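(* Let $K$ be a smooth, simple closed hypersurface in the quaternionic space $\mathbf{H}\cong\mathbb{R}^4$, disjoint from the real axis $\mathbf{R}$, let $K^*$ be its interior, and let $(n_0,n_1,n_2,n_3)$ be the outward unit normal of $K$; write $n(p)=n_0+n_1i+n_2j+n_3k$ for $p\in K$. If $f$ is a left-Cullen-regular function on a domain containing $K\cup K^*$, then $$\int_K n(p)\,f(p)\,dS_K=\int_{K^*}\Big(-\frac{2v}{r}\Big)\,dV,$$ where $dS_K$ is the element of surface area on $K$, $dV$ is the volume element of $\mathbb{R}^4$, and $v=\frac12\frac{\partial f}{\partial_l\iota}$.
   Context: $\mathbf{H}$ is the algebra of quaternions with standard basis $1,i,j,k$, and $\mathbf{R}\subset\mathbf{H}$ denotes the real quaternions. Write $p=t+xi+yj+zk$ with $t,x,y,z$ real. For $p\notin\mathbf{R}$ put $r:=\sqrt{x^2+y^2+z^2}>0$ and $\iota:=\dfrac{xi+yj+zk}{r}$, so $p=t+r\iota$. The product $n(p)f(p)$ is the quaternion product, and integrals of quaternion-valued functions are taken componentwise. A function $f$ of class $C^1$ on a domain (connected open set) $\Omega\subseteq\mathbf{H}$ with values in $\mathbf{H}$ is left-Cullen-regular if $\dfrac{\partial f}{\partial t}+\iota\dfrac{\partial f}{\partial r}=0$ (at points of $\Omega\setminus\mathbf{R}$), where $\partial/\partial r$ is differentiation with respect to $r$ in $p=t+r\iota$ with $t$ and $\iota$ held fixed, i.e. $\dfrac{\partial}{\partial r}=\dfrac1r\left(x\dfrac{\partial}{\partial x}+y\dfrac{\partial}{\partial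 y}+z\dfrac{\partial}{\partial z}\right)$. Parametrize $\iota$ by spherical coordinates, $\iota=\cos\alpha\sin\beta\, i+\sin\alpha\sin\beta\, j+\cos\beta\, k$, and let $\iota_\alpha,\iota_\beta$ be the derivatives of $\iota$ with respect to $\alpha,\beta$. In the coordinates $(t,r,\alpha,\beta)$, valid off the plane $\{t+zk\}$ (a set of measure zero, where $\sin\beta=0$ or $r=0$), define $$\frac{\partial}{\partial_l\iota}:=(\iota_\alpha)^{-1}\frac{\partial}{\partial\alpha}+(\iota_\beta)^{-1}\frac{\partial}{\partial\beta},$$ with the quaternions $(\iota_\alpha)^{-1},(\iota_\beta)^{-1}$ multiplying on the left. Thus $v=\frac12\frac{\partial f}{\partial_l\iota}$ is defined almost everywhere on $K^*$. *)

theory Defs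
  imports "HOL-Analysis.Analysis"
begin

section \<open>Quaternions as real 4-vectors\<close>

text \<open>The components \<open>p $ 1, p $ 2, p $ 3, p $ 4\<close> are the coefficients of \<open>1, i, j, k\<close>. The
  instance multiplication of \<^typ>\<open>real^4\<close> is componentwise, hence the separate symbol for the
  quaternion product.\<close>

type_synonym quat = "real^4"

definition Quat :: "real \<Rightarrow> real \<Rightarrow> real \<Rightarrow> real \<Rightarrow> quat"
  where "Quat t x y z = vector [t, x, y, z]"

lemma Quat_nth [simp]:
  "Quat t x y z $ 1 = t" "Quat t x y z $ 2 = x" "Quat t x y z $ 3 = y" "Quat t x y z $ 4 = z"
  by (simp_all add: Quat_def vector_def)

lemma quat_eq_iff: "p = q \<longleftrightarrow> p $ 1 = q $ 1 \<and> p $ 2 = q $ 2 \<and> p $ 3 = q $ 3 \<and> p $ 4 = q $ 4"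
  for p q :: quat
  by (simp add: vec_eq_iff forall_4)

definition qmult :: "quat \<Rightarrow> quat \<Rightarrow> quat"  (infixl "*\<^sub>H" 70)
  where "p *\<^sub>H q = Quat
    (p$1 * q$1 - p$2 * q$2 - p$3 * q$3 - p$4 * q$4)
    (p$1 * q$2 + p$2 * q$1 + p$3 * q$4 - p$4 * q$3)
    (p$1 * q$3 - p$2 * q$4 + p$3 * q$1 + p$4 * q$2)
    (p$1 * q$4 + p$2 * q$3 - p$3 * q$2 + p$4 * q$1)"

definition qcnj :: "quat \<Rightarrow> quat"
  where "qcnj p = Quat (p$1) (- p$2) (- p$3) (- p$4)"

definition qinv :: "quat \<Rightarrow> quat"
  where "qinv p = (1 / (norm p)\<^sup>2) *\<^sub>R qcnj p"

lemma norm_quat_sq: "(norm p)\<^sup>2 = (p$1)\<^sup>2 + (p$2)\<^sup>2 + (p$3)\<^sup>2 + (p$4)\<^sup>2" for p :: quat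
  unfolding power2_norm_eq_inner inner_vec_def by (simp add: sum_4 power2_eq_square)

lemma qmult_qinv:
  assumes "p \<noteq> 0"
  shows "p *\<^sub>H qinv p = Quat 1 0 0 0" and "qinv p *\<^sub>H p = Quat 1 0 0 0"
proof -
  define N where "N = (norm p)\<^sup>2"
  have N0: "N \<noteq> 0" using assms by (simp add: N_def)
  have N: "p$1 * p$1 + p$2 * p$2 + p$3 * p$3 + p$4 * p$4 = N"
    using norm_quat_sq[of p] unfolding N_def by (simp only: power2_eq_square)
  have "(p$1 * p$1 + p$2 * p$2 + p$3 * p$3 + p$4 * p$4) / N = 1"
    using N0 N by simp
  then show "p *\<^sub>H qinv p = Quat 1 0 0 0" "qinv p *\<^sub>H p = Quat 1 0 0 0"
    unfolding quat_eq_iff qmult_def qinv_def qcnj_def N_def[symmetric]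
    by (simp_all add: add_divide_distrib)
qed

definition real_quats :: "quat set"
  where "real_quats = range (\<lambda>t. Quat t 0 0 0)"

definition rad :: "quat \<Rightarrow> real"
  where "rad p = sqrt ((p$2)\<^sup>2 + (p$3)\<^sup>2 + (p$4)\<^sup>2)"

definition unit_im :: "quat \<Rightarrow> quat"
  where "unit_im p = (1 / rad p) *\<^sub>R Quat 0 (p$2) (p$3) (p$4)"


section \<open>Functions of class \<open>C\<^sup>k\<close> on open sets\<close>

primrec Ck_on :: "nat \<Rightarrow> ('a::euclidean_space \<Rightarrow> 'b::real_normed_vector) \<Rightarrow> 'a set \<Rightarrow> bool"
where
  "Ck_on 0 f S \<longleftrightarrow> continuous_on S f"
| "Ck_on (Suc k) f S \<longleftrightarrow> (\<forall>x\<in>S. f differentiable (at x)) \<and>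
     (\<forall>b\<in>Basis. Ck_on k (\<lambda>x. frechet_derivative f (at x) b) S)"

definition smooth_on :: "('a::euclidean_space \<Rightarrow> 'b::real_normed_vector) \<Rightarrow> 'a set \<Rightarrow> bool"
  where "smooth_on f S \<longleftrightarrow> (\<forall>k. Ck_on k f S)"


section \<open>Left-Cullen-regular functions\<close>

definition deriv_t :: "(quat \<Rightarrow> quat) \<Rightarrow> quat \<Rightarrow> quat"
  where "deriv_t f p =
    vector_derivative (\<lambda>s. f (Quat s 0 0 0 + rad p *\<^sub>R unit_im p)) (at (p$1))"

definition deriv_r :: "(quat \<Rightarrow> quat) \<Rightarrow> quat \<Rightarrow> quat"
  where "deriv_r f p =
    vector_derivative (\<lambda>s. f (Quat (p$1) 0 0 0 + s *\<^sub>R unit_im p)) (at (rad p))"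

definition left_Cullen_regular :: "(quat \<Rightarrow> quat) \<Rightarrow> quat set \<Rightarrow> bool"
  where "left_Cullen_regular f \<Omega> \<longleftrightarrow> Ck_on 1 f \<Omega> \<and>
    (\<forall>p \<in> \<Omega> - real_quats. deriv_t f p + unit_im p *\<^sub>H deriv_r f p = 0)"


section \<open>The operator \<open>\<partial>/\<partial>\<^sub>l\<iota>\<close>\<close>

definition iota :: "real \<Rightarrow> real \<Rightarrow> quat"
  where "iota \<alpha> \<beta> = Quat 0 (cos \<alpha> * sin \<beta>) (sin \<alpha> * sin \<beta>) (cos \<beta>)"

definition spherical :: "real \<Rightarrow> real \<Rightarrow> real \<Rightarrow> real \<Rightarrow> quat"
  where "spherical t r \<alpha> \<beta> = Quat t 0 0 0 + r *\<^sub>R iota \<alpha> \<beta>"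

definition iota_alpha :: "real \<Rightarrow> real \<Rightarrow> quat"
  where "iota_alpha \<alpha> \<beta> = vector_derivative (\<lambda>a. iota a \<beta>) (at \<alpha>)"

definition iota_beta :: "real \<Rightarrow> real \<Rightarrow> quat"
  where "iota_beta \<alpha> \<beta> = vector_derivative (\<lambda>b. iota \<alpha> b) (at \<beta>)"

definition angle_alpha :: "quat \<Rightarrow> real"
  where "angle_alpha p = Arg (Complex (p$2) (p$3))"

definition angle_beta :: "quat \<Rightarrow> real"
  where "angle_beta p = arccos (p$4 / rad p)"

text \<open>\<open>angle_alpha\<close> jumps across a half-space, but this does not affect \<open>deriv_iota\<close>: the derivatives
  are taken in the coordinates, in which \<open>spherical\<close> is smooth and \<open>2 * pi\<close>-periodic in \<open>\<alpha>\<close>.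
  On the null set where the coordinates degenerate (\<open>p $ 2 = p $ 3 = 0\<close>) the value is irrelevant.\<close>

definition deriv_iota :: "(quat \<Rightarrow> quat) \<Rightarrow> quat \<Rightarrow> quat"
  where "deriv_iota f p =
    (let t = p$1; r = rad p; \<alpha> = angle_alpha p; \<beta> = angle_beta p in
      qinv (iota_alpha \<alpha> \<beta>) *\<^sub>H vector_derivative (\<lambda>a. f (spherical t r a \<beta>)) (at \<alpha>)
      + qinv (iota_beta \<alpha> \<beta>) *\<^sub>H vector_derivative (\<lambda>b. f (spherical t r \<alpha> b)) (at \<beta>))"

lemma spherical_angles:
  assumes "p \<notin> real_quats"
  shows "spherical (p$1) (rad p) (angle_alpha p) (angle_beta p) = p"
proof -
  define w where "w = Complex (p$2) (p$3)"
  have r: "rad p > 0"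
  proof (rule ccontr)
    assume "\<not> rad p > 0"
    hence "(p$2)\<^sup>2 + (p$3)\<^sup>2 + (p$4)\<^sup>2 \<le> 0"
      by (simp add: rad_def)
    hence "p$2 = 0 \<and> p$3 = 0 \<and> p$4 = 0"
      by (smt (verit) power2_less_eq_zero_iff zero_le_power2)
    hence "p = Quat (p$1) 0 0 0" by (simp add: quat_eq_iff)
    with assms show False by (auto simp: real_quats_def)
  qed
  have r2: "(rad p)\<^sup>2 = (cmod w)\<^sup>2 + (p$4)\<^sup>2"
    by (simp add: rad_def w_def cmod_power2)
  have "(p$4)\<^sup>2 \<le> (rad p)\<^sup>2" using r2 by simp
  hence "\<bar>p$4\<bar> \<le> rad p" using r abs_le_square_iff[of "p$4" "rad p"] by simp
  hence le: "\<bar>p$4 / rad p\<bar> \<le> 1" using r by simp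
  have cb: "cos (angle_beta p) = p$4 / rad p"
    unfolding angle_beta_def using le by (simp add: cos_arccos_abs)
  have "sin (angle_beta p) = sqrt (1 - (p$4 / rad p)\<^sup>2)"
    unfolding angle_beta_def using le by (simp add: sin_arccos_abs)
  also have "1 - (p$4 / rad p)\<^sup>2 = (cmod w / rad p)\<^sup>2"
  proof -
    have "(cmod w)\<^sup>2 = (rad p)\<^sup>2 - (p$4)\<^sup>2" using r2 by simp
    thus ?thesis using r by (simp add: power_divide diff_divide_distrib)
  qed
  finally have sb: "sin (angle_beta p) = cmod w / rad p" using r by simp
  have "cmod w * cos (angle_alpha p) = p$2" "cmod w * sin (angle_alpha p) = p$3"
    using rcis_cmod_Arg[of w] by (auto simp: angle_alpha_def w_def complex_eq_iff)
  with r show ?thesis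
    by (simp add: quat_eq_iff spherical_def iota_def cb sb mult.commute)
qed


section \<open>Hypersurfaces, outward normals and surface measure\<close>

definition smooth_patch :: "quat set \<Rightarrow> (real^3) set \<Rightarrow> (real^3 \<Rightarrow> quat) \<Rightarrow> bool"
  where "smooth_patch K U \<phi> \<longleftrightarrow>
    open U \<and> smooth_on \<phi> U \<and> (\<forall>u\<in>U. inj (frechet_derivative \<phi> (at u))) \<and>
    openin (top_of_set K) (\<phi> ` U) \<and> (\<exists>\<psi>. homeomorphism U (\<phi> ` U) \<phi> \<psi>)"

definition smooth_simple_closed_hypersurface :: "quat set \<Rightarrow> bool"
  where "smooth_simple_closed_hypersurface K \<longleftrightarrow>
    compact K \<and> connected K \<and> (\<forall>p\<in>K. \<exists>U \<phi>. smooth_patch K U \<phi> \<and> p \<in> \<phi> ` U)"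

text \<open>The interior of the hypersurface \<open>K\<close> is the library's \<^term>\<open>inside K\<close>, the union of the
  bounded components of the complement.\<close>

definition outward_unit_normal :: "quat set \<Rightarrow> (quat \<Rightarrow> quat) \<Rightarrow> bool"
  where "outward_unit_normal K n \<longleftrightarrow> (\<forall>p\<in>K.
    norm (n p) = 1 \<and>
    (\<forall>U \<phi> u h. smooth_patch K U \<phi> \<and> u \<in> U \<and> \<phi> u = p
       \<longrightarrow> n p \<bullet> frechet_derivative \<phi> (at u) h = 0) \<and>
    (\<exists>\<epsilon>>0. \<forall>s. 0 < s \<and> s < \<epsilon>
       \<longrightarrow> p + s *\<^sub>R n p \<in> outside K \<and> p - s *\<^sub>R n p \<in> inside K))"

text \<open>Square root of the Gram determinant of the partial derivatives of a parametrization.\<close>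

definition area_density :: "(real^3 \<Rightarrow> quat) \<Rightarrow> real^3 \<Rightarrow> real"
  where "area_density \<phi> u =
    (let A = matrix (frechet_derivative \<phi> (at u)) in sqrt (det (transpose A ** A)))"

text \<open>The surface measure is the unique Borel measure on \<open>K\<close> that is given by the area formula in
  every local parametrization.\<close>

definition is_surface_measure :: "quat set \<Rightarrow> quat measure \<Rightarrow> bool"
  where "is_surface_measure K M \<longleftrightarrow>
    sets M = sets (restrict_space borel K) \<and>
    (\<forall>U \<phi> A. smooth_patch K U \<phi> \<and> A \<in> sets borel \<and> A \<subseteq> \<phi> ` U \<longrightarrow>
       emeasure M A = (\<integral>\<^sup>+u\<in>{u\<in>U. \<phi> u \<in> A}. ennreal (area_density \<phi> u) \<partial>lborel))"

definition surface_measure :: "quat set \<Rightarrow> quat measure"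
  where "surface_measure K = (THE M. is_surface_measure K M)"

end

theory Submission
  imports Defs
begin

text \<open>With \<open>D f = \<partial>\<^sub>t f + i \<partial>\<^sub>x f + j \<partial>\<^sub>y f + k \<partial>\<^sub>z f\<close>, the divergence theorem applied to the
  components of \<open>n f\<close> gives \<open>\<integral>\<^sub>K n f dS = \<integral> D f dV\<close> over the interior. In the orthonormal frame
  \<open>\<iota>, \<iota>\<^sub>\<alpha> / sin \<beta>, \<iota>\<^sub>\<beta>\<close> one has \<open>D f = \<partial>\<^sub>t f + \<iota> \<partial>\<^sub>r f - (1 / r) \<partial>f/\<partial>\<^sub>l\<iota>\<close>, because the inverse of an
  imaginary quaternion \<open>q\<close> is \<open>- q / \<bar>q\<bar>\<^sup>2\<close>; Cullen regularity removes the first two terms.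

  The divergence theorem is localised by a partition of unity. Near a point of \<open>K\<close> and for a
  constant vector \<open>w\<close> transversal to \<open>K\<close>, the map \<open>(u, s) \<mapsto> \<phi> u + s w\<close> is a diffeomorphism under
  which the interior becomes \<open>s < 0\<close>, its Jacobian is \<open>n \<bullet> w\<close> times the area density, and the
  derivative in direction \<open>w\<close> becomes \<open>\<partial>/\<partial>s\<close>. Transversal vectors span the space, so linearity in
  \<open>w\<close> covers all directions and no integration by parts along \<open>K\<close> is needed.\<close>

section \<open>Splitting off the fourth coordinate\<close>

text \<open>The hypotheses describe \<open>K\<close> only pointwise: the normal is orthogonal to
  tangent vectors and points outwards along short normal segments, with no continuity in the point
  and no uniform length. Two facts have to be extracted from this. Each half of a thin slab is
  connected and misses \<open>K\<close>, so one point of a normal segment decides whether the whole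
  half lies inside or outside. Determinants of slab maps then express the normal through the
  parametrization, which gives its continuity and so the integrability of \<open>n f\<close> on
  \<open>K\<close>. The surface measure is given by a definite description, so its existence and
  uniqueness, in essence the independence of the area formula from the parametrization, must be
  settled before an integral over \<open>K\<close> can be computed. The right-hand integrand is
  uncontrolled where the spherical coordinates degenerate; the integrals are therefore taken of the
  continuous function \<open>fueter (D p)\<close>, and the stated integrand enters at the end, up to
  a null set. Division by \<open>r\<close> is harmless: the real axis is connected, unbounded and
  disjoint from \<open>K\<close>, so it cannot meet the interior.\<close>

definition proj3 :: "quat \<Rightarrow> real^3"
  where "proj3 y = vector [y $ 1, y $ 2, y $ 3]"

text \<open>Patches live on \<open>real^3\<close>, while the change of variables theorem compares
  two regions of one space \<open>real^'m\<close>. The pair of a surface parameter and a height is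
  therefore stored as one vector of \<open>real^4\<close>.\<close>

definition ext4 :: "real^3 \<Rightarrow> real \<Rightarrow> quat"
  where "ext4 u s = Quat (u $ 1) (u $ 2) (u $ 3) s"

lemma proj3_nth [simp]: "proj3 y $ 1 = y $ 1" "proj3 y $ 2 = y $ 2" "proj3 y $ 3 = y $ 3"
  by (simp_all add: proj3_def)

lemma ext4_nth [simp]:
  "ext4 u s $ 1 = u $ 1" "ext4 u s $ 2 = u $ 2" "ext4 u s $ 3 = u $ 3" "ext4 u s $ 4 = s"
  by (simp_all add: ext4_def)

lemma proj3_ext4 [simp]: "proj3 (ext4 u s) = u"
  by (simp add: vec_eq_iff forall_3)

lemma ext4_proj3 [simp]: "ext4 (proj3 y) (y $ 4) = y"
  by (simp add: quat_eq_iff)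

lemma linear_proj3: "linear proj3"
  by (rule linearI) (simp_all add: vec_eq_iff forall_3)

lemma bounded_linear_proj3: "bounded_linear proj3"
  using linear_proj3 linear_conv_bounded_linear by blast

lemma linear_ext4: "linear (\<lambda>(u, s). ext4 u s)"
  by (rule linearI) (auto simp: quat_eq_iff)

lemma bounded_linear_ext4: "bounded_linear (\<lambda>(u, s). ext4 u s)"
  using linear_ext4 linear_conv_bounded_linear by blast

lemma proj3_diff: "proj3 (x - y) = proj3 x - proj3 y"
  using linear_proj3 by (rule linear_diff)

lemma norm_proj3_sq: "(norm (proj3 y))\<^sup>2 + (y $ 4)\<^sup>2 = (norm y)\<^sup>2"
  unfolding norm_quat_sq power2_norm_eq_inner[of "proj3 y"]
  by (simp add: inner_vec_def sum_3 power2_eq_square)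

lemma norm_le_proj3: "norm y \<le> norm (proj3 y) + \<bar>y $ 4\<bar>"
proof -
  have "(norm y)\<^sup>2 = (norm (proj3 y))\<^sup>2 + \<bar>y $ 4\<bar>\<^sup>2"
    by (simp add: norm_proj3_sq)
  also have "\<dots> \<le> (norm (proj3 y) + \<bar>y $ 4\<bar>)\<^sup>2"
    by (simp add: power2_sum)
  finally show ?thesis
    by (rule power2_le_imp_le) simp
qed

lemma box_Pair: "box (a, c) (b, d) = box a b \<times> box c d"
  by (auto simp: mem_box Basis_prod_def ball_Un)

lemma prod_Basis_vec: "(\<Prod>b\<in>Basis. x \<bullet> b) = (\<Prod>i\<in>UNIV. x $ i)" for x :: "real^'n"
proof -
  have B: "(Basis :: (real^'n) set) = range (\<lambda>i. axis i 1)"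
    by (auto simp: Basis_vec_def)
  have "inj (\<lambda>i. axis i 1 :: real^'n)"
    by (auto simp: inj_on_def axis_eq_axis)
  then show ?thesis
    unfolding B by (subst prod.reindex) (simp_all add: inner_axis)
qed

text \<open>Lebesgue measure is determined by the volumes of boxes, and the preimage of a box is a
  product of boxes. This gives access to Fubini with the fourth coordinate as inner
  variable.\<close>

lemma lborel_quat_split: "distr lborel lborel (\<lambda>(u, s). ext4 u s) = (lborel :: quat measure)"
proof (rule lborel_eqI[symmetric])
  have meas: "(\<lambda>(u, s). ext4 u s) \<in> measurable lborel lborel"
    by (simp add: borel_measurable_continuous_onI linear_continuous_on bounded_linear_ext4)
  fix l u :: quat
  assume le: "\<And>b. b \<in> Basis \<Longrightarrow> l \<bullet> b \<le> u \<bullet> b"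
  have *: "(\<lambda>(u, s). ext4 u s) -` box l u = box (proj3 l, l $ 4) (proj3 u, u $ 4)"
    by (auto simp: mem_box_cart box_Pair forall_3 forall_4)
  have le': "l $ i \<le> u $ i" for i
    using le[of "axis i 1"] by (simp add: inner_axis)
  have p3: "proj3 l $ i \<le> proj3 u $ i" for i
    using le'[of 1] le'[of 2] le'[of 3] exhaust_3[of i] by auto
  have "emeasure (distr lborel lborel (\<lambda>(u, s). ext4 u s)) (box l u)
      = emeasure lborel (box (proj3 l, l $ 4) (proj3 u, u $ 4))"
    using meas * by (subst emeasure_distr) auto
  also have "\<dots> = emeasure lborel (box (proj3 l) (proj3 u)) * emeasure lborel (box (l $ 4) (u $ 4))"
    unfolding box_Pair by (subst lborel_prod[symmetric], subst lborel.emeasure_pair_measure_Times) auto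
  also have "\<dots> = ennreal (\<Prod>i\<in>UNIV. (proj3 u - proj3 l) $ i) * ennreal (u $ 4 - l $ 4)"
  proof -
    have "emeasure lborel (box (proj3 l) (proj3 u)) = ennreal (\<Prod>b\<in>Basis. (proj3 u - proj3 l) \<bullet> b)"
      using le' by (intro emeasure_lborel_box) (auto simp: Basis_vec_def inner_axis p3)
    also have "(\<Prod>b\<in>Basis. (proj3 u - proj3 l) \<bullet> b) = (\<Prod>i\<in>UNIV. (proj3 u - proj3 l) $ i)"
      by (rule prod_Basis_vec)
    finally show ?thesis
      using le'[of 4] by simp
  qed
  also have "\<dots> = ennreal (\<Prod>i\<in>UNIV. (u - l) $ i)"
  proof -
    have "(\<Prod>i\<in>UNIV. (proj3 u - proj3 l) $ i) * (u $ 4 - l $ 4) = (\<Prod>i\<in>UNIV. (u - l) $ i)"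
      unfolding UNIV_3 UNIV_4 by simp
    moreover have "(\<Prod>i\<in>UNIV. (proj3 u - proj3 l) $ i) \<ge> 0"
      by (rule prod_nonneg) (simp add: p3)
    ultimately show ?thesis
      using le'[of 4] by (metis ennreal_mult diff_ge_0_iff_ge)
  qed
  also have "\<dots> = ennreal (\<Prod>b\<in>Basis. (u - l) \<bullet> b)"
    by (simp add: prod_Basis_vec)
  finally show "emeasure (distr lborel lborel (\<lambda>(u, s). ext4 u s)) (box l u) = ennreal (\<Prod>b\<in>Basis. (u - l) \<bullet> b)" .
qed simp

text \<open>The thickening direction \<open>w\<close> is constant, so the Jacobian does not depend on the fourth
  coordinate and the divergence theorem in direction \<open>w\<close> reduces to the fundamental theorem of
  calculus in that coordinate.\<close>

definition slab_map :: "(real^3 \<Rightarrow> quat) \<Rightarrow> quat \<Rightarrow> quat \<Rightarrow> quat"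
  where "slab_map \<phi> w y = \<phi> (proj3 y) + (y $ 4) *\<^sub>R w"

lemma slab_map_ext4 [simp]: "slab_map \<phi> w (ext4 u s) = \<phi> u + s *\<^sub>R w"
  by (simp add: slab_map_def)

lemma has_derivative_slab_map:
  assumes "(\<phi> has_derivative D) (at (proj3 y))"
  shows "(slab_map \<phi> w has_derivative slab_map D w) (at y)"
proof -
  have "((\<lambda>y. \<phi> (proj3 y)) has_derivative (\<lambda>h. D (proj3 h))) (at y)"
    using has_derivative_compose[OF bounded_linear_imp_has_derivative[OF bounded_linear_proj3] assms] .
  moreover have "((\<lambda>y. (y $ 4) *\<^sub>R w) has_derivative (\<lambda>h. (h $ 4) *\<^sub>R w)) (at y)"
    by (intro derivative_eq_intros bounded_linear_imp_has_derivative) (auto intro!: bounded_linear_intros)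
  ultimately show ?thesis
    unfolding slab_map_def by (rule has_derivative_add)
qed

lemma linear_slab_map: "linear D \<Longrightarrow> linear (slab_map D w)"
  unfolding slab_map_def
  by (rule linearI) (simp_all add: linear_add linear_cmul linear_proj3 algebra_simps)


section \<open>Determinants of slab maps and the Gram determinant\<close>

lemma det_4_last_row:
  fixes A :: "real^4^4"
  assumes "A $ 4 $ 1 = 0" "A $ 4 $ 2 = 0" "A $ 4 $ 3 = 0"
  shows "det A = A $ 4 $ 4 * (A$1$1 * A$2$2 * A$3$3 +
    A$1$2 * A$2$3 * A$3$1 +
    A$1$3 * A$2$1 * A$3$2 -
    A$1$1 * A$2$3 * A$3$2 -
    A$1$2 * A$2$1 * A$3$3 -
    A$1$3 * A$2$2 * A$3$1)"
proof -
  have f1234: "finite {2::4, 3, 4}" "1 \<notin> {2::4, 3, 4}"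
    by auto
  have f234: "finite {3::4, 4}" "2 \<notin> {3::4, 4}"
    by auto
  have f34: "finite {4::4}" "3 \<notin> {4::4}"
    by auto
  show ?thesis
    unfolding det_def UNIV_4
    unfolding sum_over_permutations_insert[OF f1234]
    unfolding sum_over_permutations_insert[OF f234]
    unfolding sum_over_permutations_insert[OF f34]
    unfolding permutes_sing
    using assms
    by (simp add: sign_swap_id permutation_swap_id permutation_compose sign_compose sign_id swap_id_eq algebra_simps)
qed

lemma proj3_axis [simp]:
  "proj3 (axis 1 1) = axis 1 1" "proj3 (axis 2 1) = axis 2 1" "proj3 (axis 3 1) = axis 3 1"
  "proj3 (axis 4 1) = 0"
  by (simp_all add: vec_eq_iff forall_3 axis_def)

lemma matrix_transpose_mult_nth:
  fixes D :: "real^'n \<Rightarrow> real^'m" and E :: "real^'k \<Rightarrow> real^'m"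
  shows "(transpose (matrix D) ** matrix E) $ i $ j = D (axis i 1) \<bullet> E (axis j 1)"
  by (simp add: matrix_matrix_mult_def transpose_def matrix_def inner_vec_def)

text \<open>The columns are those of \<open>D\<close>, followed by \<open>m\<close> or
  \<open>w\<close>. As \<open>m\<close> is orthogonal to the range of \<open>D\<close>, the last row
  of the transposed first matrix times the second is \<open>(0, 0, 0, m \<bullet> w)\<close>, and
  the upper left block is the Gram matrix of \<open>D\<close>.\<close>

lemma det_slab_map_mult:
  fixes D :: "real^3 \<Rightarrow> quat"
  assumes D: "linear D" and orth: "\<And>h. m \<bullet> D h = 0"
  shows "det (matrix (slab_map D m)) * det (matrix (slab_map D w))
    = det (transpose (matrix D) ** matrix D) * (m \<bullet> w)"
proof -
  have D0: "D 0 = 0"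
    using D by (rule linear_0)
  have orth': "D h \<bullet> m = 0" for h
    using orth by (simp add: inner_commute)
  have ax4: "axis 1 1 $ (4::4) = (0::real)" "axis 2 1 $ (4::4) = (0::real)" "axis 3 1 $ (4::4) = (0::real)"
    "axis 4 1 $ (4::4) = (1::real)"
    by (simp_all add: axis_def)
  have "det (matrix (slab_map D m)) * det (matrix (slab_map D w))
      = det (transpose (matrix (slab_map D m)) ** matrix (slab_map D w))"
    by (simp add: det_mul)
  also have "\<dots> = (m \<bullet> w) * det (transpose (matrix D) ** matrix D)"
    by (subst det_4_last_row)
       (simp_all add: matrix_transpose_mult_nth det_3 slab_map_def D0 orth orth' ax4)
  finally show ?thesis by simp
qed

lemma abs_det_slab_map:
  fixes D :: "real^3 \<Rightarrow> quat"
  assumes D: "linear D" "inj D" and m: "norm m = 1" "\<And>h. m \<bullet> D h = 0"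
  shows "\<bar>det (matrix (slab_map D w))\<bar> = \<bar>m \<bullet> w\<bar> * sqrt (det (transpose (matrix D) ** matrix D))"
    and "det (transpose (matrix D) ** matrix D) > 0"
    and "det (matrix (slab_map D w)) = det (matrix (slab_map D m)) * (m \<bullet> w)"
    and "det (matrix (slab_map D m)) \<noteq> 0"
proof -
  define c where "c = det (matrix (slab_map D m))"
  define d where "d = det (transpose (matrix D) ** matrix D)"
  have mm: "m \<bullet> m = 1"
    using m(1) by (simp add: norm_eq_1)
  have "inj (slab_map D m)"
  proof (subst linear_injective_0[OF linear_slab_map[OF D(1)]], intro allI impI)
    fix y assume y: "slab_map D m y = 0"
    then have "m \<bullet> (D (proj3 y) + (y $ 4) *\<^sub>R m) = 0"
      by (simp add: slab_map_def)
    then have y4: "y $ 4 = 0"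
      by (simp add: inner_right_distrib m mm)
    then have "D (proj3 y) = 0"
      using y by (simp add: slab_map_def)
    then have "proj3 y = 0"
      using D linear_injective_0 by blast
    with y4 show "y = 0"
      by (metis ext4_proj3 proj3_ext4 linear_0 linear_proj3 zero_index)
  qed
  then show c0: "det (matrix (slab_map D m)) \<noteq> 0"
    using det_nz_iff_inj linear_slab_map[OF D(1)] by blast
  \<comment> \<open>The case \<open>w = m\<close>: the Gram determinant is a nonzero square, which
    gives its positivity and its root.\<close>
  have dc: "d = c * c"
    using det_slab_map_mult[OF D(1) m(2), of m] mm by (simp add: c_def d_def)
  then show "det (transpose (matrix D) ** matrix D) > 0"
    using c0 by (simp add: c_def d_def zero_less_mult_iff) linarith
  have "c * det (matrix (slab_map D w)) = d * (m \<bullet> w)"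
    using det_slab_map_mult[OF D(1) m(2), of w] by (simp add: c_def d_def)
  then show *: "det (matrix (slab_map D w)) = det (matrix (slab_map D m)) * (m \<bullet> w)"
    using c0 by (simp add: dc c_def[symmetric])
  show "\<bar>det (matrix (slab_map D w))\<bar> = \<bar>m \<bullet> w\<bar> * sqrt (det (transpose (matrix D) ** matrix D))"
    unfolding * d_def[symmetric] dc by (simp add: abs_mult c_def real_sqrt_abs2)
qed

section \<open>Continuously differentiable maps and charts of the ambient space\<close>

text \<open>The derivative is an argument, so that sums, products and quotients of cutoff functions
  carry explicit derivatives. Since the domain is finite-dimensional, continuity in each direction
  \<open>h\<close> amounts to continuity in operator norm.\<close>

definition C1_on :: "('a::euclidean_space \<Rightarrow> 'b::real_normed_vector) \<Rightarrow> ('a \<Rightarrow> 'a \<Rightarrow> 'b) \<Rightarrow> 'a set \<Rightarrow> bool"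
  where "C1_on f f' S \<longleftrightarrow>
    (\<forall>x\<in>S. (f has_derivative f' x) (at x)) \<and> (\<forall>h. continuous_on S (\<lambda>x. f' x h))"

lemma C1_onD:
  assumes "C1_on f f' S"
  shows "x \<in> S \<Longrightarrow> (f has_derivative f' x) (at x)"
    and "continuous_on S (\<lambda>x. f' x h)"
  using assms unfolding C1_on_def by blast+

lemma C1_on_subset: "C1_on f f' S \<Longrightarrow> T \<subseteq> S \<Longrightarrow> C1_on f f' T"
  unfolding C1_on_def by (meson continuous_on_subset subsetD)

lemma C1_on_continuous: "C1_on f f' S \<Longrightarrow> continuous_on S f"
  by (meson C1_onD(1) continuous_at_imp_continuous_on has_derivative_continuous)

lemma C1_on_linear: "C1_on f f' S \<Longrightarrow> x \<in> S \<Longrightarrow> linear (f' x)"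
  using C1_onD(1) has_derivative_linear by blast

lemma continuous_on_linear_family:
  fixes D :: "'c::topological_space \<Rightarrow> 'a::euclidean_space \<Rightarrow> 'b::real_normed_vector"
  assumes lin: "\<And>x. x \<in> S \<Longrightarrow> linear (D x)" and cont: "\<And>b. b \<in> Basis \<Longrightarrow> continuous_on S (\<lambda>x. D x b)"
    and h: "continuous_on S h"
  shows "continuous_on S (\<lambda>x. D x (h x))"
proof (rule continuous_on_cong[THEN iffD2])
  show "D x (h x) = (\<Sum>b\<in>Basis. (h x \<bullet> b) *\<^sub>R D x b)" if "x \<in> S" for x
    using linear_sum[OF lin[OF that], of "\<lambda>b. (h x \<bullet> b) *\<^sub>R b" Basis] lin[OF that]
    by (simp add: euclidean_representation linear_scale)
  show "continuous_on S (\<lambda>x. \<Sum>b\<in>Basis. (h x \<bullet> b) *\<^sub>R D x b)"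
    by (intro continuous_intros cont h)
qed simp

text \<open>\<open>Ck_on\<close> controls the derivative in basis directions only; linearity extends
  this to every direction.\<close>

lemma Ck_on_1_imp_C1_on:
  assumes "Ck_on 1 f S"
  shows "C1_on f (\<lambda>x. frechet_derivative f (at x)) S"
proof -
  have 1: "(f has_derivative frechet_derivative f (at x)) (at x)" if "x \<in> S" for x
    using assms that by (simp flip: frechet_derivative_works)
  have "continuous_on S (\<lambda>x. frechet_derivative f (at x) h)" for h
  proof (rule continuous_on_linear_family)
    show "linear (frechet_derivative f (at x))" if "x \<in> S" for x
      using 1[OF that] by (rule has_derivative_linear)
    show "continuous_on S (\<lambda>x. frechet_derivative f (at x) b)" if "b \<in> Basis" for b
      using assms that by simp
  qed simp
  with 1 show ?thesis
    by (auto simp: C1_on_def)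
qed

text \<open>The inverse function theorem asks for a derivative that is continuous as a map into the
  bounded linear operators; \<open>F\<close> is \<open>f'\<close> in that form, and its continuity
  is checked componentwise. Of the derivative of the inverse, only its being a right inverse of
  \<open>f'\<close> is recorded.\<close>

lemma C1_inverse_function:
  fixes f :: "'a::euclidean_space \<Rightarrow> 'a"
  assumes "open U" and f: "C1_on f f' U" and x0: "x0 \<in> U" and inj: "inj (f' x0)"
  obtains U' V g g' where "open U'" "U' \<subseteq> U" "x0 \<in> U'" "open V" "f x0 \<in> V" "homeomorphism U' V f g"
    "\<And>y. y \<in> V \<Longrightarrow> (g has_derivative g' y) (at y)"
    "\<And>y h. y \<in> V \<Longrightarrow> f' (g y) (g' y h) = h"
proof -
  define F where "F x = Blinfun (f' x)" for x
  have F: "blinfun_apply (F x) = f' x" if "x \<in> U" for x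
    using C1_on_linear[OF f that] by (simp add: F_def bounded_linear_Blinfun_apply linear_conv_bounded_linear)
  have der: "(f has_derivative blinfun_apply (F x)) (at x)" if "x \<in> U" for x
    using C1_onD(1)[OF f that] F[OF that] by simp
  have cont: "continuous_on U F"
    by (rule continuous_on_blinfun_componentwise, rule continuous_on_eq[OF C1_onD(2)[OF f]])
       (simp add: F)
  obtain L where L: "linear L" "L \<circ> f' x0 = id"
    using linear_injective_left_inverse[OF C1_on_linear[OF f x0] inj] by blast
  have LB: "blinfun_apply (Blinfun L) = L"
    using L(1) by (simp add: bounded_linear_Blinfun_apply linear_conv_bounded_linear)
  have "Blinfun L o\<^sub>L F x0 = id_blinfun"
    by (rule blinfun_eqI) (use L(2) LB F[OF x0] in \<open>simp add: fun_eq_iff\<close>)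
  from inverse_function_theorem[OF \<open>open U\<close> der cont x0 this]
  obtain U' V g g' where *: "open U'" "U' \<subseteq> U" "x0 \<in> U'" "open V" "f x0 \<in> V" "homeomorphism U' V f g"
    "\<And>y. y \<in> V \<Longrightarrow> (g has_derivative g' y) (at y)"
    "\<And>y. y \<in> V \<Longrightarrow> g' y = inv (blinfun_apply (F (g y)))"
    "\<And>y. y \<in> V \<Longrightarrow> bij (blinfun_apply (F (g y)))"
    by blast
  have "f' (g y) (g' y h) = h" if "y \<in> V" for y h
  proof -
    have "g y \<in> U"
      using *(2,6) that by (auto simp: homeomorphism_def)
    then show ?thesis
      using *(8,9)[OF that] F by (simp add: bij_is_surj surj_f_inv_f)
  qed
  with * that show ?thesis by blast
qed

lemma C1_on_slab_map:
  assumes "C1_on \<phi> D U"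
  shows "C1_on (slab_map \<phi> w) (\<lambda>y. slab_map (D (proj3 y)) w) (proj3 -` U)"
  unfolding C1_on_def
proof (intro conjI ballI allI)
  show "(slab_map \<phi> w has_derivative slab_map (D (proj3 y)) w) (at y)" if "y \<in> proj3 -` U" for y
    using that C1_onD(1)[OF assms] by (intro has_derivative_slab_map) auto
  show "continuous_on (proj3 -` U) (\<lambda>y. slab_map (D (proj3 y)) w h)" for h
    unfolding slab_map_def
    using continuous_on_compose2[OF C1_onD(2)[OF assms] linear_continuous_on[OF bounded_linear_proj3]]
    by (intro continuous_intros) auto
qed

lemma open_vimage_proj3: "open U \<Longrightarrow> open (proj3 -` U)"
  by (rule continuous_open_vimage) (simp_all add: linear_continuous_at bounded_linear_proj3)

section \<open>Smooth patches and their slab charts\<close>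

abbreviation tangent_map :: "(real^3 \<Rightarrow> quat) \<Rightarrow> real^3 \<Rightarrow> real^3 \<Rightarrow> quat"
  where "tangent_map \<phi> u \<equiv> frechet_derivative \<phi> (at u)"

lemma Ck_on_subset: "Ck_on k f S \<Longrightarrow> T \<subseteq> S \<Longrightarrow> Ck_on k f T"
proof (induction k arbitrary: f)
  case 0
  then show ?case by (simp add: continuous_on_subset)
next
  case (Suc k)
  then show ?case by (auto)
qed

lemma smooth_patchD:
  assumes "smooth_patch K U \<phi>"
  shows "open U" "C1_on \<phi> (tangent_map \<phi>) U" "u \<in> U \<Longrightarrow> inj (tangent_map \<phi> u)"
    "openin (top_of_set K) (\<phi> ` U)" "inj_on \<phi> U" "continuous_on U \<phi>" "\<phi> ` U \<subseteq> K"
    "u \<in> U \<Longrightarrow> linear (tangent_map \<phi> u)"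
proof -
  show 1: "C1_on \<phi> (tangent_map \<phi>) U"
    using assms by (intro Ck_on_1_imp_C1_on) (simp add: smooth_patch_def smooth_on_def del: Ck_on.simps)
  show "continuous_on U \<phi>"
    using 1 by (rule C1_on_continuous)
  show "u \<in> U \<Longrightarrow> linear (tangent_map \<phi> u)"
    using 1 C1_on_linear by blast
  show "inj_on \<phi> U"
  proof -
    obtain \<psi> where "homeomorphism U (\<phi> ` U) \<phi> \<psi>"
      using assms unfolding smooth_patch_def by blast
    then show ?thesis
      by (intro inj_on_inverseI[where g = \<psi>]) (simp add: homeomorphism_def)
  qed
  show "\<phi> ` U \<subseteq> K"
    using assms openin_subset[of "top_of_set K" "\<phi> ` U"] unfolding smooth_patch_def by simp
  show "open U" "openin (top_of_set K) (\<phi> ` U)"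
    using assms unfolding smooth_patch_def by simp_all
  show "u \<in> U \<Longrightarrow> inj (tangent_map \<phi> u)"
    using assms unfolding smooth_patch_def by simp
qed

lemma smooth_patch_subset:
  assumes \<phi>: "smooth_patch K U \<phi>" and U': "open U'" "U' \<subseteq> U"
  shows "smooth_patch K U' \<phi>"
proof -
  obtain \<psi> where \<psi>: "homeomorphism U (\<phi> ` U) \<phi> \<psi>"
    using \<phi> by (auto simp: smooth_patch_def)
  then have "homeomorphism U' (\<phi> ` U') \<phi> \<psi>"
    using U'(2) by (rule homeomorphism_of_subsets) auto
  moreover have "openin (top_of_set (\<phi> ` U)) (\<phi> ` U')"
    using homeomorphism_imp_open_map[OF \<psi>, of U'] U' by (simp add: open_subset)
  then have "openin (top_of_set K) (\<phi> ` U')"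
    using smooth_patchD(4)[OF \<phi>] openin_trans[of "\<phi> ` U"] by blast
  ultimately show ?thesis
    using \<phi> U' unfolding smooth_patch_def smooth_on_def
    by (auto intro: Ck_on_subset)
qed

lemma slab_chart:
  assumes \<phi>: "smooth_patch K U \<phi>" and u0: "u0 \<in> U" and inj: "inj (slab_map (tangent_map \<phi> u0) w)"
  obtains U' V \<Psi> \<Psi>' where "open U'" "proj3 ` U' \<subseteq> U" "ext4 u0 0 \<in> U'" "open V" "\<phi> u0 \<in> V"
    "homeomorphism U' V (slab_map \<phi> w) \<Psi>"
    "\<And>q. q \<in> V \<Longrightarrow> (\<Psi> has_derivative \<Psi>' q) (at q)"
    "\<And>q h. q \<in> V \<Longrightarrow> slab_map (tangent_map \<phi> (proj3 (\<Psi> q))) w (\<Psi>' q h) = h"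
proof -
  have 0: "ext4 u0 0 \<in> proj3 -` U" "inj (slab_map (tangent_map \<phi> (proj3 (ext4 u0 0))) w)"
    using u0 inj by simp_all
  show thesis
  proof (rule C1_inverse_function[OF open_vimage_proj3[OF smooth_patchD(1)[OF \<phi>]]
      C1_on_slab_map[OF smooth_patchD(2)[OF \<phi>]] 0])
    fix U' V \<Psi> \<Psi>'
    assume *: "open U'" "U' \<subseteq> proj3 -` U" "ext4 u0 0 \<in> U'" "open V"
      "slab_map \<phi> w (ext4 u0 0) \<in> V" "homeomorphism U' V (slab_map \<phi> w) \<Psi>"
      "\<And>q. q \<in> V \<Longrightarrow> (\<Psi> has_derivative \<Psi>' q) (at q)"
      "\<And>q h. q \<in> V \<Longrightarrow> slab_map (tangent_map \<phi> (proj3 (\<Psi> q))) w (\<Psi>' q h) = h"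
    show thesis
      by (rule that[OF *(1) _ *(3,4) _ *(6-8)]) (use *(2,5) in auto)
  qed
qed

section \<open>The two sides of the hypersurface\<close>

definition slab :: "(real^3) set \<Rightarrow> real \<Rightarrow> quat set"
  where "slab U \<delta> = {y. proj3 y \<in> U \<and> \<bar>y $ 4\<bar> < \<delta>}"

lemma open_slab: "open U \<Longrightarrow> open (slab U \<delta>)"
proof -
  assume "open U"
  then have "open (proj3 -` U \<inter> {y. \<bar>y $ 4\<bar> < \<delta>})"
    by (intro open_Int open_vimage_proj3 open_Collect_less continuous_intros)
  then show ?thesis
    by (simp add: slab_def vimage_def Int_def)
qed

lemma slab_subset_open:
  assumes "open G" "ext4 u 0 \<in> G"
  obtains \<rho> where "\<rho> > 0" "slab (ball u \<rho>) \<rho> \<subseteq> G"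
proof -
  obtain e where e: "e > 0" "ball (ext4 u 0) e \<subseteq> G"
    using assms openE by blast
  have "slab (ball u (e/2)) (e/2) \<subseteq> ball (ext4 u 0) e"
  proof
    fix y assume "y \<in> slab (ball u (e/2)) (e/2)"
    then have "norm (proj3 (ext4 u 0 - y)) < e/2" "\<bar>(ext4 u 0 - y) $ 4\<bar> < e/2"
      by (auto simp: slab_def proj3_diff dist_norm)
    then show "y \<in> ball (ext4 u 0) e"
      using norm_le_proj3[of "ext4 u 0 - y"] by (simp add: dist_norm)
  qed
  with e that[of "e/2"] show thesis by auto
qed

text \<open>Convexity supplies the connectedness of half a slab; the sign \<open>\<sigma>\<close>
  covers both halves at once.\<close>

lemma convex_half_slab:
  assumes "convex U"
  shows "convex {y \<in> slab U \<delta>. 0 < \<sigma> * y $ 4}"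
proof -
  have lin: "linear (\<lambda>y::quat. y $ 4)"
    by (rule linearI) auto
  have "convex (proj3 -` U \<inter> (\<lambda>y. y $ 4) -` ({-\<delta><..<\<delta>} \<inter> {s. 0 < \<sigma> * s}))"
    using assms lin linear_proj3 convex_halfspace_gt[of 0 \<sigma>]
    by (intro convex_Int convex_linear_vimage convex_real_interval) (simp_all add: inner_real_def)
  also have "proj3 -` U \<inter> (\<lambda>y. y $ 4) -` ({-\<delta><..<\<delta>} \<inter> {s. 0 < \<sigma> * s}) = {y \<in> slab U \<delta>. 0 < \<sigma> * y $ 4}"
    by (auto simp: slab_def)
  finally show ?thesis .
qed

lemma outward_unit_normalD:
  assumes n: "outward_unit_normal K n" and \<phi>: "smooth_patch K U \<phi>" and u: "u \<in> U"
  shows "norm (n (\<phi> u)) = 1" "n (\<phi> u) \<bullet> tangent_map \<phi> u h = 0"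
    "\<exists>\<epsilon>>0. \<forall>s. 0 < s \<and> s < \<epsilon> \<longrightarrow> \<phi> u + s *\<^sub>R n (\<phi> u) \<in> outside K \<and> \<phi> u - s *\<^sub>R n (\<phi> u) \<in> inside K"
proof -
  have "\<phi> u \<in> K"
    using smooth_patchD(7)[OF \<phi>] u by blast
  then have *: "norm (n (\<phi> u)) = 1 \<and>
    (\<forall>U \<phi>' u' h. smooth_patch K U \<phi>' \<and> u' \<in> U \<and> \<phi>' u' = \<phi> u \<longrightarrow> n (\<phi> u) \<bullet> tangent_map \<phi>' u' h = 0) \<and>
    (\<exists>\<epsilon>>0. \<forall>s. 0 < s \<and> s < \<epsilon> \<longrightarrow> \<phi> u + s *\<^sub>R n (\<phi> u) \<in> outside K \<and> \<phi> u - s *\<^sub>R n (\<phi> u) \<in> inside K)"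
    using n unfolding outward_unit_normal_def by blast
  then show "norm (n (\<phi> u)) = 1"
    "\<exists>\<epsilon>>0. \<forall>s. 0 < s \<and> s < \<epsilon> \<longrightarrow> \<phi> u + s *\<^sub>R n (\<phi> u) \<in> outside K \<and> \<phi> u - s *\<^sub>R n (\<phi> u) \<in> inside K"
    by simp_all
  show "n (\<phi> u) \<bullet> tangent_map \<phi> u h = 0"
    using * \<phi> u by simp
qed

text \<open>Transversality of \<open>w\<close> makes the Jacobian of the slab map nonzero, because
  it is \<open>m \<bullet> w\<close> times the nonzero Jacobian for \<open>m\<close> itself.\<close>

lemma inj_slab_map_tangent:
  assumes "smooth_patch K U \<phi>" "u \<in> U" "norm m = 1" "\<And>h. m \<bullet> tangent_map \<phi> u h = 0" "m \<bullet> w \<noteq> 0"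
  shows "inj (slab_map (tangent_map \<phi> u) w)"
proof -
  have D: "linear (tangent_map \<phi> u)" "inj (tangent_map \<phi> u)"
    using smooth_patchD(3,8)[OF assms(1,2)] by blast+
  have "det (matrix (slab_map (tangent_map \<phi> u) w)) \<noteq> 0"
    using abs_det_slab_map(4)[OF D assms(3,4)] assms(5)
    by (simp add: abs_det_slab_map(3)[OF D assms(3,4), of w])
  then show ?thesis
    by (rule det_nz_iff_inj[OF linear_slab_map[OF D(1)], THEN iffD1])
qed

text \<open>Moving off the hypersurface along its normal changes the slab coordinate \<open>y $ 4\<close> at the
  rate \<open>1 / (n \<bullet> w)\<close>.\<close>

lemma slab_coordinate_along_normal:
  assumes der: "(\<Psi> has_derivative \<Psi>') (at q)" and inv: "slab_map D w (\<Psi>' m) = m"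
    and m: "norm m = 1" "\<And>h. m \<bullet> D h = 0" and q: "\<Psi> q $ 4 = 0"
  obtains d where "m \<bullet> w \<noteq> 0" "d > 0"
    "\<And>s. 0 < s \<Longrightarrow> s < d \<Longrightarrow> 0 < (m \<bullet> w) * \<Psi> (q + s *\<^sub>R m) $ 4"
    "\<And>s. 0 < s \<Longrightarrow> s < d \<Longrightarrow> (m \<bullet> w) * \<Psi> (q - s *\<^sub>R m) $ 4 < 0"
proof -
  define c where "c s = (m \<bullet> w) * \<Psi> (q + s *\<^sub>R m) $ 4" for s
  \<comment> \<open>Pairing with \<open>m\<close> removes the tangential part, so the fourth
    coordinate of \<open>\<Psi>' m\<close> can be read off without knowing the other three.\<close>
  have "m \<bullet> slab_map D w (\<Psi>' m) = 1"
    using inv m(1) by (simp add: norm_eq_1)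
  then have k: "(m \<bullet> w) * \<Psi>' m $ 4 = 1"
    by (simp add: slab_map_def inner_right_distrib m(2) mult.commute)
  then have mw: "m \<bullet> w \<noteq> 0"
    by auto
  have "((\<lambda>s. q + s *\<^sub>R m) has_derivative (\<lambda>s. s *\<^sub>R m)) (at 0)"
    by (auto intro!: derivative_eq_intros)
  moreover have "(\<Psi> has_derivative \<Psi>') (at (q + 0 *\<^sub>R m))"
    using der by simp
  ultimately have "((\<lambda>s. \<Psi> (q + s *\<^sub>R m)) has_derivative (\<lambda>s. \<Psi>' (s *\<^sub>R m))) (at 0)"
    by (rule has_derivative_compose)
  then have "((\<lambda>s. \<Psi> (q + s *\<^sub>R m) $ 4) has_derivative (\<lambda>s. \<Psi>' (s *\<^sub>R m) $ 4)) (at 0)"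
    by (rule bounded_linear.has_derivative[OF bounded_linear_vec_nth])
  then have "(c has_derivative (\<lambda>s. (m \<bullet> w) * \<Psi>' (s *\<^sub>R m) $ 4)) (at 0)"
    unfolding c_def by (rule has_derivative_mult_right)
  moreover have "(\<lambda>s. (m \<bullet> w) * \<Psi>' (s *\<^sub>R m) $ 4) = (*) 1"
    using k linear_scale[OF has_derivative_linear[OF der], of _ m] by (simp add: fun_eq_iff algebra_simps)
  ultimately have "DERIV c 0 :> 1"
    unfolding has_field_derivative_def by (simp only:)
  from DERIV_pos_inc_right[OF this] DERIV_pos_inc_left[OF this]
  obtain d1 d2 where d: "d1 > 0" "\<And>s. 0 < s \<Longrightarrow> s < d1 \<Longrightarrow> c 0 < c (0 + s)"
    "d2 > 0" "\<And>s. 0 < s \<Longrightarrow> s < d2 \<Longrightarrow> c (0 - s) < c 0"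
    by auto
  show thesis
  proof (rule that[OF mw])
    show "min d1 d2 > 0"
      using d by simp
    show "0 < (m \<bullet> w) * \<Psi> (q + s *\<^sub>R m) $ 4" if "0 < s" "s < min d1 d2" for s
      using d(2)[of s] that by (simp add: c_def q)
    show "(m \<bullet> w) * \<Psi> (q - s *\<^sub>R m) $ 4 < 0" if "0 < s" "s < min d1 d2" for s
      using d(4)[of s] that by (simp add: c_def q)
  qed
qed

text \<open>The condition on the normal speaks of single segments whose length depends on the point.
  It becomes uniform because the two halves of a thin slab are mapped to connected sets off
  \<open>K\<close>: each lies in one component of the complement, and one point of each half settles
  its side.\<close>

lemma outward_normal_slab:
  assumes K: "smooth_simple_closed_hypersurface K" and n: "outward_unit_normal K n"
    and p: "p \<in> K" and nw: "n p \<bullet> w > 0"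
  obtains U \<phi> \<delta> where "smooth_patch K U \<phi>" "p \<in> \<phi> ` U" "\<delta> > 0"
    "inj_on (slab_map \<phi> w) {y. proj3 y \<in> U \<and> \<bar>y $ 4\<bar> \<le> \<delta>}"
    "open (slab_map \<phi> w ` slab U \<delta>)"
    "\<And>u s. u \<in> U \<Longrightarrow> - \<delta> \<le> s \<Longrightarrow> s < 0 \<Longrightarrow> \<phi> u + s *\<^sub>R w \<in> inside K"
    "\<And>u s. u \<in> U \<Longrightarrow> 0 < s \<Longrightarrow> s \<le> \<delta> \<Longrightarrow> \<phi> u + s *\<^sub>R w \<in> outside K"
    "\<And>u. u \<in> U \<Longrightarrow> n (\<phi> u) \<bullet> w > 0"
proof -
  obtain U0 \<phi> u0 where \<phi>: "smooth_patch K U0 \<phi>" and u0: "u0 \<in> U0" and \<phi>u0: "\<phi> u0 = p"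
    using K p unfolding smooth_simple_closed_hypersurface_def by (metis imageE)
  note normal = outward_unit_normalD[OF n \<phi>]
  have "inj (slab_map (tangent_map \<phi> u0) w)"
    using normal[OF u0] nw \<phi>u0 by (intro inj_slab_map_tangent[OF \<phi> u0, of "n (\<phi> u0)"]) auto
  from slab_chart[OF \<phi> u0 this]
  obtain U1 V1 \<Psi> \<Psi>' where U1: "open U1" "proj3 ` U1 \<subseteq> U0" "ext4 u0 0 \<in> U1"
    and V1: "open V1" "\<phi> u0 \<in> V1" and hom: "homeomorphism U1 V1 (slab_map \<phi> w) \<Psi>"
    and \<Psi>: "\<And>q. q \<in> V1 \<Longrightarrow> (\<Psi> has_derivative \<Psi>' q) (at q)"
      "\<And>q h. q \<in> V1 \<Longrightarrow> slab_map (tangent_map \<phi> (proj3 (\<Psi> q))) w (\<Psi>' q h) = h"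
    by metis
  have inv1: "\<Psi> (slab_map \<phi> w y) = y" "slab_map \<phi> w y \<in> V1" if "y \<in> U1" for y
    using hom that by (auto simp: homeomorphism_def)
  have inv2: "slab_map \<phi> w (\<Psi> q) = q" "\<Psi> q \<in> U1" if "q \<in> V1" for q
    using hom that by (auto simp: homeomorphism_def)
  have cont: "continuous_on U1 (slab_map \<phi> w)" "continuous_on V1 \<Psi>"
    using hom by (auto simp: homeomorphism_def)
  obtain \<rho>1 where \<rho>1: "\<rho>1 > 0" "slab (ball u0 \<rho>1) \<rho>1 \<subseteq> U1"
    using slab_subset_open[OF U1(1,3)] .
  have mem1: "ext4 u 0 \<in> U1" if "u \<in> ball u0 \<rho>1" for u
    using \<rho>1 that by (auto simp: slab_def)
  have sub0: "ball u0 \<rho>1 \<subseteq> U0"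
    using mem1 U1(2) by (metis image_subset_iff proj3_ext4 subsetI)
  \<comment> \<open>Relative openness of the patch gives an open \<open>T\<close> in which
    \<open>K\<close> consists of this patch alone, so no other sheet of \<open>K\<close> comes
    close.\<close>
  obtain T where T: "open T" "\<phi> ` ball u0 \<rho>1 = K \<inter> T"
    using smooth_patchD(4)[OF smooth_patch_subset[OF \<phi> open_ball sub0]] openin_open by metis
  have "open (U1 \<inter> slab_map \<phi> w -` T)"
    using continuous_open_preimage[OF cont(1) U1(1) T(1)] .
  moreover have "ext4 u0 0 \<in> U1 \<inter> slab_map \<phi> w -` T"
    using U1(3) T(2) \<rho>1(1) by auto
  ultimately obtain \<rho>2 where \<rho>2: "\<rho>2 > 0" "slab (ball u0 \<rho>2) \<rho>2 \<subseteq> U1 \<inter> slab_map \<phi> w -` T"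
    using slab_subset_open by metis
  define \<rho> where "\<rho> = min \<rho>1 \<rho>2"
  define B where "B = slab (ball u0 \<rho>) \<rho>"
  have \<rho>: "\<rho> > 0" "\<rho> \<le> \<rho>1"
    using \<rho>1 \<rho>2 by (auto simp: \<rho>_def)
  have BU1: "B \<subseteq> U1" and BT: "slab_map \<phi> w ` B \<subseteq> T"
    using \<rho>2 by (auto simp: B_def \<rho>_def slab_def subset_iff)
  have openB: "open B"
    unfolding B_def by (rule open_slab) simp
  have memB: "ext4 u s \<in> B \<longleftrightarrow> u \<in> ball u0 \<rho> \<and> \<bar>s\<bar> < \<rho>" for u s
    by (simp add: B_def slab_def)
  \<comment> \<open>A point of \<open>K\<close> in \<open>T\<close> is the image of a point at
    height zero, and the chart is injective.\<close>
  have notK: "slab_map \<phi> w y \<notin> K" if y: "y \<in> B" "y $ 4 \<noteq> 0" for y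
  proof
    assume "slab_map \<phi> w y \<in> K"
    then obtain u where u: "u \<in> ball u0 \<rho>1" "slab_map \<phi> w y = \<phi> u"
      using T(2) BT y(1) by blast
    then have "slab_map \<phi> w y = slab_map \<phi> w (ext4 u 0)"
      by simp
    then have "y = ext4 u 0"
      using inv1(1) mem1[OF u(1)] BU1 y(1) by (metis subsetD)
    then show False
      using y(2) by simp
  qed
  have comp: "connected_component (- K) (slab_map \<phi> w y) (slab_map \<phi> w y')"
    if "y \<in> B" "y' \<in> B" "0 < \<sigma> * y $ 4" "0 < \<sigma> * y' $ 4" for y y' \<sigma>
  proof -
    define H where "H = {y \<in> B. 0 < \<sigma> * y $ 4}"
    have "connected H"
      unfolding H_def B_def by (intro convex_connected convex_half_slab) simp
    then have "connected (slab_map \<phi> w ` H)"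
      using cont(1) BU1 by (intro connected_continuous_image continuous_on_subset[OF cont(1)]) (auto simp: H_def)
    moreover have "slab_map \<phi> w ` H \<subseteq> - K"
      using notK by (force simp: H_def)
    moreover have "y \<in> H" "y' \<in> H"
      using that by (auto simp: H_def)
    ultimately show ?thesis
      unfolding connected_component_def by (intro exI[of _ "slab_map \<phi> w ` H"]) simp
  qed
  \<comment> \<open>Each normal segment enters the chart on the side given by the sign of
    \<open>n (\<phi> u) \<bullet> w\<close>. That sign is known only at \<open>u0\<close> so far, so
    it stays in the statement.\<close>
  have sides: "n (\<phi> u) \<bullet> w \<noteq> 0"
    "\<exists>y\<in>B. slab_map \<phi> w y \<in> inside K \<and> (n (\<phi> u) \<bullet> w) * y $ 4 < 0"
    "\<exists>y\<in>B. slab_map \<phi> w y \<in> outside K \<and> (n (\<phi> u) \<bullet> w) * y $ 4 > 0"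
    if u: "u \<in> ball u0 \<rho>" for u
  proof -
    define m where "m = n (\<phi> u)"
    have uB: "ext4 u 0 \<in> B"
      using u \<rho>(1) by (simp add: memB)
    then have uU: "u \<in> U0"
      using sub0 \<rho>(2) u by auto
    have q: "\<phi> u \<in> V1" "\<Psi> (\<phi> u) = ext4 u 0"
      using inv1[of "ext4 u 0"] uB BU1 by auto
    note mm = normal[OF uU, folded m_def]
    obtain d where d: "m \<bullet> w \<noteq> 0" "d > 0"
      "\<And>s. 0 < s \<Longrightarrow> s < d \<Longrightarrow> 0 < (m \<bullet> w) * \<Psi> (\<phi> u + s *\<^sub>R m) $ 4"
      "\<And>s. 0 < s \<Longrightarrow> s < d \<Longrightarrow> (m \<bullet> w) * \<Psi> (\<phi> u - s *\<^sub>R m) $ 4 < 0"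
      using slab_coordinate_along_normal[OF \<Psi>(1)[OF q(1)], of "tangent_map \<phi> u" w m] \<Psi>(2)[OF q(1)] mm q(2)
      by (metis ext4_nth(4) proj3_ext4)
    have "open (V1 \<inter> \<Psi> -` B)"
      using continuous_open_preimage[OF cont(2) V1(1) openB] .
    moreover have "\<phi> u \<in> V1 \<inter> \<Psi> -` B"
      using q uB by simp
    ultimately obtain e where e: "e > 0" "ball (\<phi> u) e \<subseteq> V1 \<inter> \<Psi> -` B"
      using openE by blast
    obtain \<epsilon> where \<epsilon>: "\<epsilon> > 0" "\<And>s. 0 < s \<Longrightarrow> s < \<epsilon> \<Longrightarrow> \<phi> u + s *\<^sub>R m \<in> outside K"
        "\<And>s. 0 < s \<Longrightarrow> s < \<epsilon> \<Longrightarrow> \<phi> u - s *\<^sub>R m \<in> inside K"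
      using mm(3) by blast
    \<comment> \<open>Short enough for three purposes: the sign of the height (\<open>d\<close>),
      staying in the chart (\<open>e\<close>), and the defining property of the outward normal
      (\<open>\<epsilon>\<close>).\<close>
    define s where "s = min d (min e \<epsilon>) / 2"
    have s: "0 < s" "s < d" "s < e" "s < \<epsilon>"
      using d(2) e(1) \<epsilon>(1) by (auto simp: s_def)
    have "\<phi> u + s *\<^sub>R m \<in> ball (\<phi> u) e" "\<phi> u - s *\<^sub>R m \<in> ball (\<phi> u) e"
      using s mm(1) by (auto simp: dist_norm)
    then have *: "\<phi> u + s *\<^sub>R m \<in> V1 \<inter> \<Psi> -` B" "\<phi> u - s *\<^sub>R m \<in> V1 \<inter> \<Psi> -` B"
      using e by blast+
    show "n (\<phi> u) \<bullet> w \<noteq> 0"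
      using d(1) by (simp add: m_def)
    show "\<exists>y\<in>B. slab_map \<phi> w y \<in> inside K \<and> (n (\<phi> u) \<bullet> w) * y $ 4 < 0"
      using * inv2(1) \<epsilon>(3)[OF s(1,4)] d(4)[OF s(1,2)] unfolding m_def[symmetric]
      by (intro bexI[of _ "\<Psi> (\<phi> u - s *\<^sub>R m)"]) auto
    show "\<exists>y\<in>B. slab_map \<phi> w y \<in> outside K \<and> (n (\<phi> u) \<bullet> w) * y $ 4 > 0"
      using * inv2(1) \<epsilon>(2)[OF s(1,4)] d(3)[OF s(1,2)] unfolding m_def[symmetric]
      by (intro bexI[of _ "\<Psi> (\<phi> u + s *\<^sub>R m)"]) auto
  qed
  have u0B: "u0 \<in> ball u0 \<rho>"
    using \<rho> by simp
  obtain yi where yi: "yi \<in> B" "slab_map \<phi> w yi \<in> inside K" "yi $ 4 < 0"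
    using sides(2)[OF u0B] nw \<phi>u0 by (auto simp: mult_less_0_iff)
  obtain yo where yo: "yo \<in> B" "slab_map \<phi> w yo \<in> outside K" "yo $ 4 > 0"
    using sides(3)[OF u0B] nw \<phi>u0 by (auto simp: zero_less_mult_iff)
  have inB: "slab_map \<phi> w y \<in> inside K" if "y \<in> B" "y $ 4 < 0" for y
    using inside_same_component[OF comp[of yi y "-1"]] yi that by simp
  have outB: "slab_map \<phi> w y \<in> outside K" if "y \<in> B" "y $ 4 > 0" for y
    using outside_same_component[OF comp[of yo y 1]] yo that by simp
  show thesis
  proof (rule that)
    show "smooth_patch K (ball u0 \<rho>) \<phi>"
      using smooth_patch_subset[OF \<phi> open_ball] sub0 \<rho>(2) by (metis subset_ball subset_trans)
    show "p \<in> \<phi> ` ball u0 \<rho>"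
      using u0B \<phi>u0 by blast
    \<comment> \<open>Half of \<open>\<rho>\<close>, so that the closed slab, including its faces at
      height \<open>\<delta>\<close>, still lies in \<open>B\<close>.\<close>
    show "\<rho> / 2 > 0"
      using \<rho> by simp
    have "{y. proj3 y \<in> ball u0 \<rho> \<and> \<bar>y $ 4\<bar> \<le> \<rho> / 2} \<subseteq> U1"
      using BU1 \<rho>(1) by (force simp: B_def slab_def)
    then show "inj_on (slab_map \<phi> w) {y. proj3 y \<in> ball u0 \<rho> \<and> \<bar>y $ 4\<bar> \<le> \<rho> / 2}"
      using inv1(1) by (intro inj_on_inverseI[where g = \<Psi>]) blast
    have sub: "slab (ball u0 \<rho>) (\<rho> / 2) \<subseteq> U1"
      using BU1 \<rho>(1) by (force simp: B_def slab_def)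
    have "slab_map \<phi> w ` slab (ball u0 \<rho>) (\<rho> / 2) = V1 \<inter> \<Psi> -` slab (ball u0 \<rho>) (\<rho> / 2)"
    proof (intro equalityI subsetI)
      fix q assume "q \<in> slab_map \<phi> w ` slab (ball u0 \<rho>) (\<rho> / 2)"
      then show "q \<in> V1 \<inter> \<Psi> -` slab (ball u0 \<rho>) (\<rho> / 2)"
        using inv1 sub by auto
    next
      fix q assume "q \<in> V1 \<inter> \<Psi> -` slab (ball u0 \<rho>) (\<rho> / 2)"
      then show "q \<in> slab_map \<phi> w ` slab (ball u0 \<rho>) (\<rho> / 2)"
        using inv2(1)[of q] by (intro image_eqI[of _ _ "\<Psi> q"]) auto
    qed
    then show "open (slab_map \<phi> w ` slab (ball u0 \<rho>) (\<rho> / 2))"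
      using continuous_open_preimage[OF cont(2) V1(1) open_slab[OF open_ball]] by metis
    show "\<phi> u + s *\<^sub>R w \<in> inside K" if "u \<in> ball u0 \<rho>" "- (\<rho> / 2) \<le> s" "s < 0" for u s
      using inB[of "ext4 u s"] that \<rho> by (simp add: memB)
    show "\<phi> u + s *\<^sub>R w \<in> outside K" if "u \<in> ball u0 \<rho>" "0 < s" "s \<le> \<rho> / 2" for u s
      using outB[of "ext4 u s"] that \<rho> by (simp add: memB)
    show "n (\<phi> u) \<bullet> w > 0" if u: "u \<in> ball u0 \<rho>" for u
    proof (rule ccontr)
      \<comment> \<open>A negative product would put an inside point at positive height, where
        \<open>outB\<close> makes it an outside point.\<close>
      assume "\<not> n (\<phi> u) \<bullet> w > 0"
      then have neg: "n (\<phi> u) \<bullet> w < 0"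
        using sides(1)[OF u] by linarith
      obtain y where "y \<in> B" "slab_map \<phi> w y \<in> inside K" "(n (\<phi> u) \<bullet> w) * y $ 4 < 0"
        using sides(2)[OF u] by blast
      then have "slab_map \<phi> w y \<in> inside K" "slab_map \<phi> w y \<in> outside K"
        using neg outB by (simp_all add: mult_less_0_iff)
      then show False
        using inside_Int_outside[of K] by blast
    qed
  qed
qed

section \<open>The surface measure\<close>

lemma continuous_on_area_density:
  assumes "smooth_patch K U \<phi>"
  shows "continuous_on U (area_density \<phi>)"
proof -
  have "continuous_on U (\<lambda>u. tangent_map \<phi> u h)" for h
    using C1_onD(2)[OF smooth_patchD(2)[OF assms]] .
  then show ?thesis
    unfolding area_density_def Let_def det_3 matrix_transpose_mult_nth by (intro continuous_intros)
qed

text \<open>The range of \<open>D\<close> has dimension at most 3 in a space of dimension 4. This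
  provides a thickening direction where no normal field has been fixed.\<close>

lemma exists_unit_normal:
  assumes "linear (D :: real^3 \<Rightarrow> quat)"
  obtains m where "norm m = 1" "\<And>h. m \<bullet> D h = 0"
proof -
  have sub: "subspace (range D)"
    using assms linear_subspace_image subspace_UNIV by blast
  have "dim (range D) \<le> dim (UNIV :: (real^3) set)"
    using assms by (rule dim_image_le)
  then have "dim (range D) < DIM(quat)"
    by simp
  then obtain x where x: "x \<noteq> 0" "\<And>y. y \<in> span (range D) \<Longrightarrow> orthogonal x y"
    using orthogonal_to_subspace_exists by metis
  show thesis
  proof (rule that)
    show "norm (x /\<^sub>R norm x) = 1"
      using x by simp
    show "(x /\<^sub>R norm x) \<bullet> D h = 0" for h
      using x(2)[of "D h"] by (simp add: span_base orthogonal_def)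
  qed
qed

lemma area_density_nonneg:
  assumes \<phi>: "smooth_patch K U \<phi>" and u: "u \<in> U"
  shows "0 \<le> area_density \<phi> u"
proof -
  obtain m where "norm m = 1" "\<And>h. m \<bullet> tangent_map \<phi> u h = 0"
    using exists_unit_normal[OF smooth_patchD(8)[OF \<phi> u]] by metis
  from abs_det_slab_map(2)[OF smooth_patchD(8,3)[OF \<phi> u] this] show ?thesis
    by (simp add: area_density_def Let_def)
qed

text \<open>Near each point the transition map agrees with the first three coordinates of the local
  inverse of a slab map, which is differentiable on an open subset of the ambient space.\<close>

lemma transition_differentiable:
  assumes \<phi>: "smooth_patch K U \<phi>" and \<phi>1: "smooth_patch K U1 \<phi>1"
    and hom: "homeomorphism U1 (\<phi>1 ` U1) \<phi>1 \<psi>1"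
    and u: "u \<in> U" "\<phi> u \<in> \<phi>1 ` U1"
  obtains T where "((\<lambda>u. \<psi>1 (\<phi> u)) has_derivative T) (at u)"
    "area_density \<phi> u = \<bar>det (matrix T)\<bar> * area_density \<phi>1 (\<psi>1 (\<phi> u))"
proof -
  define \<tau> where "\<tau> u = \<psi>1 (\<phi> u)" for u
  obtain O1 where O1: "open O1" "\<phi>1 ` U1 = K \<inter> O1"
    using smooth_patchD(4)[OF \<phi>1] openin_open by metis
  define W where "W = U \<inter> \<phi> -` O1"
  have W: "open W"
    unfolding W_def using continuous_open_preimage[OF smooth_patchD(6,1)[OF \<phi>] O1(1)] .
  have \<phi>W: "\<phi> u' \<in> \<phi>1 ` U1" if "u' \<in> W" for u'
    using that O1(2) smooth_patchD(7)[OF \<phi>] by (auto simp: W_def)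
  have uW: "u \<in> W"
    using u O1(2) by (auto simp: W_def)
  have \<tau>: "\<tau> u' \<in> U1" "\<phi>1 (\<tau> u') = \<phi> u'" if "u' \<in> W" for u'
    using \<phi>W[OF that] hom by (auto simp: \<tau>_def homeomorphism_def)
  have contW: "continuous_on W \<tau>"
  proof -
    have "continuous_on W \<phi>"
      using smooth_patchD(6)[OF \<phi>] by (rule continuous_on_subset) (auto simp: W_def)
    moreover have "continuous_on (\<phi>1 ` U1) \<psi>1"
      using hom by (simp add: homeomorphism_def)
    ultimately show ?thesis
      unfolding \<tau>_def using \<phi>W by (intro continuous_on_compose2[of "\<phi>1 ` U1" \<psi>1 W \<phi>]) auto
  qed
  note uU1 = \<tau>(1)[OF uW]
  \<comment> \<open>Thickening the second patch along its own normal at \<open>\<tau> u\<close>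
    gives \<open>w \<bullet> w = 1\<close>, so its slab map is invertible there.\<close>
  obtain w where w: "norm w = 1" "\<And>h. w \<bullet> tangent_map \<phi>1 (\<tau> u) h = 0"
    using exists_unit_normal[OF smooth_patchD(8)[OF \<phi>1 uU1]] by metis
  then have "inj (slab_map (tangent_map \<phi>1 (\<tau> u)) w)"
    by (intro inj_slab_map_tangent[OF \<phi>1 uU1 w]) (simp add: norm_eq_1)
  from slab_chart[OF \<phi>1 uU1 this]
  obtain U' V \<Psi> \<Psi>' where U': "open U'" "ext4 (\<tau> u) 0 \<in> U'" and V: "\<phi>1 (\<tau> u) \<in> V"
    and hom': "homeomorphism U' V (slab_map \<phi>1 w) \<Psi>"
    and \<Psi>: "\<And>q. q \<in> V \<Longrightarrow> (\<Psi> has_derivative \<Psi>' q) (at q)"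
    by metis
  define N where "N = W \<inter> (\<lambda>u'. ext4 (\<tau> u') 0) -` U'"
  have "continuous_on W (\<lambda>u'. ext4 (\<tau> u') 0)"
    using continuous_on_compose2[OF linear_continuous_on[OF bounded_linear_ext4, of UNIV]
        continuous_on_Pair[OF contW continuous_on_const[of W 0]]]
    by simp
  then have N: "open N"
    unfolding N_def using continuous_open_preimage W U'(1) by blast
  have uN: "u \<in> N"
    using uW U' by (simp add: N_def)
  \<comment> \<open>At height zero the slab map is \<open>\<phi>1\<close>. The set \<open>N\<close>
    keeps \<open>\<tau>\<close> inside the domain of the local chart, so dropping the height from
    \<open>\<Psi>\<close> after \<open>\<phi>\<close> recovers \<open>\<tau>\<close>.\<close>
  have eq: "proj3 (\<Psi> (\<phi> u')) = \<tau> u'" if "u' \<in> N" for u'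
  proof -
    have "\<Psi> (slab_map \<phi>1 w (ext4 (\<tau> u') 0)) = ext4 (\<tau> u') 0"
      using that hom' unfolding N_def homeomorphism_def by blast
    then show ?thesis
      using \<tau>(2)[of u'] that by (simp add: N_def)
  qed
  have "\<phi> u \<in> V"
    using V \<tau>(2)[OF uW] by simp
  note d\<phi> = C1_onD(1)[OF smooth_patchD(2)[OF \<phi>] u(1)]
  have "((\<lambda>u'. proj3 (\<Psi> (\<phi> u'))) has_derivative (\<lambda>h. proj3 (\<Psi>' (\<phi> u) (tangent_map \<phi> u h)))) (at u)"
    by (rule bounded_linear.has_derivative[OF bounded_linear_proj3 has_derivative_compose[OF d\<phi> \<Psi>[OF \<open>\<phi> u \<in> V\<close>]]])
  then have T: "(\<tau> has_derivative (\<lambda>h. proj3 (\<Psi>' (\<phi> u) (tangent_map \<phi> u h)))) (at u)"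
    by (rule has_derivative_transform_within_open[OF _ N uN]) (simp add: eq)
  define T where "T = (\<lambda>h. proj3 (\<Psi>' (\<phi> u) (tangent_map \<phi> u h)))"
  note T = T[folded T_def]
  have "((\<lambda>u'. \<phi>1 (\<tau> u')) has_derivative (\<lambda>h. tangent_map \<phi>1 (\<tau> u) (T h))) (at u)"
    using has_derivative_compose[OF T C1_onD(1)[OF smooth_patchD(2)[OF \<phi>1] uU1]] .
  then have "(\<phi> has_derivative (\<lambda>h. tangent_map \<phi>1 (\<tau> u) (T h))) (at u)"
    by (rule has_derivative_transform_within_open[OF _ W uW]) (simp add: \<tau>)
  then have comp: "tangent_map \<phi> u = tangent_map \<phi>1 (\<tau> u) \<circ> T"
    using has_derivative_unique[OF d\<phi>] by (simp add: comp_def)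
  have linT: "linear T"
    using T by (rule has_derivative_linear)
  define A where "A = matrix (tangent_map \<phi>1 (\<tau> u))"
  have "matrix (tangent_map \<phi> u) = A ** matrix T"
    unfolding comp A_def by (rule matrix_compose[OF linT smooth_patchD(8)[OF \<phi>1 uU1]])
  \<comment> \<open>A Gram determinant transforms by the square of the determinant of
    \<open>T\<close>; the root turns this into the absolute value.\<close>
  then have "det (transpose (matrix (tangent_map \<phi> u)) ** matrix (tangent_map \<phi> u))
      = det (transpose (matrix T) ** (transpose A ** A) ** matrix T)"
    by (simp add: matrix_transpose_mul matrix_mul_assoc)
  also have "\<dots> = (det (matrix T))\<^sup>2 * det (transpose A ** A)"
    by (simp add: det_mul power2_eq_square)
  finally have "area_density \<phi> u = \<bar>det (matrix T)\<bar> * area_density \<phi>1 (\<tau> u)"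
    by (simp add: area_density_def A_def real_sqrt_mult Let_def)
  with T that show thesis
    unfolding \<tau>_def by blast
qed

section \<open>Change of variables for nonnegative integrals\<close>

lemma nn_integral_eq_HK_integral:
  fixes h :: "'a::euclidean_space \<Rightarrow> real"
  assumes S: "S \<in> sets borel" and pos: "\<And>x. x \<in> S \<Longrightarrow> 0 \<le> h x"
    and meas: "(\<lambda>x. indicator S x * h x) \<in> borel_measurable borel"
  shows "(\<integral>\<^sup>+x\<in>S. ennreal (h x) \<partial>lborel)
    = (if h absolutely_integrable_on S then ennreal (integral S h) else \<infinity>)"
proof -
  define k where "k x = indicator S x * h x" for x
  have k: "k \<in> borel_measurable lborel" "\<And>x. 0 \<le> k x"
    using meas by (simp_all add: k_def[abs_def] pos split: split_indicator)
  have "(\<integral>\<^sup>+x\<in>S. ennreal (h x) \<partial>lborel) = (\<integral>\<^sup>+x. ennreal (k x) \<partial>lborel)"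
    by (intro nn_integral_cong) (auto simp: k_def indicator_def)
  moreover have abs: "h absolutely_integrable_on S \<longleftrightarrow> integrable lborel k"
    using integrable_completion[OF k(1)] by (simp add: set_integrable_def k_def[abs_def])
  moreover have "(\<integral>\<^sup>+x. ennreal (k x) \<partial>lborel) = ennreal (integral S h)" if "integrable lborel k"
  proof -
    have "integral S h = (\<integral>x. k x \<partial>lborel)"
      using set_lebesgue_integral_eq_integral(2)[of S h] that abs integral_completion[OF k(1)]
      by (simp add: set_lebesgue_integral_def k_def[abs_def])
    then show ?thesis
      using nn_integral_eq_integral[OF that] k(2) by simp
  qed
  moreover have "(\<integral>\<^sup>+x. ennreal (k x) \<partial>lborel) = \<infinity>" if "\<not> integrable lborel k"
    using that integrableI_nonneg[OF k(1)] k(2) by (metis AE_I2 infinity_ennreal_def less_top)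
  ultimately show ?thesis
    by simp
qed

text \<open>The theorem for absolutely integrable functions is an equivalence, so one side is
  integrable exactly when the other is. In the remaining case both nonnegative integrals are
  infinite, and equality holds without any finiteness assumption.\<close>

lemma nn_integral_change_of_variables:
  fixes g :: "real^'m::{finite,wellorder} \<Rightarrow> real^'m::_" and f :: "real^'m::_ \<Rightarrow> real"
  assumes S: "S \<in> sets borel" and gS: "g ` S \<in> sets borel"
    and der: "\<And>x. x \<in> S \<Longrightarrow> (g has_derivative g' x) (at x within S)" and inj: "inj_on g S"
    and f: "\<And>y. y \<in> g ` S \<Longrightarrow> 0 \<le> f y" "(\<lambda>y. indicator (g ` S) y * f y) \<in> borel_measurable borel"
    and h: "\<And>x. x \<in> S \<Longrightarrow> h x = \<bar>det (matrix (g' x))\<bar> * f (g x)"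
      "(\<lambda>x. indicator S x * h x) \<in> borel_measurable borel"
  shows "(\<integral>\<^sup>+x\<in>S. ennreal (h x) \<partial>lborel) = (\<integral>\<^sup>+y\<in>g ` S. ennreal (f y) \<partial>lborel)"
proof -
  \<comment> \<open>The change of variables theorem concerns functions into \<open>real^'n\<close>;
    multiplication by \<open>?e\<close> places a real function in \<open>real^1\<close>.\<close>
  let ?e = "axis 1 1 :: real^1"
  have scale: "(\<lambda>x. k x *\<^sub>R ?e) absolutely_integrable_on A \<longleftrightarrow> k absolutely_integrable_on A"
    for k :: "real^'m::_ \<Rightarrow> real" and A
  proof
    assume "(\<lambda>x. k x *\<^sub>R ?e) absolutely_integrable_on A"
    then have "(\<lambda>x. k x *\<^sub>R ?e \<bullet> ?e) absolutely_integrable_on A"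
      by (rule absolutely_integrable_component)
    then show "k absolutely_integrable_on A"
      by (simp add: inner_axis_axis)
  qed (rule absolutely_integrable_scaleR_right)
  have scale_int: "integral A (\<lambda>x. k x *\<^sub>R ?e) = integral A k *\<^sub>R ?e" if "k absolutely_integrable_on A"
    for k :: "real^'m::_ \<Rightarrow> real" and A
    using that
    by (intro integral_unique has_integral_linear[of k, unfolded o_def, where h = "\<lambda>x. x *\<^sub>R ?e"])
       (auto simp: integrable_integral set_lebesgue_integral_eq_integral(1) bounded_linear_scaleR_left)
  let ?d = "\<lambda>x. \<bar>det (matrix (g' x))\<bar> * f (g x)"
  have "(\<lambda>x. \<bar>det (matrix (g' x))\<bar> *\<^sub>R (f (g x) *\<^sub>R ?e)) = (\<lambda>x. ?d x *\<^sub>R ?e)"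
    by simp
  then have cv: "(\<lambda>x. ?d x *\<^sub>R ?e) absolutely_integrable_on S \<and> integral S (\<lambda>x. ?d x *\<^sub>R ?e) = b \<longleftrightarrow>
      (\<lambda>y. f y *\<^sub>R ?e) absolutely_integrable_on (g ` S) \<and> integral (g ` S) (\<lambda>y. f y *\<^sub>R ?e) = b" for b
    using has_absolute_integral_change_of_variables[OF _ der inj, of "\<lambda>y. f y *\<^sub>R ?e" b] S by simp
  have iff: "?d absolutely_integrable_on S \<longleftrightarrow> f absolutely_integrable_on (g ` S)"
    using cv[of "integral S (\<lambda>x. ?d x *\<^sub>R ?e)"] cv[of "integral (g ` S) (\<lambda>y. f y *\<^sub>R ?e)"]
    unfolding scale by blast
  have eq: "integral S ?d = integral (g ` S) f" if "?d absolutely_integrable_on S"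
  proof -
    have "integral S (\<lambda>x. ?d x *\<^sub>R ?e) = integral (g ` S) (\<lambda>y. f y *\<^sub>R ?e)"
      using cv[of "integral S (\<lambda>x. ?d x *\<^sub>R ?e)"] that unfolding scale by simp
    then show ?thesis
      using scale_int[of S ?d] scale_int[of "g ` S" f] that iff by simp
  qed
  have hd: "h absolutely_integrable_on S \<longleftrightarrow> ?d absolutely_integrable_on S" "integral S h = integral S ?d"
    by (intro set_integrable_cong refl h(1), assumption) (intro integral_cong h(1), assumption)
  have "0 \<le> h x" if "x \<in> S" for x
    using h(1)[OF that] f(1)[of "g x"] that by simp
  then show ?thesis
    using nn_integral_eq_HK_integral[OF S _ h(2)] nn_integral_eq_HK_integral[OF gS f] iff eq hd by simp
qed

text \<open>Pushed forward to all of \<open>K\<close> rather than to the image of the patch, so that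
  measures of different patches share one sigma-algebra and can be compared and added.\<close>

definition patch_measure :: "quat set \<Rightarrow> (real^3) set \<Rightarrow> (real^3 \<Rightarrow> quat) \<Rightarrow> quat measure"
  where "patch_measure K U \<phi> =
    distr (density (restrict_space lborel U) (\<lambda>u. ennreal (area_density \<phi> u))) (restrict_space borel K) \<phi>"

lemma sets_patch_measure [simp, measurable_cong]: "sets (patch_measure K U \<phi>) = sets (restrict_space borel K)"
  by (simp add: patch_measure_def)

lemma patch_measurable:
  assumes "smooth_patch K U \<phi>"
  shows "\<phi> \<in> measurable (restrict_space lborel U) (restrict_space borel K)"
    and "area_density \<phi> \<in> borel_measurable (restrict_space lborel U)"
proof -
  have "\<phi> \<in> borel_measurable (restrict_space lborel U)"
    using borel_measurable_continuous_on_restrict[OF smooth_patchD(6)[OF assms]]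
    by (simp cong: measurable_cong_sets add: sets_restrict_space_cong[OF sets_lborel])
  then show "\<phi> \<in> measurable (restrict_space lborel U) (restrict_space borel K)"
    using smooth_patchD(7)[OF assms] by (intro measurable_restrict_space2) (auto simp: space_restrict_space)
  show "area_density \<phi> \<in> borel_measurable (restrict_space lborel U)"
    using borel_measurable_continuous_on_restrict[OF continuous_on_area_density[OF assms]]
    by (simp cong: measurable_cong_sets add: sets_restrict_space_cong[OF sets_lborel])
qed

lemma emeasure_patch_measure:
  assumes \<phi>: "smooth_patch K U \<phi>" and A: "A \<in> sets (restrict_space borel K)"
  shows "emeasure (patch_measure K U \<phi>) A = (\<integral>\<^sup>+u\<in>{u\<in>U. \<phi> u \<in> A}. ennreal (area_density \<phi> u) \<partial>lborel)"
proof -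
  have U: "U \<in> sets lborel"
    using smooth_patchD(1)[OF \<phi>] by simp
  let ?B = "\<phi> -` A \<inter> space (restrict_space lborel U)"
  have B: "?B \<in> sets (restrict_space lborel U)"
    using measurable_sets[OF patch_measurable(1)[OF \<phi>] A] .
  have "emeasure (patch_measure K U \<phi>) A
      = emeasure (density (restrict_space lborel U) (\<lambda>u. ennreal (area_density \<phi> u))) ?B"
    unfolding patch_measure_def using patch_measurable(1)[OF \<phi>] A by (subst emeasure_distr) simp_all
  also have "\<dots> = (\<integral>\<^sup>+u\<in>?B. ennreal (area_density \<phi> u) \<partial>restrict_space lborel U)"
    using patch_measurable(2)[OF \<phi>] B by (subst emeasure_density) simp_all
  also have "\<dots> = (\<integral>\<^sup>+u\<in>{u\<in>U. \<phi> u \<in> A}. ennreal (area_density \<phi> u) \<partial>lborel)"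
    using U by (subst nn_integral_restrict_space)
      (auto simp: space_restrict_space indicator_def intro!: nn_integral_cong)
  finally show ?thesis .
qed

lemma sets_patch_preimage:
  assumes \<phi>: "smooth_patch K U \<phi>" and A: "A \<in> sets (restrict_space borel K)"
  shows "{u \<in> U. \<phi> u \<in> A} \<in> sets borel"
proof -
  have "\<phi> -` A \<inter> space (restrict_space lborel U) \<in> sets (restrict_space lborel U)"
    using measurable_sets[OF patch_measurable(1)[OF \<phi>] A] .
  moreover have "\<phi> -` A \<inter> space (restrict_space lborel U) = {u \<in> U. \<phi> u \<in> A}"
    by (auto simp: space_restrict_space)
  ultimately show ?thesis
    using smooth_patchD(1)[OF \<phi>] by (auto simp: sets_restrict_space_iff)
qed

lemma sets_patch_image:
  assumes \<phi>: "smooth_patch K U \<phi>"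
  shows "\<phi> ` U \<in> sets (restrict_space borel K)"
proof -
  obtain T where "open T" "\<phi> ` U = K \<inter> T"
    using smooth_patchD(4)[OF \<phi>] openin_open by metis
  then show ?thesis
    by (auto simp: sets_restrict_space)
qed

text \<open>Independence of the parametrization: the transition map carries one preimage of
  \<open>A\<close> bijectively to the other, and its Jacobian is the ratio of the area
  densities.\<close>

lemma emeasure_patch_measure_cong:
  assumes \<phi>: "smooth_patch K U \<phi>" and \<phi>1: "smooth_patch K U1 \<phi>1"
    and A: "A \<in> sets (restrict_space borel K)" "A \<subseteq> \<phi> ` U" "A \<subseteq> \<phi>1 ` U1"
  shows "emeasure (patch_measure K U \<phi>) A = emeasure (patch_measure K U1 \<phi>1) A"
proof -
  obtain \<psi>1 where hom: "homeomorphism U1 (\<phi>1 ` U1) \<phi>1 \<psi>1"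
    using \<phi>1 by (auto simp: smooth_patch_def)
  define \<tau> where "\<tau> u = \<psi>1 (\<phi> u)" for u
  define S where "S = {u \<in> U. \<phi> u \<in> A}"
  have inv1: "\<psi>1 (\<phi>1 u) = u" if "u \<in> U1" for u
    using hom that unfolding homeomorphism_def by blast
  have \<tau>: "\<tau> u \<in> U1" "\<phi>1 (\<tau> u) = \<phi> u" if "u \<in> S" for u
    using A(3) inv1 that by (auto simp: S_def \<tau>_def)
  have "\<tau> ` S = {u \<in> U1. \<phi>1 u \<in> A}"
  proof (intro equalityI subsetI)
    fix u1 assume u1: "u1 \<in> {u \<in> U1. \<phi>1 u \<in> A}"
    then obtain u where "u \<in> U" "\<phi>1 u1 = \<phi> u"
      using A(2) by auto
    then show "u1 \<in> \<tau> ` S"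
      using u1 inv1[of u1] by (intro image_eqI[of _ _ u]) (auto simp: S_def \<tau>_def)
  qed (use \<tau> in \<open>auto simp: S_def\<close>)
  note S1 = this
  have dens: "(\<lambda>u. indicator {u \<in> U. \<phi> u \<in> A} u * area_density \<phi> u) \<in> borel_measurable borel"
    if "smooth_patch K U \<phi>" for U \<phi>
    using borel_measurable_continuous_on_indicator[OF sets_patch_preimage[OF that A(1)],
        OF continuous_on_subset[OF continuous_on_area_density[OF that]]]
    by simp
  have "\<exists>T. (\<tau> has_derivative T) (at u) \<and>
      area_density \<phi> u = \<bar>det (matrix T)\<bar> * area_density \<phi>1 (\<tau> u)" if "u \<in> S" for u
    using transition_differentiable[OF \<phi> \<phi>1 hom, of u] that A(3) unfolding \<tau>_def S_def by blast
  then obtain T where T: "\<And>u. u \<in> S \<Longrightarrow> (\<tau> has_derivative T u) (at u)"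
      "\<And>u. u \<in> S \<Longrightarrow> area_density \<phi> u = \<bar>det (matrix (T u))\<bar> * area_density \<phi>1 (\<tau> u)"
    by metis
  have "inj_on \<tau> S"
    using \<tau> smooth_patchD(5)[OF \<phi>] unfolding inj_on_def S_def by (metis mem_Collect_eq)
  then have "(\<integral>\<^sup>+u\<in>S. ennreal (area_density \<phi> u) \<partial>lborel)
      = (\<integral>\<^sup>+u\<in>\<tau> ` S. ennreal (area_density \<phi>1 u) \<partial>lborel)"
  proof (rule nn_integral_change_of_variables[rotated 3])
    show "S \<in> sets borel"
      unfolding S_def by (rule sets_patch_preimage[OF \<phi> A(1)])
    show "\<tau> ` S \<in> sets borel"
      unfolding S1 by (rule sets_patch_preimage[OF \<phi>1 A(1)])
    show "(\<tau> has_derivative T u) (at u within S)" if "u \<in> S" for u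
      using T(1)[OF that] has_derivative_at_withinI by blast
    show "0 \<le> area_density \<phi>1 y" if "y \<in> \<tau> ` S" for y
      using that \<tau>(1) area_density_nonneg[OF \<phi>1] by blast
    show "(\<lambda>y. indicator (\<tau> ` S) y * area_density \<phi>1 y) \<in> borel_measurable borel"
      unfolding S1 by (rule dens[OF \<phi>1])
    show "(\<lambda>x. indicator S x * area_density \<phi> x) \<in> borel_measurable borel"
      unfolding S_def by (rule dens[OF \<phi>])
  qed (rule T(2))
  then show ?thesis
    unfolding emeasure_patch_measure[OF \<phi> A(1)] emeasure_patch_measure[OF \<phi>1 A(1)] S1
    by (simp add: S_def)
qed

text \<open>Shrinking a patch to a ball whose closure stays in the domain makes the density bounded.
  Finitely many such patches give \<open>K\<close> finite total area, on which the integrability of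
  continuous functions rests.\<close>

lemma finite_patch_at:
  assumes K: "smooth_simple_closed_hypersurface K" and p: "p \<in> K"
  shows "\<exists>U \<phi>. smooth_patch K U \<phi> \<and> p \<in> \<phi> ` U \<and> emeasure (patch_measure K U \<phi>) K < \<infinity>"
proof -
  obtain U0 \<phi> u0 where \<phi>: "smooth_patch K U0 \<phi>" and u0: "u0 \<in> U0" and \<phi>u0: "\<phi> u0 = p"
    using K p unfolding smooth_simple_closed_hypersurface_def by (metis imageE)
  obtain e where e: "e > 0" "cball u0 e \<subseteq> U0"
    using open_contains_cball smooth_patchD(1)[OF \<phi>] u0 by blast
  have \<phi>': "smooth_patch K (ball u0 e) \<phi>"
    using e by (intro smooth_patch_subset[OF \<phi>]) auto
  have "compact (area_density \<phi> ` cball u0 e)"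
    by (intro compact_continuous_image continuous_on_subset[OF continuous_on_area_density[OF \<phi>]] e) simp
  then have "bounded (area_density \<phi> ` cball u0 e)"
    by (rule compact_imp_bounded)
  then obtain C where "\<forall>x\<in>area_density \<phi> ` cball u0 e. norm x \<le> C"
    unfolding bounded_iff by blast
  then have C: "\<bar>area_density \<phi> u\<bar> \<le> C" if "u \<in> cball u0 e" for u
    using that by (metis imageI real_norm_def)
  have "emeasure (patch_measure K (ball u0 e) \<phi>) K
      = (\<integral>\<^sup>+u\<in>{u\<in>ball u0 e. \<phi> u \<in> K}. ennreal (area_density \<phi> u) \<partial>lborel)"
    by (rule emeasure_patch_measure[OF \<phi>']) (auto simp: sets_restrict_space)
  also have "\<dots> \<le> (\<integral>\<^sup>+u. ennreal C * indicator (ball u0 e) u \<partial>lborel)"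
  proof (rule nn_integral_mono)
    fix u :: "real^3"
    have "area_density \<phi> u \<le> C" if "u \<in> ball u0 e"
      using C[of u] that by auto
    then show "ennreal (area_density \<phi> u) * indicator {u \<in> ball u0 e. \<phi> u \<in> K} u
        \<le> ennreal C * indicator (ball u0 e) u"
      by (simp add: indicator_def ennreal_leI)
  qed
  also have "\<dots> = ennreal C * emeasure lborel (ball u0 e)"
    by (rule nn_integral_cmult_indicator) simp
  also have "\<dots> < \<infinity>"
    using emeasure_lborel_ball_finite[of u0 e] by (simp add: ennreal_mult_less_top)
  finally have "emeasure (patch_measure K (ball u0 e) \<phi>) K < \<infinity>" .
  moreover have "p \<in> \<phi> ` ball u0 e"
    using e(1) \<phi>u0 by auto
  ultimately show ?thesis
    using \<phi>' by blast
qed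

section \<open>Existence and uniqueness of the surface measure\<close>

lemma finite_patch_partition:
  assumes K: "smooth_simple_closed_hypersurface K"
  obtains N :: nat and U \<phi> B where "\<And>i. i < N \<Longrightarrow> smooth_patch K (U i) (\<phi> i)"
    "\<And>i. i < N \<Longrightarrow> emeasure (patch_measure K (U i) (\<phi> i)) K < \<infinity>"
    "\<And>i. i < N \<Longrightarrow> B i \<subseteq> \<phi> i ` U i" "\<And>i. i < N \<Longrightarrow> B i \<in> sets (restrict_space borel K)"
    "disjoint_family_on B {..<N}" "(\<Union>i<N. B i) = K"
proof -
  have "\<forall>p\<in>K. \<exists>T U \<phi>. open T \<and> p \<in> T \<and> smooth_patch K U \<phi> \<and> \<phi> ` U = K \<inter> T \<and>
      emeasure (patch_measure K U \<phi>) K < \<infinity>"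
  proof
    fix p assume "p \<in> K"
    from finite_patch_at[OF K this] obtain U \<phi>
      where \<phi>: "smooth_patch K U \<phi>" "p \<in> \<phi> ` U" "emeasure (patch_measure K U \<phi>) K < \<infinity>"
      by blast
    moreover obtain T where "open T" "\<phi> ` U = K \<inter> T"
      using smooth_patchD(4)[OF \<phi>(1)] unfolding openin_open by blast
    ultimately show "\<exists>T U \<phi>. open T \<and> p \<in> T \<and> smooth_patch K U \<phi> \<and> \<phi> ` U = K \<inter> T \<and>
        emeasure (patch_measure K U \<phi>) K < \<infinity>"
      by (intro exI[of _ T] exI[of _ U] exI[of _ \<phi>]) auto
  qed
  then obtain T U \<phi> where T: "\<And>p. p \<in> K \<Longrightarrow> open (T p) \<and> p \<in> T p \<and> smooth_patch K (U p) (\<phi> p) \<and>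
      \<phi> p ` U p = K \<inter> T p \<and> emeasure (patch_measure K (U p) (\<phi> p)) K < \<infinity>"
    by metis
  have "compact K"
    using K by (simp add: smooth_simple_closed_hypersurface_def)
  then obtain P where P: "P \<subseteq> K" "finite P" "K \<subseteq> (\<Union>p\<in>P. T p)"
    by (rule compactE_image[of K K T]) (use T in auto)
  obtain h where h: "bij_betw h {0..<card P} P"
    using ex_bij_betw_nat_finite[OF P(2)] by blast
  define N where "N = card P"
  have hP: "h i \<in> P" "h i \<in> K" if "i < N" for i
    using h that P(1) by (auto simp: bij_betw_def N_def)
  \<comment> \<open>Overlaps are removed in the order of the indices: every point of
    \<open>K\<close> is assigned to the first patch that contains it.\<close>
  define B where "B i = \<phi> (h i) ` U (h i) - (\<Union>j<i. \<phi> (h j) ` U (h j))" for i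
  show thesis
  proof (rule that)
    show patch: "smooth_patch K (U (h i)) (\<phi> (h i))" if "i < N" for i
      using T hP that by blast
    show "emeasure (patch_measure K (U (h i)) (\<phi> (h i))) K < \<infinity>" if "i < N" for i
      using T hP that by blast
    show "B i \<subseteq> \<phi> (h i) ` U (h i)" if "i < N" for i
      by (auto simp: B_def)
    show "B i \<in> sets (restrict_space borel K)" if "i < N" for i
      unfolding B_def using that by (intro sets.Diff sets.finite_UN sets_patch_image patch) auto
    show "disjoint_family_on B {..<N}"
      unfolding disjoint_family_on_def
    proof (intro ballI impI)
      fix i j :: nat assume "i \<noteq> j"
      then show "B i \<inter> B j = {}"
        by (cases i j rule: linorder_cases) (auto simp: B_def)
    qed
    show "(\<Union>i<N. B i) = K"
    proof (intro equalityI subsetI)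
      fix q assume q: "q \<in> K"
      then obtain p where p: "p \<in> P" "q \<in> T p"
        using P(3) by blast
      have "p \<in> h ` {0..<card P}"
        using h p(1) by (simp add: bij_betw_def)
      then obtain i where i: "i < N" "h i = p"
        by (auto simp: N_def)
      define k where "k = (LEAST k. q \<in> \<phi> (h k) ` U (h k))"
      have qi: "q \<in> \<phi> (h i) ` U (h i)"
        using p i q T P(1) by blast
      have "q \<in> \<phi> (h k) ` U (h k)" "k \<le> i"
        unfolding k_def using LeastI[of "\<lambda>k. q \<in> \<phi> (h k) ` U (h k)", OF qi]
          Least_le[of "\<lambda>k. q \<in> \<phi> (h k) ` U (h k)", OF qi] by simp_all
      moreover have "q \<notin> \<phi> (h j) ` U (h j)" if "j < k" for j
        using not_less_Least that unfolding k_def by blast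
      ultimately have "q \<in> B k" "k < N"
        using i(1) by (auto simp: B_def)
      then show "q \<in> (\<Union>i<N. B i)"
        by blast
    next
      fix q assume "q \<in> (\<Union>i<N. B i)"
      then show "q \<in> K"
        using smooth_patchD(7)[OF patch] by (auto simp: B_def)
    qed
  qed
qed

lemma finite_sum_of_measures:
  assumes "finite I" and sets: "\<And>i. i \<in> I \<Longrightarrow> sets (\<nu> i) = sets N"
  obtains M where "sets M = sets N" "\<And>A. A \<in> sets N \<Longrightarrow> emeasure M A = (\<Sum>i\<in>I. emeasure (\<nu> i) A)"
proof
  define \<mu> where "\<mu> A = (\<Sum>i\<in>I. emeasure (\<nu> i) A)" for A
  let ?M = "measure_of (space N) (sets N) \<mu>"
  show "sets ?M = sets N"
    by simp
  show "emeasure ?M A = (\<Sum>i\<in>I. emeasure (\<nu> i) A)" if A: "A \<in> sets N" for A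
  proof -
    have "emeasure ?M A = \<mu> A"
    proof (rule emeasure_measure_of_sigma[OF sets.sigma_algebra_axioms _ _ A])
      show "positive (sets N) \<mu>"
        by (simp add: positive_def \<mu>_def)
      show "countably_additive (sets N) \<mu>"
      proof (rule countably_additiveI)
        fix A :: "nat \<Rightarrow> _" assume A: "range A \<subseteq> sets N" "disjoint_family A"
        have "(\<Sum>n. \<mu> (A n)) = (\<Sum>i\<in>I. \<Sum>n. emeasure (\<nu> i) (A n))"
          unfolding \<mu>_def by (rule suminf_sum) auto
        also have "\<dots> = \<mu> (\<Union>n. A n)"
          unfolding \<mu>_def using A sets by (intro sum.cong refl suminf_emeasure) auto
        finally show "(\<Sum>n. \<mu> (A n)) = \<mu> (\<Union>n. A n)" .
      qed
    qed
    then show ?thesis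
      by (simp add: \<mu>_def)
  qed
qed

text \<open>A compact \<open>K\<close> is Borel, so the Borel sets in the definition are the
  measurable sets of the subspace. The area integral can then be replaced by the value of a measure,
  for which additivity is available.\<close>

lemma is_surface_measure_iff:
  "is_surface_measure K M \<longleftrightarrow> sets M = sets (restrict_space borel K) \<and>
    (\<forall>U \<phi> A. smooth_patch K U \<phi> \<longrightarrow> A \<in> sets (restrict_space borel K) \<longrightarrow> A \<subseteq> \<phi> ` U \<longrightarrow>
      emeasure M A = emeasure (patch_measure K U \<phi>) A)"
  if "compact K"
proof -
  have "A \<in> sets (restrict_space borel K) \<longleftrightarrow> A \<in> sets borel"
    if "smooth_patch K U \<phi>" "A \<subseteq> \<phi> ` U" for U \<phi> A
    using \<open>compact K\<close> smooth_patchD(7)[OF that(1)] that(2)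
    by (subst sets_restrict_space_iff) (auto intro: borel_compact)
  then show ?thesis
    unfolding is_surface_measure_def using emeasure_patch_measure by (metis (no_types, lifting))
qed

text \<open>On each piece \<open>B i\<close> the measure is prescribed by its patch, so additivity
  leaves at most one candidate. The sum of the restricted patch measures is that candidate, and it
  obeys the area formula in every other patch since patch measures agree on overlaps.\<close>

lemma ex1_surface_measure:
  assumes K: "smooth_simple_closed_hypersurface K"
  shows "\<exists>!M. is_surface_measure K M" and "is_surface_measure K M \<Longrightarrow> emeasure M K < \<infinity>"
proof -
  have cK: "compact K"
    using K by (simp add: smooth_simple_closed_hypersurface_def)
  obtain N :: nat and U \<phi> B where
    patch: "\<And>i. i < N \<Longrightarrow> smooth_patch K (U i) (\<phi> i)"
    and fin: "\<And>i. i < N \<Longrightarrow> emeasure (patch_measure K (U i) (\<phi> i)) K < \<infinity>"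
    and B: "\<And>i. i < N \<Longrightarrow> B i \<subseteq> \<phi> i ` U i" "\<And>i. i < N \<Longrightarrow> B i \<in> sets (restrict_space borel K)"
    and disj: "disjoint_family_on B {..<N}" and UB: "(\<Union>i<N. B i) = K"
    using finite_patch_partition[OF K] by metis
  let ?R = "restrict_space borel K"
  have split: "emeasure M A = (\<Sum>i<N. emeasure M (B i \<inter> A))" if M: "sets M = sets ?R" and A: "A \<in> sets ?R" for M A
  proof -
    have "A \<subseteq> K"
      using sets.sets_into_space[OF A] by (auto simp: space_restrict_space)
    then have "A = (\<Union>i<N. B i \<inter> A)"
      using UB by blast
    moreover have "disjoint_family_on (\<lambda>i. B i \<inter> A) {..<N}"
      using disj unfolding disjoint_family_on_def by blast
    then have "(\<Sum>i<N. emeasure M (B i \<inter> A)) = emeasure M (\<Union>i<N. B i \<inter> A)"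
      using B(2) A M by (intro sum_emeasure) auto
    ultimately show ?thesis by simp
  qed
  have formula: "emeasure M A = (\<Sum>i<N. emeasure (patch_measure K (U i) (\<phi> i)) (B i \<inter> A))"
    if M: "is_surface_measure K M" and A: "A \<in> sets ?R" for M A
  proof -
    have "emeasure M (B i \<inter> A) = emeasure (patch_measure K (U i) (\<phi> i)) (B i \<inter> A)" if "i < N" for i
      using M patch[OF that] B[OF that] A unfolding is_surface_measure_iff[OF cK] by blast
    then show ?thesis
      using split[of M A] M A unfolding is_surface_measure_iff[OF cK] by simp
  qed
  define \<nu> where "\<nu> i = density (patch_measure K (U i) (\<phi> i)) (indicator (B i))" for i
  have \<nu>: "emeasure (\<nu> i) A = emeasure (patch_measure K (U i) (\<phi> i)) (B i \<inter> A)" if "i < N" "A \<in> sets ?R" for i A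
    unfolding \<nu>_def using that B(2) by (intro emeasure_restricted) auto
  obtain M where M: "sets M = sets ?R" "\<And>A. A \<in> sets ?R \<Longrightarrow> emeasure M A = (\<Sum>i<N. emeasure (\<nu> i) A)"
    by (rule finite_sum_of_measures[of "{..<N}" \<nu> ?R]) (auto simp: \<nu>_def)
  have "is_surface_measure K M"
    unfolding is_surface_measure_iff[OF cK]
  proof (intro conjI allI impI)
    fix V \<eta> A assume \<eta>: "smooth_patch K V \<eta>" and A: "A \<in> sets ?R" "A \<subseteq> \<eta> ` V"
    have "emeasure M A = (\<Sum>i<N. emeasure (patch_measure K (U i) (\<phi> i)) (B i \<inter> A))"
      using M(2)[OF A(1)] \<nu> A(1) by simp
    also have "\<dots> = (\<Sum>i<N. emeasure (patch_measure K V \<eta>) (B i \<inter> A))"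
      using B A by (intro sum.cong refl emeasure_patch_measure_cong patch \<eta>) auto
    also have "\<dots> = emeasure (patch_measure K V \<eta>) A"
      using split[of "patch_measure K V \<eta>" A] A by simp
    finally show "emeasure M A = emeasure (patch_measure K V \<eta>) A" .
  qed (rule M)
  moreover have "M' = M" if "is_surface_measure K M'" for M'
  proof (rule measure_eqI)
    show "sets M' = sets M"
      using that M(1) by (simp add: is_surface_measure_def)
    show "emeasure M' A = emeasure M A" if "A \<in> sets M'" for A
      using that formula \<open>is_surface_measure K M\<close> \<open>is_surface_measure K M'\<close>
      by (simp add: is_surface_measure_def)
  qed
  ultimately show "\<exists>!M. is_surface_measure K M"
    by blast
  show "emeasure M K < \<infinity>" if "is_surface_measure K M" for M
  proof -
    have KR: "K \<in> sets ?R"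
      by (auto simp: sets_restrict_space)
    have "emeasure (patch_measure K (U i) (\<phi> i)) (B i \<inter> K) < \<infinity>" if "i < N" for i
      using fin[OF that] emeasure_mono[of "B i \<inter> K" K "patch_measure K (U i) (\<phi> i)"] KR
      by (simp add: le_less_trans)
    then show ?thesis
      unfolding formula[OF that KR] by simp
  qed
qed

lemma
  assumes K: "smooth_simple_closed_hypersurface K"
  shows is_surface_measure_surface_measure: "is_surface_measure K (surface_measure K)"
    and sets_surface_measure: "sets (surface_measure K) = sets (restrict_space borel K)"
    and space_surface_measure: "space (surface_measure K) = K"
    and emeasure_surface_measure_finite: "emeasure (surface_measure K) K < \<infinity>"
proof -
  show 1: "is_surface_measure K (surface_measure K)"
    unfolding surface_measure_def using ex1_surface_measure(1)[OF K] by (rule theI')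
  then show 2: "sets (surface_measure K) = sets (restrict_space borel K)"
    by (simp add: is_surface_measure_def)
  show "space (surface_measure K) = K"
    using sets_eq_imp_space_eq[OF 2] by (simp add: space_restrict_space)
  show "emeasure (surface_measure K) K < \<infinity>"
    using ex1_surface_measure(2)[OF K 1] .
qed

text \<open>The surface measure cut down to the patch is the patch measure, and a function that
  vanishes off the patch does not see the rest of \<open>K\<close>.\<close>

lemma integral_surface_measure_patch:
  fixes F :: "quat \<Rightarrow> 'b::{banach, second_countable_topology}"
  assumes K: "smooth_simple_closed_hypersurface K" and \<phi>: "smooth_patch K U \<phi>"
    and F: "F \<in> borel_measurable (surface_measure K)" "\<And>p. p \<in> K - \<phi> ` U \<Longrightarrow> F p = 0"
  shows "(\<integral>p. F p \<partial>surface_measure K) = (LINT u:U|lborel. area_density \<phi> u *\<^sub>R F (\<phi> u))"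
proof -
  let ?M = "surface_measure K" and ?P = "patch_measure K U \<phi>"
  have cK: "compact K"
    using K by (simp add: smooth_simple_closed_hypersurface_def)
  note sets = sets_surface_measure[OF K]
  have \<phi>U: "\<phi> ` U \<in> sets ?M"
    using sets_patch_image[OF \<phi>] by (simp add: sets)
  have "density ?M (\<lambda>p. ennreal (indicator (\<phi> ` U) p)) = ?P"
  proof (rule measure_eqI)
    fix A assume "A \<in> sets (density ?M (\<lambda>p. ennreal (indicator (\<phi> ` U) p)))"
    then have A: "A \<in> sets ?M"
      by simp
    then have "emeasure (density ?M (\<lambda>p. ennreal (indicator (\<phi> ` U) p))) A = emeasure ?M (\<phi> ` U \<inter> A)"
      using \<phi>U by (simp add: ennreal_indicator emeasure_restricted)
    also have "\<dots> = emeasure ?P (\<phi> ` U \<inter> A)"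
      using is_surface_measure_surface_measure[OF K] \<phi> A \<phi>U
      unfolding is_surface_measure_iff[OF cK] by (simp add: sets.Int)
    also have "\<dots> = emeasure ?P A"
      using A \<phi>U unfolding sets
      by (simp add: emeasure_patch_measure[OF \<phi>] sets.Int cong: conj_cong)
    finally show "emeasure (density ?M (\<lambda>p. ennreal (indicator (\<phi> ` U) p))) A = emeasure ?P A" .
  qed (simp add: sets)
  moreover have "(\<integral>p. F p \<partial>?M) = (\<integral>p. indicator (\<phi> ` U) p *\<^sub>R F p \<partial>?M)"
    using F(2) by (intro Bochner_Integration.integral_cong) (auto simp: space_surface_measure[OF K] indicator_def)
  moreover have "\<dots> = (\<integral>p. F p \<partial>density ?M (\<lambda>p. ennreal (indicator (\<phi> ` U) p)))"
    using F(1) \<phi>U by (subst integral_density) auto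
  ultimately have "(\<integral>p. F p \<partial>?M) = (\<integral>p. F p \<partial>?P)"
    by simp
  also have "\<dots> = (\<integral>u. F (\<phi> u) \<partial>density (restrict_space lborel U) (\<lambda>u. ennreal (area_density \<phi> u)))"
    unfolding patch_measure_def using patch_measurable(1)[OF \<phi>] F(1)
    by (intro integral_distr) (simp_all add: measurable_cong_sets[OF sets refl])
  also have "\<dots> = (\<integral>u. area_density \<phi> u *\<^sub>R F (\<phi> u) \<partial>restrict_space lborel U)"
  proof (rule integral_density)
    show "(\<lambda>u. F (\<phi> u)) \<in> borel_measurable (restrict_space lborel U)"
      using measurable_compose[OF patch_measurable(1)[OF \<phi>]] F(1) by (simp add: measurable_cong_sets[OF sets refl])
    show "area_density \<phi> \<in> borel_measurable (restrict_space lborel U)"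
      by (rule patch_measurable(2)[OF \<phi>])
    show "AE u in restrict_space lborel U. 0 \<le> area_density \<phi> u"
      using area_density_nonneg[OF \<phi>] by (intro AE_I2) (simp add: space_restrict_space)
  qed
  also have "\<dots> = (LINT u:U|lborel. area_density \<phi> u *\<^sub>R F (\<phi> u))"
    using smooth_patchD(1)[OF \<phi>] unfolding set_lebesgue_integral_def by (subst integral_restrict_space) auto
  finally show ?thesis .
qed

section \<open>The divergence theorem\<close>

lemma has_vector_derivative_line:
  assumes "(g has_derivative D) (at (a + s *\<^sub>R w))"
  shows "((\<lambda>s. g (a + s *\<^sub>R w)) has_vector_derivative D w) (at s within T)"
proof -
  have "((\<lambda>s. a + s *\<^sub>R w) has_derivative (\<lambda>h. h *\<^sub>R w)) (at s)"
    by (auto intro!: derivative_eq_intros)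
  from has_derivative_compose[OF this assms]
  have "((\<lambda>s. g (a + s *\<^sub>R w)) has_derivative (\<lambda>h. D (h *\<^sub>R w))) (at s)" .
  moreover have "(\<lambda>h. D (h *\<^sub>R w)) = (\<lambda>h. h *\<^sub>R D w)"
    using linear_scale[OF has_derivative_linear[OF assms]] by auto
  ultimately show ?thesis
    unfolding has_vector_derivative_def by (simp add: has_derivative_at_withinI)
qed

text \<open>Near \<open>x\<close> the function is constant. Applied off closed balls, this carries
  support conditions on \<open>g\<close> over to \<open>g'\<close>.\<close>

lemma C1_on_zero_imp_deriv_zero:
  assumes g: "C1_on g g' S" and "open G" "x \<in> G" "G \<subseteq> S" "\<And>y. y \<in> G \<Longrightarrow> g y = 0"
  shows "g' x h = 0"
proof -
  have "((\<lambda>_. 0) has_derivative g' x) (at x)"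
    using C1_onD(1)[OF g, of x] assms(2-5) has_derivative_transform_within_open[of g "g' x" x UNIV G "\<lambda>_. 0"]
    by auto
  then have "g' x = (\<lambda>_. 0)"
    by (rule has_derivative_unique[OF _ has_derivative_const])
  then show ?thesis by simp
qed

text \<open>By translation invariance the integral of \<open>G (x + t *\<^sub>R w)\<close> over the
  whole space does not depend on \<open>t\<close>; its derivative at \<open>t = 0\<close>, taken
  under the integral sign, is the integral in question.\<close>

lemma integral_directional_derivative_eq_0:
  fixes G :: "'a::euclidean_space \<Rightarrow> 'b::euclidean_space"
  assumes G: "C1_on G G' UNIV" and supp: "\<And>x. x \<notin> ball p r \<Longrightarrow> G x = 0"
  shows "(\<integral>x. G' x w \<partial>lborel) = 0"
proof -
  have contG: "continuous_on UNIV G"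
    using G by (rule C1_on_continuous)
  have supp': "G' x h = 0" if "x \<notin> cball p r" for x h
    by (rule C1_on_zero_imp_deriv_zero[OF G, of "- cball p r"]) (use that supp in \<open>auto simp: open_Compl\<close>)
  \<comment> \<open>The margin \<open>norm w\<close> lets one box contain the supports of all
    translates with \<open>t\<close> in the unit ball, so the Leibniz rule works over a fixed
    compact box.\<close>
  obtain a b where ab: "cball p (r + norm w) \<subseteq> cbox a b"
    using bounded_subset_cbox_symmetric[OF bounded_cball] by metis
  have int_lborel: "integral (cbox a b) F = (\<integral>x. F x \<partial>lborel)"
    if F: "continuous_on UNIV F" "\<And>x. x \<notin> cbox a b \<Longrightarrow> F x = 0" for F :: "'a \<Rightarrow> 'b"
  proof -
    have "integrable lborel (\<lambda>x. indicator (cbox a b) x *\<^sub>R F x)"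
      using continuous_on_subset[OF F(1)] by (intro borel_integrable_compact) auto
    moreover have "(\<lambda>x. indicator (cbox a b) x *\<^sub>R F x) = F"
      using F(2) by (auto simp: indicator_def fun_eq_iff)
    ultimately have "(F has_integral (\<integral>x. F x \<partial>lborel)) UNIV"
      using has_integral_integral_lborel by metis
    moreover have "(\<lambda>x. if x \<in> cbox a b then F x else 0) = F"
      using F(2) by auto
    ultimately have "(F has_integral (\<integral>x. F x \<partial>lborel)) (cbox a b)"
      using has_integral_restrict_UNIV[of "cbox a b" F] by simp
    then show ?thesis by (rule integral_unique)
  qed
  have shift: "integral (cbox a b) (\<lambda>x. G (x + t *\<^sub>R w)) = (\<integral>x. G x \<partial>lborel)" if t: "t \<in> ball 0 1" for t :: real
  proof -
    have "G (x + t *\<^sub>R w) = 0" if "x \<notin> cbox a b" for x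
    proof (rule supp)
      have "norm (t *\<^sub>R w) \<le> norm w"
        using t by (simp add: mult_left_le_one_le)
      moreover have "r + norm w < dist p x"
        using that ab by (meson mem_cball not_le subsetD)
      moreover have "dist p x \<le> dist p (x + t *\<^sub>R w) + norm (t *\<^sub>R w)"
        using dist_triangle[of p x "x + t *\<^sub>R w"] by (simp add: dist_norm)
      ultimately show "x + t *\<^sub>R w \<notin> ball p r"
        by simp
    qed
    moreover have "continuous_on UNIV (\<lambda>x. G (x + t *\<^sub>R w))"
      by (intro continuous_on_compose2[OF contG] continuous_intros) auto
    ultimately have "integral (cbox a b) (\<lambda>x. G (x + t *\<^sub>R w)) = (\<integral>x. G (x + t *\<^sub>R w) \<partial>lborel)"
      by (intro int_lborel) auto
    also have "\<dots> = (\<integral>x. G x \<partial>distr lborel borel ((+) (t *\<^sub>R w)))"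
      using contG by (subst integral_distr) (auto simp: add.commute borel_measurable_continuous_onI)
    also have "\<dots> = (\<integral>x. G x \<partial>lborel)"
      by (simp add: lborel_distr_plus)
    finally show ?thesis .
  qed
  have "((\<lambda>t. integral (cbox a b) (\<lambda>x. G (x + t *\<^sub>R w))) has_vector_derivative
      integral (cbox a b) (\<lambda>x. G' (x + 0 *\<^sub>R w) w)) (at 0 within ball 0 1)"
  proof (rule leibniz_rule_vector_derivative)
    show "((\<lambda>t. G (x + t *\<^sub>R w)) has_vector_derivative G' (x + t *\<^sub>R w) w) (at t within ball 0 1)" for t x
      using C1_onD(1)[OF G] by (intro has_vector_derivative_line) auto
    show "(\<lambda>x. G (x + t *\<^sub>R w)) integrable_on cbox a b" for t
      by (intro integrable_continuous continuous_on_compose2[OF contG] continuous_intros) auto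
    have "continuous_on (ball 0 1 \<times> cbox a b) (\<lambda>z. G' (snd z + fst z *\<^sub>R w) w)"
      by (intro continuous_on_compose2[OF C1_onD(2)[OF G]] continuous_intros) auto
    then show "continuous_on (ball 0 1 \<times> cbox a b) (\<lambda>(t, x). G' (x + t *\<^sub>R w) w)"
      by (simp add: case_prod_unfold)
  qed auto
  then have "((\<lambda>t. (\<integral>x. G x \<partial>lborel)) has_vector_derivative
      integral (cbox a b) (\<lambda>x. G' (x + 0 *\<^sub>R w) w)) (at 0 within ball 0 1)"
    by (rule has_vector_derivative_transform[rotated 2]) (simp_all add: shift)
  then have "integral (cbox a b) (\<lambda>x. G' x w) = 0"
    using vector_derivative_unique_at[OF _ has_vector_derivative_const]
    by (simp add: at_within_open[of 0 "ball 0 1"])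
  moreover have "cball p r \<subseteq> cbox a b"
    using ab subset_cball[of r "r + norm w" p] by auto
  then have "integral (cbox a b) (\<lambda>x. G' x w) = (\<integral>x. G' x w \<partial>lborel)"
    using supp' by (intro int_lborel C1_onD(2)[OF G]) blast
  ultimately show ?thesis by simp
qed

section \<open>Jacobians, continuity of the normal, and the divergence theorem in one slab\<close>

locale oriented_hypersurface =
  fixes K :: "quat set" and n :: "quat \<Rightarrow> quat"
  assumes hypersurface: "smooth_simple_closed_hypersurface K"
    and normal: "outward_unit_normal K n"
begin

lemma compact_K: "compact K"
  using hypersurface by (simp add: smooth_simple_closed_hypersurface_def)

lemma compact_closure_inside: "compact (K \<union> inside K)"
proof -
  have "closed (K \<union> inside K)"
    unfolding union_with_inside using open_outside[OF compact_imp_closed[OF compact_K]]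
    by (simp add: closed_def)
  moreover have "bounded (K \<union> inside K)"
    using bounded_inside[OF compact_imp_bounded[OF compact_K]] compact_imp_bounded[OF compact_K] by simp
  ultimately show ?thesis
    by (simp add: compact_eq_bounded_closed)
qed

lemma open_inside_K: "open (inside K)"
  using compact_imp_closed[OF compact_K] by (rule open_inside)

lemma norm_normal: "q \<in> K \<Longrightarrow> norm (n q) = 1"
  using normal by (simp add: outward_unit_normal_def)

lemma set_integrable_inside:
  fixes f :: "quat \<Rightarrow> 'b::euclidean_space"
  assumes "continuous_on (K \<union> inside K) f"
  shows "set_integrable lebesgue (inside K) f"
proof -
  have *: "integrable lborel (\<lambda>x. indicator (K \<union> inside K) x *\<^sub>R f x)"
    using assms compact_closure_inside by (intro borel_integrable_compact)
  then have "set_integrable lebesgue (K \<union> inside K) f"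
    unfolding set_integrable_def using integrable_completion[OF borel_measurable_integrable[OF *]] by simp
  then show ?thesis
    by (rule set_integrable_subset) (use open_inside_K in auto)
qed

lemma slab_jacobian:
  assumes \<phi>: "smooth_patch K U \<phi>" and u: "u \<in> U"
  shows "\<bar>det (matrix (slab_map (tangent_map \<phi> u) w))\<bar> = \<bar>n (\<phi> u) \<bullet> w\<bar> * area_density \<phi> u"
    and "area_density \<phi> u > 0"
    and "det (matrix (slab_map (tangent_map \<phi> u) w))
      = det (matrix (slab_map (tangent_map \<phi> u) (n (\<phi> u)))) * (n (\<phi> u) \<bullet> w)"
proof -
  note * = abs_det_slab_map[OF smooth_patchD(8,3)[OF \<phi> u] outward_unit_normalD(1,2)[OF normal \<phi> u]]
  show "\<bar>det (matrix (slab_map (tangent_map \<phi> u) w))\<bar> = \<bar>n (\<phi> u) \<bullet> w\<bar> * area_density \<phi> u"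
    using *(1)[of w] by (simp add: area_density_def Let_def)
  show "area_density \<phi> u > 0"
    using *(2) by (simp add: area_density_def Let_def)
  show "det (matrix (slab_map (tangent_map \<phi> u) w))
      = det (matrix (slab_map (tangent_map \<phi> u) (n (\<phi> u)))) * (n (\<phi> u) \<bullet> w)"
    by (rule *(3))
qed

lemma continuous_on_det_slab_map:
  assumes \<phi>: "smooth_patch K U \<phi>"
  shows "continuous_on U (\<lambda>u. det (matrix (slab_map (tangent_map \<phi> u) w)))"
proof -
  have "continuous_on U (\<lambda>u. tangent_map \<phi> u h)" for h
    using C1_onD(2)[OF smooth_patchD(2)[OF \<phi>]] .
  then show ?thesis
    unfolding det_def matrix_def slab_map_def by (auto intro!: continuous_intros)
qed

text \<open>The outward normal is specified point by point, so its continuity needs proof. Near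
  \<open>p\<close> the fixed vector \<open>n p\<close> is transversal to \<open>K\<close>, and
  determinants of slab maps give every component of the normal as a continuous function of the
  parameter.\<close>

lemma continuous_on_normal: "continuous_on K n"
  unfolding continuous_on_eq_continuous_within
proof
  fix p assume p: "p \<in> K"
  have "n p \<bullet> n p > 0"
    using norm_normal[OF p] by (simp add: norm_eq_1)
  from outward_normal_slab[OF hypersurface normal p this]
  obtain U \<phi> where \<phi>: "smooth_patch K U \<phi>" and p\<phi>: "p \<in> \<phi> ` U"
    and pos: "\<And>u. u \<in> U \<Longrightarrow> n (\<phi> u) \<bullet> n p > 0"
    by metis
  let ?d = "\<lambda>u x. det (matrix (slab_map (tangent_map \<phi> u) x))"
  have d0: "?d u (n p) \<noteq> 0" if "u \<in> U" for u
    using slab_jacobian(1)[OF \<phi> that, of "n p"] slab_jacobian(2)[OF \<phi> that] pos[OF that] by auto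
  \<comment> \<open>The determinants for \<open>x\<close> and for \<open>n p\<close> contain the
    same factor \<open>c\<close>, whose sign is unknown; it cancels in their quotient. The absolute
    value of the second determinant divided by the area density restores
    \<open>n (\<phi> u) \<bullet> n p\<close>.\<close>
  have eq: "n (\<phi> u) \<bullet> x = ?d u x * \<bar>?d u (n p)\<bar> / (?d u (n p) * area_density \<phi> u)" if u: "u \<in> U" for u x
  proof -
    define c where "c = ?d u (n (\<phi> u))"
    have "?d u x = c * (n (\<phi> u) \<bullet> x)" "?d u (n p) = c * (n (\<phi> u) \<bullet> n p)"
      using slab_jacobian(3)[OF \<phi> u] unfolding c_def by blast+
    moreover have "\<bar>?d u (n p)\<bar> = (n (\<phi> u) \<bullet> n p) * area_density \<phi> u"
      using slab_jacobian(1)[OF \<phi> u, of "n p"] pos[OF u] by simp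
    ultimately show ?thesis
      using d0[OF u] pos[OF u] slab_jacobian(2)[OF \<phi> u] by (simp add: field_simps)
  qed
  have "continuous_on U (\<lambda>u. n (\<phi> u))"
  proof (subst continuous_on_componentwise, intro ballI)
    fix b :: quat
    have "continuous_on U (\<lambda>u. ?d u b * \<bar>?d u (n p)\<bar> / (?d u (n p) * area_density \<phi> u))"
      using d0 slab_jacobian(2)[OF \<phi>]
      by (intro continuous_intros continuous_on_det_slab_map[OF \<phi>] continuous_on_area_density[OF \<phi>])
         (auto simp: less_le)
    then show "continuous_on U (\<lambda>u. n (\<phi> u) \<bullet> b)"
      by (rule continuous_on_eq) (simp add: eq)
  qed
  moreover obtain \<psi> where \<psi>: "homeomorphism U (\<phi> ` U) \<phi> \<psi>"
    using \<phi> by (auto simp: smooth_patch_def)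
  ultimately have "continuous_on (\<phi> ` U) (\<lambda>q. n (\<phi> (\<psi> q)))"
    using \<psi> by (intro continuous_on_compose2[of U "\<lambda>u. n (\<phi> u)" "\<phi> ` U" \<psi>]) (auto simp: homeomorphism_def)
  then have "continuous_on (\<phi> ` U) n"
    by (rule continuous_on_eq) (use \<psi> in \<open>auto simp: homeomorphism_def\<close>)
  moreover obtain T where T: "open T" "\<phi> ` U = K \<inter> T"
    using smooth_patchD(4)[OF \<phi>] openin_open by metis
  ultimately have "continuous (at p within (K \<inter> T)) n"
    using p\<phi> by (simp add: continuous_on_eq_continuous_within)
  moreover have "at p within (K \<inter> T) = at p within K"
    using T p\<phi> by (intro at_within_nhd[of p T]) auto
  ultimately show "continuous (at p within K) n"
    by simp
qed

lemma measurable_surface: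
  fixes F :: "quat \<Rightarrow> 'b::{banach, second_countable_topology}"
  assumes "continuous_on K F"
  shows "F \<in> borel_measurable (surface_measure K)"
  using borel_measurable_continuous_on_restrict[OF assms]
  by (simp add: measurable_cong_sets[OF sets_surface_measure[OF hypersurface] refl])

lemma integrable_surface:
  fixes F :: "quat \<Rightarrow> 'b::{banach, second_countable_topology}"
  assumes F: "continuous_on K F"
  shows "integrable (surface_measure K) F"
proof -
  interpret finite_measure "surface_measure K"
  proof (rule finite_measureI)
    show "emeasure (surface_measure K) (space (surface_measure K)) \<noteq> \<infinity>"
      unfolding space_surface_measure[OF hypersurface]
      using emeasure_surface_measure_finite[OF hypersurface] by simp
  qed
  have "bounded (F ` K)"
    using compact_imp_bounded[OF compact_continuous_image[OF F compact_K]] .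
  then obtain B where B: "\<forall>x\<in>F ` K. norm x \<le> B"
    unfolding bounded_iff by blast
  show ?thesis
  proof (rule integrable_const_bound)
    show "AE q in surface_measure K. norm (F q) \<le> B"
      using B by (intro AE_I2) (simp add: space_surface_measure[OF hypersurface])
  qed (rule measurable_surface[OF F])
qed

text \<open>In slab coordinates the integrand is \<open>J u\<close> times the derivative of
  \<open>g (\<phi> u + s *\<^sub>R w)\<close> in \<open>s\<close>. Since \<open>J\<close> does not
  involve \<open>s\<close>, integrating over \<open>s\<close> first leaves the value at
  \<open>s = 0\<close>, which lies on \<open>K\<close>, minus the value on the bottom face, which is
  zero by \<open>bot\<close>.\<close>

lemma slab_divergence:
  fixes g :: "quat \<Rightarrow> quat"
  assumes \<phi>: "smooth_patch K U \<phi>" and \<delta>: "\<delta> > 0"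
    and inj: "inj_on (slab_map \<phi> w) {y. proj3 y \<in> U \<and> \<bar>y $ 4\<bar> \<le> \<delta>}"
    and ins: "\<And>u s. u \<in> U \<Longrightarrow> - \<delta> \<le> s \<Longrightarrow> s < 0 \<Longrightarrow> \<phi> u + s *\<^sub>R w \<in> inside K"
    and pos: "\<And>u. u \<in> U \<Longrightarrow> n (\<phi> u) \<bullet> w > 0"
    and Q: "Q = {y \<in> slab U \<delta>. y $ 4 < 0}" and QO: "open (slab_map \<phi> w ` Q)"
    and g: "C1_on g g' \<Omega>" and \<Omega>: "K \<union> inside K \<subseteq> \<Omega>"
    and bot: "\<And>u. u \<in> U \<Longrightarrow> g (\<phi> u - \<delta> *\<^sub>R w) = 0"
  shows "(LINT x:slab_map \<phi> w ` Q|lebesgue. g' x w)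
    = (LINT u:U|lborel. area_density \<phi> u *\<^sub>R ((n (\<phi> u) \<bullet> w) *\<^sub>R g (\<phi> u)))"
proof -
  define J where "J u = (n (\<phi> u) \<bullet> w) * area_density \<phi> u" for u
  let ?\<Phi> = "slab_map \<phi> w"
  have contf: "continuous_on (K \<union> inside K) (\<lambda>x. g' x w)"
    using C1_onD(2)[OF g] \<Omega> by (rule continuous_on_subset)
  have Qin: "?\<Phi> y \<in> inside K" "proj3 y \<in> U" if "y \<in> Q" for y
    using that ins[of "proj3 y" "y $ 4"] by (auto simp: Q slab_def slab_map_def)
  have openQ: "open Q"
  proof -
    have "open (slab U \<delta> \<inter> {y. y $ 4 < 0})"
      by (intro open_Int open_slab smooth_patchD(1)[OF \<phi>] open_Collect_less continuous_intros)
    then show ?thesis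
      by (simp add: Q Collect_conj_eq)
  qed
  have injQ: "inj_on ?\<Phi> Q"
    by (rule inj_on_subset[OF inj]) (auto simp: Q slab_def)
  have der: "(?\<Phi> has_derivative slab_map (tangent_map \<phi> (proj3 y)) w) (at y within Q)" if "y \<in> Q" for y
    using has_derivative_slab_map[OF C1_onD(1)[OF smooth_patchD(2)[OF \<phi>] Qin(2)[OF that]]]
    by (rule has_derivative_at_withinI)
  have J: "\<bar>det (matrix (slab_map (tangent_map \<phi> (proj3 y)) w))\<bar> = J (proj3 y)" if "y \<in> Q" for y
    using slab_jacobian(1)[OF \<phi> Qin(2)[OF that], of w] pos[OF Qin(2)[OF that]] by (simp add: J_def)
  have fint: "(\<lambda>x. g' x w) absolutely_integrable_on (?\<Phi> ` Q)"
  proof (rule set_integrable_subset[OF set_integrable_inside[OF contf]])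
    show "?\<Phi> ` Q \<in> sets lebesgue"
      using QO by simp
    show "?\<Phi> ` Q \<subseteq> inside K"
      using Qin(1) by blast
  qed
  have Qs: "Q \<in> sets lebesgue"
    using openQ by simp
  have cv: "(\<lambda>y. \<bar>det (matrix (slab_map (tangent_map \<phi> (proj3 y)) w))\<bar> *\<^sub>R g' (?\<Phi> y) w) absolutely_integrable_on Q \<and>
      integral Q (\<lambda>y. \<bar>det (matrix (slab_map (tangent_map \<phi> (proj3 y)) w))\<bar> *\<^sub>R g' (?\<Phi> y) w)
        = integral (?\<Phi> ` Q) (\<lambda>x. g' x w)"
    by (rule iffD2[OF has_absolute_integral_change_of_variables[OF Qs der injQ] conjI[OF fint refl]])
  have Jint: "(\<lambda>y. J (proj3 y) *\<^sub>R g' (?\<Phi> y) w) absolutely_integrable_on Q"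
    using cv by (subst set_integrable_cong[OF refl refl, of _ _ "\<lambda>y. \<bar>det (matrix (slab_map (tangent_map \<phi> (proj3 y)) w))\<bar> *\<^sub>R g' (?\<Phi> y) w"])
      (auto simp: J)
  have Jeq: "integral Q (\<lambda>y. J (proj3 y) *\<^sub>R g' (?\<Phi> y) w) = integral (?\<Phi> ` Q) (\<lambda>x. g' x w)"
    using cv by (subst integral_cong[of Q _ "\<lambda>y. \<bar>det (matrix (slab_map (tangent_map \<phi> (proj3 y)) w))\<bar> *\<^sub>R g' (?\<Phi> y) w"])
      (auto simp: J)
  define G where "G y = indicator Q y *\<^sub>R (J (proj3 y) *\<^sub>R g' (?\<Phi> y) w)" for y
  have contJ: "continuous_on U J"
    unfolding J_def using smooth_patchD(6,7)[OF \<phi>]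
    by (intro continuous_intros continuous_on_area_density[OF \<phi>] continuous_on_compose2[OF continuous_on_normal])
  have "continuous_on Q (\<lambda>y. J (proj3 y) *\<^sub>R g' (?\<Phi> y) w)"
  proof (intro continuous_intros)
    show "continuous_on Q (\<lambda>y. J (proj3 y))"
      using Qin(2) by (intro continuous_on_compose2[OF contJ] linear_continuous_on bounded_linear_proj3) auto
    have "continuous_on Q ?\<Phi>"
      using der by (rule has_derivative_continuous_on)
    then show "continuous_on Q (\<lambda>y. g' (?\<Phi> y) w)"
      by (rule continuous_on_compose2[OF contf]) (use Qin(1) in blast)
  qed
  \<comment> \<open>Borel measurability permits the passage from the completed measure, in which the
    change of variables is stated, to \<open>lborel\<close>, where Fubini is applied.\<close>
  then have Gm: "G \<in> borel_measurable borel"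
    unfolding G_def[abs_def] using openQ by (intro borel_measurable_continuous_on_indicator) auto
  have "integrable lebesgue G"
    using Jint unfolding set_integrable_def G_def[abs_def] .
  then have Gi: "integrable lborel G"
    using integrable_completion[of G lborel] Gm by simp
  have "(LINT x:?\<Phi> ` Q|lebesgue. g' x w) = integral (?\<Phi> ` Q) (\<lambda>x. g' x w)"
    using fint by (rule set_lebesgue_integral_eq_integral(2))
  also have "\<dots> = (LINT y:Q|lebesgue. J (proj3 y) *\<^sub>R g' (?\<Phi> y) w)"
    unfolding Jeq[symmetric] using Jint by (rule set_lebesgue_integral_eq_integral(2)[symmetric])
  also have "\<dots> = (\<integral>y. G y \<partial>lebesgue)"
    unfolding set_lebesgue_integral_def G_def ..
  also have "\<dots> = (\<integral>y. G y \<partial>lborel)"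
    using Gm by (intro integral_completion) simp
  also have "\<dots> = (\<integral>y. G y \<partial>distr lborel lborel (\<lambda>(u, s). ext4 u s))"
    by (simp add: lborel_quat_split)
  also have "\<dots> = (\<integral>z. G ((\<lambda>(u, s). ext4 u s) z) \<partial>(lborel \<Otimes>\<^sub>M lborel))"
  proof -
    have "(\<lambda>(u, s). ext4 u s) \<in> borel_measurable borel"
      by (simp add: borel_measurable_continuous_onI linear_continuous_on bounded_linear_ext4)
    then show ?thesis
      unfolding lborel_prod using Gm by (subst integral_distr) auto
  qed
  also have "\<dots> = (\<integral>u. (\<integral>s. G (ext4 u s) \<partial>lborel) \<partial>lborel)"
  proof -
    have m: "(\<lambda>(u, s). ext4 u s) \<in> borel_measurable borel"
      by (simp add: borel_measurable_continuous_onI linear_continuous_on bounded_linear_ext4)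
    have "integrable (lborel \<Otimes>\<^sub>M lborel) (\<lambda>z. G ((\<lambda>(u, s). ext4 u s) z))"
      using Gi m Gm integrable_distr_eq[of "\<lambda>(u, s). ext4 u s" lborel lborel G]
      unfolding lborel_prod lborel_quat_split by simp
    from lborel_pair.integral_fst'[OF this] show ?thesis
      by simp
  qed
  also have "\<dots> = (\<integral>u. indicator U u *\<^sub>R (area_density \<phi> u *\<^sub>R ((n (\<phi> u) \<bullet> w) *\<^sub>R g (\<phi> u))) \<partial>lborel)"
  proof (intro Bochner_Integration.integral_cong refl)
    fix u :: "real^3"
    show "(\<integral>s. G (ext4 u s) \<partial>lborel) = indicator U u *\<^sub>R (area_density \<phi> u *\<^sub>R ((n (\<phi> u) \<bullet> w) *\<^sub>R g (\<phi> u)))"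
    proof (cases "u \<in> U")
      case False
      then show ?thesis
        by (simp add: G_def Q slab_def)
    next
      case True
      have inC: "\<phi> u + s *\<^sub>R w \<in> K \<union> inside K" if "s \<in> {- \<delta>..0}" for s
        using that ins[OF True, of s] smooth_patchD(7)[OF \<phi>] True by (cases "s = 0") auto
      have cont: "continuous_on {- \<delta>..0} (\<lambda>s. g' (\<phi> u + s *\<^sub>R w) w)"
      proof (rule continuous_on_compose2[OF contf])
        show "continuous_on {- \<delta>..0} (\<lambda>s. \<phi> u + s *\<^sub>R w)"
          by (intro continuous_intros)
        show "(\<lambda>s. \<phi> u + s *\<^sub>R w) ` {- \<delta>..0} \<subseteq> K \<union> inside K"
          using inC by blast
      qed
      then have contJ': "continuous_on {- \<delta>..0} (\<lambda>s. J u *\<^sub>R g' (\<phi> u + s *\<^sub>R w) w)"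
        by (intro continuous_intros)
      have open_sub: "{- \<delta><..<0} \<subseteq> {- \<delta>..0}"
        by auto
      have meas: "(\<lambda>s. indicator A s *\<^sub>R (J u *\<^sub>R g' (\<phi> u + s *\<^sub>R w) w)) \<in> borel_measurable borel"
        if "A \<in> sets borel" "A \<subseteq> {- \<delta>..0}" for A
        using that(1) continuous_on_subset[OF contJ' that(2)] by (rule borel_measurable_continuous_on_indicator)
      have G: "G (ext4 u s) = indicator {- \<delta><..<0} s *\<^sub>R (J u *\<^sub>R g' (\<phi> u + s *\<^sub>R w) w)" for s
        using True \<delta> by (auto simp: G_def Q slab_def indicator_def)
      \<comment> \<open>\<open>Q\<close> is open, so \<open>G\<close> lives on the open interval,
        whereas the fundamental theorem uses the closed one; the two endpoints are null.\<close>
      have "(\<integral>s. G (ext4 u s) \<partial>lborel) = (\<integral>s. indicator {- \<delta>..0} s *\<^sub>R (J u *\<^sub>R g' (\<phi> u + s *\<^sub>R w) w) \<partial>lborel)"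
      proof (rule integral_cong_AE)
        show "(\<lambda>s. G (ext4 u s)) \<in> borel_measurable lborel"
          unfolding G using meas[of "{- \<delta><..<0}", OF _ open_sub] by simp
        show "(\<lambda>s. indicator {- \<delta>..0} s *\<^sub>R (J u *\<^sub>R g' (\<phi> u + s *\<^sub>R w) w)) \<in> borel_measurable lborel"
          using meas[of "{- \<delta>..0}"] by simp
        show "AE s in lborel. G (ext4 u s) = indicator {- \<delta>..0} s *\<^sub>R (J u *\<^sub>R g' (\<phi> u + s *\<^sub>R w) w)"
          using AE_lborel_singleton[of "0::real"] AE_lborel_singleton[of "- \<delta>"]
          by eventually_elim (auto simp: G indicator_def)
      qed
      also have "\<dots> = J u *\<^sub>R g (\<phi> u + 0 *\<^sub>R w) - J u *\<^sub>R g (\<phi> u + (- \<delta>) *\<^sub>R w)"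
      proof (rule integral_FTC_Icc)
        show "- \<delta> \<le> 0"
          using \<delta> by simp
        show "((\<lambda>s. J u *\<^sub>R g (\<phi> u + s *\<^sub>R w)) has_vector_derivative J u *\<^sub>R g' (\<phi> u + s *\<^sub>R w) w) (at s within {- \<delta>..0})"
          if "- \<delta> \<le> s" "s \<le> 0" for s
        proof -
          have "\<phi> u + s *\<^sub>R w \<in> \<Omega>"
            using inC[of s] that \<Omega> by auto
          then show ?thesis
            by (intro bounded_linear.has_vector_derivative[OF bounded_linear_scaleR_right]
                has_vector_derivative_line C1_onD(1)[OF g])
        qed
        show "continuous_on {- \<delta>..0} (\<lambda>s. J u *\<^sub>R g' (\<phi> u + s *\<^sub>R w) w)"
          by (rule contJ')
      qed
      also have "\<dots> = indicator U u *\<^sub>R (area_density \<phi> u *\<^sub>R ((n (\<phi> u) \<bullet> w) *\<^sub>R g (\<phi> u)))"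
        using bot[OF True] True by (simp add: J_def mult.commute)
      finally show ?thesis .
    qed
  qed
  finally show ?thesis
    by (simp add: set_lebesgue_integral_def)
qed

text \<open>The radius is fixed before \<open>g\<close> is known, so that compactness can select
  finitely many balls. The domain is quantified as well, because the partition of unity exists only
  on a smaller neighbourhood of \<open>K \<union> inside K\<close>.\<close>

definition divergence_near :: "quat \<Rightarrow> quat \<Rightarrow> real \<Rightarrow> bool"
  where "divergence_near w p r \<longleftrightarrow> (\<forall>g g' \<Omega>. open \<Omega> \<longrightarrow> K \<union> inside K \<subseteq> \<Omega> \<longrightarrow> C1_on g g' \<Omega> \<longrightarrow>
    (\<forall>x\<in>\<Omega> - ball p r. g x = 0) \<longrightarrow>
    (\<integral>q. (n q \<bullet> w) *\<^sub>R g q \<partial>surface_measure K) = (LINT x:inside K|lebesgue. g' x w :: quat))"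

lemma divergence_near_mono: "divergence_near w p r \<Longrightarrow> s \<le> r \<Longrightarrow> divergence_near w p s"
  unfolding divergence_near_def by (meson DiffD1 DiffD2 DiffI subset_ball subsetD)

text \<open>A ball inside the image of the slab confines the support: the volume integral reduces to
  the lower half slab and the surface integral to one patch.\<close>

lemma divergence_near_transversal:
  assumes p: "p \<in> K" and nw: "n p \<bullet> w > 0"
  obtains r where "r > 0" "divergence_near w p r"
proof -
  show thesis
  proof (rule outward_normal_slab[OF hypersurface normal p nw])
    fix U \<phi> \<delta>
    assume \<phi>: "smooth_patch K U \<phi>" and p\<phi>: "p \<in> \<phi> ` U" and \<delta>: "\<delta> > 0"
      and inj: "inj_on (slab_map \<phi> w) {y. proj3 y \<in> U \<and> \<bar>y $ 4\<bar> \<le> \<delta>}"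
      and V: "open (slab_map \<phi> w ` slab U \<delta>)"
      and ins: "\<And>u s. u \<in> U \<Longrightarrow> - \<delta> \<le> s \<Longrightarrow> s < 0 \<Longrightarrow> \<phi> u + s *\<^sub>R w \<in> inside K"
      and outs: "\<And>u s. u \<in> U \<Longrightarrow> 0 < s \<Longrightarrow> s \<le> \<delta> \<Longrightarrow> \<phi> u + s *\<^sub>R w \<in> outside K"
      and pos: "\<And>u. u \<in> U \<Longrightarrow> n (\<phi> u) \<bullet> w > 0"
    let ?V = "slab_map \<phi> w ` slab U \<delta>"
    define Q where "Q = {y \<in> slab U \<delta>. y $ 4 < 0}"
    have VK: "?V \<inter> K \<subseteq> \<phi> ` U" and Vin: "?V \<inter> inside K = slab_map \<phi> w ` Q"
    proof -
      have disj: "x \<in> inside K \<Longrightarrow> x \<notin> K" "x \<in> outside K \<Longrightarrow> x \<notin> K" "x \<in> outside K \<Longrightarrow> x \<notin> inside K" for x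
        using inside_no_overlap[of K] outside_no_overlap[of K] inside_Int_outside[of K] by blast+
      have cases: "slab_map \<phi> w y \<in> inside K \<and> slab_map \<phi> w y \<notin> K \<and> y $ 4 < 0
          \<or> slab_map \<phi> w y \<in> \<phi> ` U \<and> slab_map \<phi> w y \<notin> inside K \<and> \<not> y $ 4 < 0
          \<or> slab_map \<phi> w y \<notin> K \<and> slab_map \<phi> w y \<notin> inside K \<and> \<not> y $ 4 < 0" if "y \<in> slab U \<delta>" for y
      proof -
        have y: "proj3 y \<in> U" "\<bar>y $ 4\<bar> < \<delta>"
          using that by (auto simp: slab_def)
        consider "y $ 4 < 0" | "y $ 4 = 0" | "y $ 4 > 0"
          by linarith
        then show ?thesis
        proof cases
          case 1
          then have "slab_map \<phi> w y \<in> inside K"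
            using ins[OF y(1), of "y $ 4"] y(2) by (simp add: slab_map_def)
          with 1 disj(1) show ?thesis
            by blast
        next
          case 2
          then have "slab_map \<phi> w y \<in> \<phi> ` U"
            using y(1) by (simp add: slab_map_def)
          with 2 disj(1) smooth_patchD(7)[OF \<phi>] show ?thesis
            by auto
        next
          case 3
          then have "slab_map \<phi> w y \<in> outside K"
            using outs[OF y(1), of "y $ 4"] y(2) by (simp add: slab_map_def)
          with 3 disj(2,3) show ?thesis
            by auto
        qed
      qed
      then show "?V \<inter> K \<subseteq> \<phi> ` U"
        by blast
      show "?V \<inter> inside K = slab_map \<phi> w ` Q"
        unfolding Q_def using cases by blast
    qed
    have "p \<in> ?V"
    proof -
      obtain u where "u \<in> U" "\<phi> u = p"
        using p\<phi> by blast
      then show ?thesis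
        using \<delta> by (intro image_eqI[of _ _ "ext4 u 0"]) (auto simp: slab_def)
    qed
    \<comment> \<open>The closed ball has to fit, since the derivative of \<open>g\<close> is known
      to vanish only off the closed ball.\<close>
    then obtain r where r: "r > 0" "cball p r \<subseteq> ?V"
      using V open_contains_cball by blast
    have "divergence_near w p r"
      unfolding divergence_near_def
    proof (intro allI impI)
      fix g :: "quat \<Rightarrow> quat" and g' \<Omega>
      assume \<Omega>: "open \<Omega>" "K \<union> inside K \<subseteq> \<Omega>" and g: "C1_on g g' \<Omega>" and supp: "\<forall>x\<in>\<Omega> - ball p r. g x = 0"
      have g'0: "g' x w = 0" if "x \<in> \<Omega>" "x \<notin> cball p r" for x
        by (rule C1_on_zero_imp_deriv_zero[OF g, of "\<Omega> - cball p r"])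
          (use that supp \<Omega>(1) in \<open>auto intro!: open_Diff\<close>)
      have "(LINT x:inside K|lebesgue. g' x w) = (LINT x:slab_map \<phi> w ` Q|lebesgue. g' x w)"
        unfolding set_lebesgue_integral_def
      proof (intro Bochner_Integration.integral_cong refl)
        fix x
        show "indicator (inside K) x *\<^sub>R g' x w = indicator (slab_map \<phi> w ` Q) x *\<^sub>R g' x w"
        proof (cases "x \<in> inside K - ?V")
          case True
          then have "g' x w = 0"
            using r(2) \<Omega>(2) by (intro g'0) blast+
          then show ?thesis by simp
        next
          case False
          then show ?thesis
            unfolding Vin[symmetric] by (cases "x \<in> inside K") simp_all
        qed
      qed
      also have "\<dots> = (LINT u:U|lborel. area_density \<phi> u *\<^sub>R ((n (\<phi> u) \<bullet> w) *\<^sub>R g (\<phi> u)))"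
      proof (rule slab_divergence[OF \<phi> \<delta> inj ins pos Q_def _ g \<Omega>(2)])
        show "open (slab_map \<phi> w ` Q)"
          unfolding Vin[symmetric] using V open_inside_K by (rule open_Int)
        show "g (\<phi> u - \<delta> *\<^sub>R w) = 0" if u: "u \<in> U" for u
        proof -
          \<comment> \<open>The slab map is injective up to and including height
            \<open>- \<delta>\<close>, so a point of the bottom face is not the image of a point of
            the open slab.\<close>
          have "\<phi> u - \<delta> *\<^sub>R w \<notin> ?V"
          proof
            assume "\<phi> u - \<delta> *\<^sub>R w \<in> ?V"
            then obtain y where y: "y \<in> slab U \<delta>" "slab_map \<phi> w y = slab_map \<phi> w (ext4 u (- \<delta>))"
              by auto
            then have "y = ext4 u (- \<delta>)"
              using inj u \<delta> by (auto simp: inj_on_def slab_def)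
            then show False
              using y(1) \<delta> by (simp add: slab_def)
          qed
          then have "\<phi> u - \<delta> *\<^sub>R w \<notin> ball p r"
            using r(2) ball_subset_cball[of p r] by blast
          moreover have "\<phi> u - \<delta> *\<^sub>R w \<in> \<Omega>"
            using ins[OF u, of "- \<delta>"] \<delta> \<Omega>(2) by auto
          ultimately show ?thesis
            using supp by blast
        qed
      qed
      also have "\<dots> = (\<integral>q. (n q \<bullet> w) *\<^sub>R g q \<partial>surface_measure K)"
      proof (rule integral_surface_measure_patch[OF hypersurface \<phi>, symmetric])
        have "continuous_on K g"
          using C1_on_continuous[OF g] \<Omega>(2) by (auto intro: continuous_on_subset)
        then show "(\<lambda>q. (n q \<bullet> w) *\<^sub>R g q) \<in> borel_measurable (surface_measure K)"
          by (intro measurable_surface continuous_intros continuous_on_normal)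
        show "(n q \<bullet> w) *\<^sub>R g q = 0" if "q \<in> K - \<phi> ` U" for q
        proof -
          have "q \<notin> ball p r"
            using that VK r(2) ball_subset_cball[of p r] by blast
          then have "g q = 0"
            using that supp \<Omega>(2) by blast
          then show ?thesis by simp
        qed
      qed
      finally show "(\<integral>q. (n q \<bullet> w) *\<^sub>R g q \<partial>surface_measure K) = (LINT x:inside K|lebesgue. g' x w)" ..
    qed
    with r(1) show thesis
      by (rule that)
  qed
qed

text \<open>A direction that is tangent at \<open>p\<close> is a difference of two transversal ones.\<close>

lemma divergence_near_boundary:
  assumes p: "p \<in> K"
  obtains r where "r > 0" "divergence_near w p r"
proof -
  \<comment> \<open>This makes the product of \<open>n p\<close> with
    \<open>w + c *\<^sub>R n p\<close> at least 1, whatever the sign of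
    \<open>n p \<bullet> w\<close>.\<close>
  define c where "c = \<bar>n p \<bullet> w\<bar> + 1"
  have nn: "n p \<bullet> n p = 1"
    using norm_normal[OF p] by (simp add: norm_eq_1)
  have "n p \<bullet> (w + c *\<^sub>R n p) > 0" "n p \<bullet> (c *\<^sub>R n p) > 0"
    by (simp_all add: inner_right_distrib nn c_def)
  then obtain r1 r2 where r: "r1 > 0" "divergence_near (w + c *\<^sub>R n p) p r1"
      "r2 > 0" "divergence_near (c *\<^sub>R n p) p r2"
    using divergence_near_transversal[OF p] by metis
  define r where "r = min r1 r2"
  have d1: "divergence_near (w + c *\<^sub>R n p) p r" and d2: "divergence_near (c *\<^sub>R n p) p r"
    using r by (auto simp: r_def intro: divergence_near_mono)
  have "divergence_near w p r"
    unfolding divergence_near_def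
  proof (intro allI impI)
    fix g :: "quat \<Rightarrow> quat" and g' \<Omega>
    assume *: "open \<Omega>" "K \<union> inside K \<subseteq> \<Omega>" "C1_on g g' \<Omega>" "\<forall>x\<in>\<Omega> - ball p r. g x = 0"
    have contg: "continuous_on K g"
      using C1_on_continuous[OF *(3)] *(2) by (auto intro: continuous_on_subset)
    have int1: "integrable (surface_measure K) (\<lambda>q. (n q \<bullet> v) *\<^sub>R g q)" for v
      by (intro integrable_surface continuous_intros continuous_on_normal contg)
    have int2: "set_integrable lebesgue (inside K) (\<lambda>x. g' x v)" for v
      using C1_onD(2)[OF *(3)] *(2) by (intro set_integrable_inside) (rule continuous_on_subset)
    have eq1: "(\<integral>q. (n q \<bullet> (w + c *\<^sub>R n p)) *\<^sub>R g q \<partial>surface_measure K)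
        = (LINT x:inside K|lebesgue. g' x (w + c *\<^sub>R n p))"
      using d1 * unfolding divergence_near_def by blast
    have eq2: "(\<integral>q. (n q \<bullet> (c *\<^sub>R n p)) *\<^sub>R g q \<partial>surface_measure K)
        = (LINT x:inside K|lebesgue. g' x (c *\<^sub>R n p))"
      using d2 * unfolding divergence_near_def by blast
    have "(\<integral>q. (n q \<bullet> w) *\<^sub>R g q \<partial>surface_measure K)
        = (\<integral>q. (n q \<bullet> (w + c *\<^sub>R n p)) *\<^sub>R g q - (n q \<bullet> (c *\<^sub>R n p)) *\<^sub>R g q \<partial>surface_measure K)"
      by (simp add: inner_right_distrib algebra_simps)
    also have "\<dots> = (LINT x:inside K|lebesgue. g' x (w + c *\<^sub>R n p)) - (LINT x:inside K|lebesgue. g' x (c *\<^sub>R n p))"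
      unfolding Bochner_Integration.integral_diff[OF int1 int1] eq1 eq2 ..
    also have "\<dots> = (LINT x:inside K|lebesgue. g' x (w + c *\<^sub>R n p) - g' x (c *\<^sub>R n p))"
      using int2 by (subst set_integral_diff) auto
    also have "\<dots> = (LINT x:inside K|lebesgue. g' x w)"
    proof (rule set_lebesgue_integral_cong)
      show "\<forall>x. x \<in> inside K \<longrightarrow> g' x (w + c *\<^sub>R n p) - g' x (c *\<^sub>R n p) = g' x w"
        using C1_on_linear[OF *(3)] *(2) by (auto simp: linear_add)
    qed (use open_inside_K in simp)
    finally show "(\<integral>q. (n q \<bullet> w) *\<^sub>R g q \<partial>surface_measure K) = (LINT x:inside K|lebesgue. g' x w)" .
  qed
  moreover have "r > 0"
    using r by (simp add: r_def)
  ultimately show thesis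
    using that by blast
qed

text \<open>Both sides vanish: the support does not reach \<open>K\<close>, and \<open>g\<close>
  extended by zero is continuously differentiable on the whole space, where directional derivatives
  integrate to zero.\<close>

lemma divergence_near_interior:
  assumes p: "p \<in> inside K"
  obtains r where "r > 0" "divergence_near w p r"
proof -
  obtain R where R: "R > 0" "ball p R \<subseteq> inside K"
    using open_inside_K p openE by blast
  \<comment> \<open>With a radius below \<open>R\<close>, the ball of radius \<open>R\<close> and
    the complement of the closed ball of radius \<open>r\<close> are open sets covering the space;
    the extension agrees with \<open>g\<close> on the first and is zero on the second.\<close>
  define r where "r = R / 2"
  have r: "r > 0" "cball p r \<subseteq> ball p R"
    using R(1) by (auto simp: r_def)
  have "divergence_near w p r"
    unfolding divergence_near_def
  proof (intro allI impI)
    fix g :: "quat \<Rightarrow> quat" and g' \<Omega>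
    assume \<Omega>: "open \<Omega>" "K \<union> inside K \<subseteq> \<Omega>" and g: "C1_on g g' \<Omega>" and supp: "\<forall>x\<in>\<Omega> - ball p r. g x = 0"
    have g'0: "g' x h = 0" if "x \<in> \<Omega>" "x \<notin> cball p r" for x h
      by (rule C1_on_zero_imp_deriv_zero[OF g, of "\<Omega> - cball p r"])
        (use that supp \<Omega>(1) in \<open>auto intro!: open_Diff\<close>)
    define G where "G x = (if x \<in> ball p R then g x else 0)" for x
    define G' where "G' x h = (if x \<in> ball p R then g' x h else 0)" for x h
    have B\<Omega>: "ball p R \<subseteq> \<Omega>"
      using R(2) \<Omega>(2) by blast
    have G0: "G x = 0" if "x \<notin> ball p r" for x
      using that supp B\<Omega> by (auto simp: G_def)
    have "C1_on G G' UNIV"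
      unfolding C1_on_def
    proof (intro conjI ballI allI)
      fix x
      show "(G has_derivative G' x) (at x)"
      proof (cases "x \<in> ball p R")
        case True
        then have "(g has_derivative G' x) (at x)"
          using C1_onD(1)[OF g, of x] B\<Omega> by (auto simp: G'_def[abs_def])
        then show ?thesis
          by (rule has_derivative_transform_within_open[OF _ open_ball True]) (simp add: G_def)
      next
        case False
        then have "x \<in> - cball p r" "G' x = (\<lambda>_. 0)"
          using r(2) by (auto simp: G'_def[abs_def])
        then show ?thesis
          using has_derivative_transform_within_open[of "\<lambda>_. 0" "\<lambda>_. 0" x UNIV "- cball p r" G] G0
          by (auto simp: open_Compl)
      qed
    next
      fix h
      have "continuous_on (ball p R) (\<lambda>x. G' x h)"
        using continuous_on_subset[OF C1_onD(2)[OF g] B\<Omega>] by (rule continuous_on_eq) (simp add: G'_def)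
      moreover have "continuous_on (- cball p r) (\<lambda>x. G' x h)"
      proof (rule continuous_on_eq[OF continuous_on_const])
        show "0 = G' x h" if "x \<in> - cball p r" for x
          using that g'0[of x h] B\<Omega> by (auto simp: G'_def)
      qed
      ultimately have "continuous_on (ball p R \<union> - cball p r) (\<lambda>x. G' x h)"
        by (intro continuous_on_open_Un) (auto simp: open_Compl)
      then show "continuous_on UNIV (\<lambda>x. G' x h)"
        by (rule continuous_on_subset) (use r(2) in auto)
    qed
    from integral_directional_derivative_eq_0[OF this G0]
    have "(\<integral>x. G' x w \<partial>lborel) = 0" .
    moreover have "(\<lambda>x. G' x w) \<in> borel_measurable lborel"
      using C1_onD(2)[OF \<open>C1_on G G' UNIV\<close>] by (simp add: borel_measurable_continuous_onI)
    then have "(\<integral>x. G' x w \<partial>lebesgue) = (\<integral>x. G' x w \<partial>lborel)"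
      by (rule integral_completion)
    moreover have "(LINT x:inside K|lebesgue. g' x w) = (\<integral>x. G' x w \<partial>lebesgue)"
      unfolding set_lebesgue_integral_def
    proof (intro Bochner_Integration.integral_cong refl)
      fix x
      show "indicator (inside K) x *\<^sub>R g' x w = G' x w"
      proof (cases "x \<in> ball p R")
        case True
        then show ?thesis
          using R(2) by (auto simp: G'_def)
      next
        case False
        then have "x \<in> inside K \<Longrightarrow> g' x w = 0"
          using g'0[of x w] r(2) \<Omega>(2) by blast
        then show ?thesis
          using False by (simp add: G'_def indicator_def)
      qed
    qed
    moreover have "(\<integral>q. (n q \<bullet> w) *\<^sub>R g q \<partial>surface_measure K) = (\<integral>q. 0 \<partial>surface_measure K)"
    proof (intro Bochner_Integration.integral_cong refl)
      fix q assume "q \<in> space (surface_measure K)"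
      then have "q \<in> K"
        by (simp add: space_surface_measure[OF hypersurface])
      moreover have "q \<notin> ball p r"
        using R(2) r(2) inside_no_overlap[of K] \<open>q \<in> K\<close> ball_subset_cball[of p r] by blast
      ultimately show "(n q \<bullet> w) *\<^sub>R g q = 0"
        using supp \<Omega>(2) by auto
    qed
    ultimately show "(\<integral>q. (n q \<bullet> w) *\<^sub>R g q \<partial>surface_measure K) = (LINT x:inside K|lebesgue. g' x w)"
      by simp
  qed
  with r that show thesis by blast
qed

end

section \<open>Calculus of continuously differentiable functions and a partition of unity\<close>

lemma C1_on_sum:
  assumes "\<And>i. i \<in> I \<Longrightarrow> C1_on (f i) (f' i) S"
  shows "C1_on (\<lambda>x. \<Sum>i\<in>I. f i x) (\<lambda>x h. \<Sum>i\<in>I. f' i x h) S"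
  unfolding C1_on_def
  by (intro conjI ballI allI has_derivative_sum continuous_on_sum C1_onD[OF assms])

lemma C1_on_scaleR:
  fixes f :: "'a::euclidean_space \<Rightarrow> real"
  assumes f: "C1_on f f' S" and g: "C1_on g g' S"
  shows "C1_on (\<lambda>x. f x *\<^sub>R g x) (\<lambda>x h. f x *\<^sub>R g' x h + f' x h *\<^sub>R g x) S"
  unfolding C1_on_def
  by (intro conjI ballI allI has_derivative_scaleR continuous_intros
      C1_onD[OF f] C1_onD[OF g] C1_on_continuous[OF f] C1_on_continuous[OF g])

lemma C1_on_divide:
  fixes f :: "'a::euclidean_space \<Rightarrow> real"
  assumes f: "C1_on f f' S" and g: "C1_on g g' S" and nz: "\<And>x. x \<in> S \<Longrightarrow> g x \<noteq> 0"
  shows "C1_on (\<lambda>x. f x / g x) (\<lambda>x h. (f' x h * g x - f x * g' x h) / (g x * g x)) S"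
  unfolding C1_on_def
proof (intro conjI ballI allI)
  show "((\<lambda>x. f x / g x) has_derivative (\<lambda>h. (f' x h * g x - f x * g' x h) / (g x * g x))) (at x)"
    if "x \<in> S" for x
    using has_derivative_divide'[OF C1_onD(1)[OF f that] C1_onD(1)[OF g that] nz[OF that]] .
  show "continuous_on S (\<lambda>x. (f' x h * g x - f x * g' x h) / (g x * g x))" for h
    using nz by (intro continuous_intros C1_onD(2)[OF f] C1_onD(2)[OF g]
        C1_on_continuous[OF f] C1_on_continuous[OF g]) auto
qed

text \<open>Squaring removes the corner of the positive part. At zero, Caratheodory's criterion
  holds with \<open>max 0\<close> itself as slope function.\<close>

lemma DERIV_max_0_square: "((\<lambda>t. (max 0 t)\<^sup>2) has_real_derivative 2 * max 0 t) (at t)"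
proof (cases t "0::real" rule: linorder_cases)
  case less
  have "((\<lambda>t. 0) has_real_derivative 2 * max 0 t) (at t)"
    using less by (simp add: max_def)
  then show ?thesis
    by (rule has_field_derivative_transform_within_open[of _ _ _ "{..<0}"]) (use less in auto)
next
  case equal
  have "\<exists>g. (\<forall>z. (max 0 z)\<^sup>2 - (max 0 t)\<^sup>2 = g z * (z - t)) \<and> isCont g t \<and> g t = 2 * max 0 t"
    unfolding equal by (intro exI[of _ "max 0"]) (auto simp: max_def power2_eq_square intro!: continuous_intros)
  then show ?thesis
    by (simp add: CARAT_DERIV)
next
  case greater
  have "((\<lambda>t. t\<^sup>2) has_real_derivative 2 * max 0 t) (at t)"
    using greater by (auto intro!: derivative_eq_intros)
  then show ?thesis
    by (rule has_field_derivative_transform_within_open[of _ _ _ "{0<..}"]) (use greater in auto)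
qed

text \<open>The outer square makes the cutoff continuously differentiable across the sphere of
  radius \<open>r\<close>; the square of the norm keeps it differentiable at the centre.\<close>

definition bump :: "'a::euclidean_space \<Rightarrow> real \<Rightarrow> 'a \<Rightarrow> real"
  where "bump p r x = (max 0 (r\<^sup>2 - (norm (x - p))\<^sup>2))\<^sup>2"

lemma bump_nonneg: "0 \<le> bump p r x"
  by (simp add: bump_def)

lemma bump_eq_0: "r > 0 \<Longrightarrow> x \<notin> ball p r \<Longrightarrow> bump p r x = 0"
  by (auto simp: bump_def dist_norm norm_minus_commute max_def not_less intro: power_mono)

lemma bump_pos: "x \<in> ball p r \<Longrightarrow> 0 < bump p r x"
  using power_strict_mono[of "norm (x - p)" r 2] by (simp add: bump_def dist_norm norm_minus_commute max_def)

lemma C1_on_bump: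
  "C1_on (bump p r) (\<lambda>x h. - 4 * max 0 (r\<^sup>2 - (norm (x - p))\<^sup>2) * ((x - p) \<bullet> h)) S"
  unfolding C1_on_def
proof (intro conjI ballI allI)
  fix x
  have "((\<lambda>x. r\<^sup>2 - (x - p) \<bullet> (x - p)) has_derivative (\<lambda>h. - (2 * ((x - p) \<bullet> h)))) (at x)"
    by (auto intro!: derivative_eq_intros simp: inner_commute)
  then have "((\<lambda>x. r\<^sup>2 - (norm (x - p))\<^sup>2) has_derivative (\<lambda>h. - (2 * ((x - p) \<bullet> h)))) (at x)"
    by (simp add: power2_norm_eq_inner)
  from has_derivative_compose[OF this DERIV_max_0_square[unfolded has_field_derivative_def]]
  show "(bump p r has_derivative (\<lambda>h. - 4 * max 0 (r\<^sup>2 - (norm (x - p))\<^sup>2) * ((x - p) \<bullet> h))) (at x)"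
    unfolding bump_def[abs_def] by (simp add: algebra_simps)
qed (intro continuous_intros)

context oriented_hypersurface
begin

text \<open>The cutoffs \<open>bump p (r p) x / s x\<close> sum to one, so both \<open>g\<close> and
  its derivative split into local pieces. The terms from differentiating the cutoffs are contained
  in \<open>G'\<close>, and they add up correctly because derivatives are unique.\<close>

theorem divergence_theorem:
  fixes g :: "quat \<Rightarrow> quat"
  assumes "open \<Omega>" and \<Omega>: "K \<union> inside K \<subseteq> \<Omega>" and g: "C1_on g g' \<Omega>"
  shows "(\<integral>q. (n q \<bullet> w) *\<^sub>R g q \<partial>surface_measure K) = (LINT x:inside K|lebesgue. g' x w)"
proof -
  have "\<exists>r>0. divergence_near w p r" if "p \<in> K \<union> inside K" for p
    using that divergence_near_boundary[of p w] divergence_near_interior[of p w] by (metis UnE)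
  then obtain r where r: "\<And>p. p \<in> K \<union> inside K \<Longrightarrow> r p > 0 \<and> divergence_near w p (r p)"
    by metis
  obtain P where P: "P \<subseteq> K \<union> inside K" "finite P" "K \<union> inside K \<subseteq> (\<Union>p\<in>P. ball p (r p))"
    by (rule compactE_image[OF compact_closure_inside, of "K \<union> inside K" "\<lambda>p. ball p (r p)"]) (use r in auto)
  define s where "s x = (\<Sum>p\<in>P. bump p (r p) x)" for x
  define s' where "s' x h = (\<Sum>p\<in>P. - 4 * max 0 ((r p)\<^sup>2 - (norm (x - p))\<^sup>2) * ((x - p) \<bullet> h))" for x h
  have s: "C1_on s s' S" for S
    unfolding s_def[abs_def] s'_def[abs_def] by (rule C1_on_sum, rule C1_on_bump)
  \<comment> \<open>The sum \<open>s\<close> may vanish on parts of \<open>\<Omega>\<close> away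
    from \<open>K \<union> inside K\<close>, so the quotients are formed only where it is
    positive.\<close>
  define \<Omega>' where "\<Omega>' = \<Omega> \<inter> {x. 0 < s x}"
  have o': "open \<Omega>'"
    unfolding \<Omega>'_def using \<open>open \<Omega>\<close> C1_on_continuous[OF s[of UNIV]]
    by (intro open_Int open_Collect_less continuous_on_const)
  have spos: "0 < s x" if x: "x \<in> K \<union> inside K" for x
  proof -
    obtain p where "p \<in> P" "x \<in> ball p (r p)"
      using P(3) x by blast
    then show ?thesis
      unfolding s_def using P(2) bump_pos bump_nonneg by (intro sum_pos2[of P p]) auto
  qed
  have \<Omega>': "K \<union> inside K \<subseteq> \<Omega>'"
    using \<Omega> spos by (auto simp: \<Omega>'_def)
  have nz: "s x \<noteq> 0" if "x \<in> \<Omega>'" for x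
    using that by (auto simp: \<Omega>'_def)
  have g\<Omega>': "C1_on g g' \<Omega>'"
    using g by (rule C1_on_subset) (auto simp: \<Omega>'_def)
  define G where "G p x = (bump p (r p) x / s x) *\<^sub>R g x" for p x
  have "\<exists>G'. C1_on (G p) G' \<Omega>'" for p
    using C1_on_scaleR[OF C1_on_divide[OF C1_on_bump s nz] g\<Omega>', of p "r p"] unfolding G_def[abs_def] by blast
  then obtain G' where G: "\<And>p. C1_on (G p) (G' p) \<Omega>'"
    by metis
  have sumG: "(\<Sum>p\<in>P. G p x) = g x" if "x \<in> \<Omega>'" for x
    using nz[OF that] by (simp add: G_def s_def flip: scaleR_sum_left sum_divide_distrib)
  have sumG': "(\<Sum>p\<in>P. G' p x w) = g' x w" if x: "x \<in> \<Omega>'" for x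
  proof -
    have "((\<lambda>x. \<Sum>p\<in>P. G p x) has_derivative (\<lambda>h. \<Sum>p\<in>P. G' p x h)) (at x)"
      by (intro has_derivative_sum C1_onD(1)[OF G x])
    then have "(g has_derivative (\<lambda>h. \<Sum>p\<in>P. G' p x h)) (at x)"
      by (rule has_derivative_transform_within_open[OF _ o' x]) (rule sumG)
    from has_derivative_unique[OF this C1_onD(1)[OF g\<Omega>' x]] show ?thesis
      by (rule fun_cong)
  qed
  have local: "(\<integral>q. (n q \<bullet> w) *\<^sub>R G p q \<partial>surface_measure K) = (LINT x:inside K|lebesgue. G' p x w)" if p: "p \<in> P" for p
  proof -
    have r0: "r p > 0" and near: "divergence_near w p (r p)"
      using r p P(1) by blast+
    have supp: "\<forall>x\<in>\<Omega>' - ball p (r p). G p x = 0"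
      using bump_eq_0[OF r0, of _ p] by (auto simp: G_def)
    have "open \<Omega>' \<longrightarrow> K \<union> inside K \<subseteq> \<Omega>' \<longrightarrow> C1_on (G p) (G' p) \<Omega>' \<longrightarrow>
        (\<forall>x\<in>\<Omega>' - ball p (r p). G p x = 0) \<longrightarrow> ?thesis"
      using near unfolding divergence_near_def by (elim allE)
    then show ?thesis
      using o' \<Omega>' G[of p] supp by blast
  qed
  have int1: "integrable (surface_measure K) (\<lambda>q. (n q \<bullet> w) *\<^sub>R G p q)" for p
    using C1_on_continuous[OF G[of p]] \<Omega>'
    by (intro integrable_surface continuous_intros continuous_on_normal) (auto intro: continuous_on_subset)
  have int2: "set_integrable lebesgue (inside K) (\<lambda>x. G' p x w)" for p
    using C1_onD(2)[OF G[of p]] \<Omega>' by (intro set_integrable_inside) (rule continuous_on_subset)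
  have "(\<integral>q. (n q \<bullet> w) *\<^sub>R g q \<partial>surface_measure K) = (\<integral>q. (\<Sum>p\<in>P. (n q \<bullet> w) *\<^sub>R G p q) \<partial>surface_measure K)"
  proof (intro Bochner_Integration.integral_cong refl)
    fix q assume "q \<in> space (surface_measure K)"
    then have "q \<in> \<Omega>'"
      using \<Omega>' by (auto simp: space_surface_measure[OF hypersurface])
    then show "(n q \<bullet> w) *\<^sub>R g q = (\<Sum>p\<in>P. (n q \<bullet> w) *\<^sub>R G p q)"
      using sumG by (simp flip: scaleR_sum_right)
  qed
  also have "\<dots> = (\<Sum>p\<in>P. LINT x:inside K|lebesgue. G' p x w)"
    using int1 local by (simp add: Bochner_Integration.integral_sum)
  also have "\<dots> = (\<integral>x. (\<Sum>p\<in>P. indicator (inside K) x *\<^sub>R G' p x w) \<partial>lebesgue)"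
    unfolding set_lebesgue_integral_def
    using int2 by (intro Bochner_Integration.integral_sum[symmetric]) (simp add: set_integrable_def)
  also have "\<dots> = (LINT x:inside K|lebesgue. g' x w)"
    unfolding set_lebesgue_integral_def
  proof (intro Bochner_Integration.integral_cong refl)
    fix x
    show "(\<Sum>p\<in>P. indicator (inside K) x *\<^sub>R G' p x w) = indicator (inside K) x *\<^sub>R g' x w"
      using sumG'[of x] \<Omega>' by (cases "x \<in> inside K") auto
  qed
  finally show ?thesis .
qed

end

section \<open>Quaternionic derivatives\<close>

lemma bounded_linear_qmult_right: "bounded_linear (\<lambda>q. a *\<^sub>H q)"
  unfolding linear_conv_bounded_linear[symmetric]
  by (rule linearI) (simp_all add: quat_eq_iff qmult_def algebra_simps)

lemma Quat_eq_sum: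
  "Quat t x y z = t *\<^sub>R axis 1 1 + x *\<^sub>R axis 2 1 + y *\<^sub>R axis 3 1 + z *\<^sub>R axis 4 1"
  by (simp add: quat_eq_iff axis_def)

lemma has_vector_derivative_Quat:
  assumes "(t has_real_derivative t') (at s)" "(x has_real_derivative x') (at s)"
    "(y has_real_derivative y') (at s)" "(z has_real_derivative z') (at s)"
  shows "((\<lambda>s. Quat (t s) (x s) (y s) (z s)) has_vector_derivative Quat t' x' y' z') (at s)"
proof -
  have "((\<lambda>s. c s *\<^sub>R b) has_vector_derivative c' *\<^sub>R b) (at s)"
    if "(c has_real_derivative c') (at s)" for c c' and b :: quat
    using has_vector_derivative_scaleR[OF that has_vector_derivative_const, of b] by simp
  then show ?thesis
    unfolding Quat_eq_sum using assms by (intro has_vector_derivative_add)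
qed

lemma has_vector_derivative_compose_derivative:
  assumes "(c has_vector_derivative c') (at s)" and "(f has_derivative D) (at (c s))"
  shows "((\<lambda>s. f (c s)) has_vector_derivative D c') (at s)"
proof -
  have "(\<lambda>h. D (h *\<^sub>R c')) = (\<lambda>h. h *\<^sub>R D c')"
    using linear_scale[OF has_derivative_linear[OF assms(2)]] by auto
  then show ?thesis
    using has_derivative_compose[OF assms(1)[unfolded has_vector_derivative_def] assms(2)]
    by (simp add: has_vector_derivative_def)
qed

lemma spherical_eq_Quat:
  "spherical t r \<alpha> \<beta> = Quat t (r * (cos \<alpha> * sin \<beta>)) (r * (sin \<alpha> * sin \<beta>)) (r * cos \<beta>)"
  by (simp add: quat_eq_iff spherical_def iota_def)

lemma iota_alpha_eq: "iota_alpha \<alpha> \<beta> = Quat 0 (- sin \<alpha> * sin \<beta>) (cos \<alpha> * sin \<beta>) 0"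
  unfolding iota_alpha_def iota_def
  by (intro vector_derivative_at has_vector_derivative_Quat) (auto intro!: derivative_eq_intros)

lemma iota_beta_eq: "iota_beta \<alpha> \<beta> = Quat 0 (cos \<alpha> * cos \<beta>) (sin \<alpha> * cos \<beta>) (- sin \<beta>)"
  unfolding iota_beta_def iota_def
  by (intro vector_derivative_at has_vector_derivative_Quat) (auto intro!: derivative_eq_intros)

lemma vector_derivative_spherical:
  assumes "(f has_derivative D) (at (spherical t r \<alpha> \<beta>))"
  shows "vector_derivative (\<lambda>a. f (spherical t r a \<beta>)) (at \<alpha>) = r *\<^sub>R D (iota_alpha \<alpha> \<beta>)"
    and "vector_derivative (\<lambda>b. f (spherical t r \<alpha> b)) (at \<beta>) = r *\<^sub>R D (iota_beta \<alpha> \<beta>)"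
proof -
  note scale = linear_scale[OF has_derivative_linear[OF assms], symmetric]
  have "((\<lambda>a. spherical t r a \<beta>) has_vector_derivative r *\<^sub>R iota_alpha \<alpha> \<beta>) (at \<alpha>)"
  proof -
    have "((\<lambda>a. spherical t r a \<beta>) has_vector_derivative
        Quat 0 (r * (- sin \<alpha> * sin \<beta>)) (r * (cos \<alpha> * sin \<beta>)) 0) (at \<alpha>)"
      unfolding spherical_eq_Quat
      by (intro has_vector_derivative_Quat) (auto intro!: derivative_eq_intros)
    moreover have "r *\<^sub>R iota_alpha \<alpha> \<beta> = Quat 0 (r * (- sin \<alpha> * sin \<beta>)) (r * (cos \<alpha> * sin \<beta>)) 0"
      by (simp add: quat_eq_iff iota_alpha_eq)
    ultimately show ?thesis by simp
  qed
  from has_vector_derivative_compose_derivative[OF this assms]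
  show "vector_derivative (\<lambda>a. f (spherical t r a \<beta>)) (at \<alpha>) = r *\<^sub>R D (iota_alpha \<alpha> \<beta>)"
    unfolding scale by (rule vector_derivative_at)
  have "((\<lambda>b. spherical t r \<alpha> b) has_vector_derivative r *\<^sub>R iota_beta \<alpha> \<beta>) (at \<beta>)"
  proof -
    have "((\<lambda>b. spherical t r \<alpha> b) has_vector_derivative
        Quat 0 (r * (cos \<alpha> * cos \<beta>)) (r * (sin \<alpha> * cos \<beta>)) (r * - sin \<beta>)) (at \<beta>)"
      unfolding spherical_eq_Quat
      by (intro has_vector_derivative_Quat) (auto intro!: derivative_eq_intros)
    moreover have "r *\<^sub>R iota_beta \<alpha> \<beta> = Quat 0 (r * (cos \<alpha> * cos \<beta>)) (r * (sin \<alpha> * cos \<beta>)) (r * - sin \<beta>)"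
      by (simp add: quat_eq_iff iota_beta_eq)
    ultimately show ?thesis by simp
  qed
  from has_vector_derivative_compose_derivative[OF this assms]
  show "vector_derivative (\<lambda>b. f (spherical t r \<alpha> b)) (at \<beta>) = r *\<^sub>R D (iota_beta \<alpha> \<beta>)"
    unfolding scale by (rule vector_derivative_at)
qed

text \<open>For \<open>D\<close> the derivative of \<open>f\<close> at a point, this is the value
  there of the left Cauchy-Riemann-Fueter operator.\<close>

definition fueter :: "(quat \<Rightarrow> quat) \<Rightarrow> quat"
  where "fueter D = (\<Sum>i\<in>UNIV. axis i 1 *\<^sub>H D (axis i 1))"

text \<open>A sum of terms \<open>e *\<^sub>H D e\<close> is the same for every orthonormal basis.
  The real unit is kept, and \<open>i, j, k\<close> are replaced by the spherical frame, with
  \<open>iota_alpha\<close> normalised so that the identity also holds where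
  \<open>sin \<beta> = 0\<close>.\<close>

lemma fueter_frame:
  assumes D: "linear D"
  shows "fueter D = D (Quat 1 0 0 0) + iota \<alpha> \<beta> *\<^sub>H D (iota \<alpha> \<beta>)
    + Quat 0 (- sin \<alpha>) (cos \<alpha>) 0 *\<^sub>H D (Quat 0 (- sin \<alpha>) (cos \<alpha>) 0)
    + iota_beta \<alpha> \<beta> *\<^sub>H D (iota_beta \<alpha> \<beta>)"
proof -
  define ca sa cb sb where "ca = cos \<alpha>" and "sa = sin \<alpha>" and "cb = cos \<beta>" and "sb = sin \<beta>"
  have cs: "ca * ca + sa * sa = 1" "cb * cb + sb * sb = 1"
    by (simp_all add: ca_def sa_def cb_def sb_def flip: power2_eq_square)
  define u a b where "u = Quat 0 (ca * sb) (sa * sb) cb" and "a = Quat 0 (- sa) ca 0"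
    and "b = Quat 0 (ca * cb) (sa * cb) (- sb)"
  define U A B where "U = D u" and "A = D a" and "B = D b"
  have lin: "D (x *\<^sub>R u + y *\<^sub>R a + z *\<^sub>R b) = x *\<^sub>R U + y *\<^sub>R A + z *\<^sub>R B" for x y z
    using D by (simp add: linear_add linear_scale U_def A_def B_def)
  \<comment> \<open>The frame is orthonormal, so the coefficients are the corresponding components
    of \<open>u\<close>, \<open>a\<close> and \<open>b\<close>.\<close>
  have "axis 2 1 = (ca * sb) *\<^sub>R u + (- sa) *\<^sub>R a + (ca * cb) *\<^sub>R b"
    "axis 3 1 = (sa * sb) *\<^sub>R u + ca *\<^sub>R a + (sa * cb) *\<^sub>R b"
    "axis 4 1 = cb *\<^sub>R u + 0 *\<^sub>R a + (- sb) *\<^sub>R b"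
    unfolding quat_eq_iff u_def a_def b_def axis_def using cs by (simp; algebra)+
  then have De: "D (axis 2 1) = (ca * sb) *\<^sub>R U + (- sa) *\<^sub>R A + (ca * cb) *\<^sub>R B"
    "D (axis 3 1) = (sa * sb) *\<^sub>R U + ca *\<^sub>R A + (sa * cb) *\<^sub>R B"
    "D (axis 4 1) = cb *\<^sub>R U + 0 *\<^sub>R A + (- sb) *\<^sub>R B"
    using lin by metis+
  have e: "axis 1 1 = Quat 1 0 0 0" "axis 2 1 = Quat 0 1 0 0" "axis 3 1 = Quat 0 0 1 0" "axis 4 1 = Quat 0 0 0 1"
    by (simp_all add: quat_eq_iff axis_def)
  have "fueter D = axis 1 1 *\<^sub>H D (axis 1 1) + axis 2 1 *\<^sub>H D (axis 2 1) + axis 3 1 *\<^sub>H D (axis 3 1)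
      + axis 4 1 *\<^sub>H D (axis 4 1)"
    by (simp add: fueter_def sum_4)
  also have "\<dots> = D (Quat 1 0 0 0) + u *\<^sub>H U + a *\<^sub>H A + b *\<^sub>H B"
    unfolding De unfolding e u_def a_def b_def by (simp add: quat_eq_iff qmult_def algebra_simps)
  finally show ?thesis
    by (simp add: u_def a_def b_def U_def A_def B_def iota_def iota_beta_eq ca_def sa_def cb_def sb_def)
qed

text \<open>Regularity cancels the first two terms of the frame expansion. The hypothesis
  \<open>p $ 2 \<noteq> 0\<close> forces \<open>sin \<beta> \<noteq> 0\<close>, so the factor
  \<open>sin \<beta>\<close> from differentiating in \<open>\<alpha>\<close> cancels against the
  inverse of \<open>iota_alpha\<close>. The chain rule contributes the factor
  \<open>rad p\<close>.\<close>

lemma fueter_eq_deriv_iota: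
  assumes p: "p \<notin> real_quats" "p $ 2 \<noteq> 0" and f: "(f has_derivative D) (at p)"
    and reg: "deriv_t f p + unit_im p *\<^sub>H deriv_r f p = 0"
  shows "fueter D = - ((1 / rad p) *\<^sub>R deriv_iota f p)"
proof -
  define \<alpha> \<beta> where "\<alpha> = angle_alpha p" and "\<beta> = angle_beta p"
  note lin = has_derivative_linear[OF f]
  have r: "rad p > 0"
    unfolding rad_def using p(2) by (auto intro!: add_pos_nonneg)
  have sph: "spherical (p $ 1) (rad p) \<alpha> \<beta> = p"
    unfolding \<alpha>_def \<beta>_def by (rule spherical_angles[OF p(1)])
  have p2: "p $ 2 = rad p * (cos \<alpha> * sin \<beta>)" and p3: "p $ 3 = rad p * (sin \<alpha> * sin \<beta>)" and p4: "p $ 4 = rad p * cos \<beta>"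
    using arg_cong[OF sph, of "\<lambda>q. q $ 2"] arg_cong[OF sph, of "\<lambda>q. q $ 3"] arg_cong[OF sph, of "\<lambda>q. q $ 4"]
    by (simp_all add: spherical_eq_Quat)
  have sb: "sin \<beta> \<noteq> 0"
    using p(2) p2 by auto
  have u: "unit_im p = iota \<alpha> \<beta>"
    using r by (simp add: unit_im_def iota_def quat_eq_iff p2 p3 p4)
  have pu: "p = Quat (p $ 1) 0 0 0 + rad p *\<^sub>R unit_im p"
    using sph by (simp add: u spherical_def)
  have "deriv_t f p = D (Quat 1 0 0 0)"
  proof -
    have "((\<lambda>s. f (rad p *\<^sub>R unit_im p + s *\<^sub>R Quat 1 0 0 0)) has_vector_derivative D (Quat 1 0 0 0)) (at (p $ 1))"
    proof (rule has_vector_derivative_line)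
      have "rad p *\<^sub>R unit_im p + p $ 1 *\<^sub>R Quat 1 0 0 0 = p"
        using pu by (simp add: quat_eq_iff)
      then show "(f has_derivative D) (at (rad p *\<^sub>R unit_im p + p $ 1 *\<^sub>R Quat 1 0 0 0))"
        using f by simp
    qed
    moreover have "rad p *\<^sub>R unit_im p + s *\<^sub>R Quat 1 0 0 0 = Quat s 0 0 0 + rad p *\<^sub>R unit_im p" for s
      by (simp add: quat_eq_iff)
    ultimately show ?thesis
      unfolding deriv_t_def by (simp add: vector_derivative_at)
  qed
  moreover have "deriv_r f p = D (iota \<alpha> \<beta>)"
    unfolding deriv_r_def u[symmetric]
    by (intro vector_derivative_at has_vector_derivative_line) (use f pu in simp)
  ultimately have reg': "D (Quat 1 0 0 0) + iota \<alpha> \<beta> *\<^sub>H D (iota \<alpha> \<beta>) = 0"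
    using reg by (simp add: u)
  let ?a = "Quat 0 (- sin \<alpha>) (cos \<alpha>) 0" and ?b = "iota_beta \<alpha> \<beta>"
  have fsph: "(f has_derivative D) (at (spherical (p $ 1) (rad p) \<alpha> \<beta>))"
    using f by (simp add: sph)
  have a: "iota_alpha \<alpha> \<beta> = sin \<beta> *\<^sub>R ?a"
    by (simp add: iota_alpha_eq quat_eq_iff)
  have "(norm ?a)\<^sup>2 = 1" "(norm ?b)\<^sup>2 = 1"
  proof -
    show "(norm ?a)\<^sup>2 = 1"
      by (simp add: norm_quat_sq)
    have "(norm ?b)\<^sup>2 = (cos \<beta>)\<^sup>2 * ((cos \<alpha>)\<^sup>2 + (sin \<alpha>)\<^sup>2) + (sin \<beta>)\<^sup>2"
      unfolding norm_quat_sq iota_beta_eq by (simp add: power_mult_distrib algebra_simps del: sin_cos_squared_add2)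
    then show "(norm ?b)\<^sup>2 = 1"
      by simp
  qed
  note norms = this
  have "(norm (iota_alpha \<alpha> \<beta>))\<^sup>2 = (sin \<beta>)\<^sup>2"
    unfolding a norm_scaleR power_mult_distrib norms by simp
  then have qa: "qinv (iota_alpha \<alpha> \<beta>) = - (1 / sin \<beta>) *\<^sub>R ?a"
    using sb unfolding qinv_def by (simp add: a qcnj_def quat_eq_iff power2_eq_square field_simps)
  have qb: "qinv ?b = - ?b"
    unfolding qinv_def norms by (simp add: qcnj_def quat_eq_iff iota_beta_eq)
  have "deriv_iota f p = qinv (iota_alpha \<alpha> \<beta>) *\<^sub>H (rad p *\<^sub>R D (iota_alpha \<alpha> \<beta>)) + qinv ?b *\<^sub>H (rad p *\<^sub>R D ?b)"
    unfolding deriv_iota_def Let_def \<alpha>_def[symmetric] \<beta>_def[symmetric] vector_derivative_spherical[OF fsph] ..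
  also have "\<dots> = - rad p *\<^sub>R (?a *\<^sub>H D ?a + ?b *\<^sub>H D ?b)"
  proof -
    have Da: "D (iota_alpha \<alpha> \<beta>) = sin \<beta> *\<^sub>R D ?a"
      unfolding a by (rule linear_scale[OF lin])
    have "(- (1 / sin \<beta>) *\<^sub>R x) *\<^sub>H (rad p *\<^sub>R (sin \<beta> *\<^sub>R y)) + (- x') *\<^sub>H (rad p *\<^sub>R y')
        = - rad p *\<^sub>R (x *\<^sub>H y + x' *\<^sub>H y')" for x y x' y'
      using sb by (simp add: quat_eq_iff qmult_def field_simps)
    then show ?thesis
      unfolding qa qb Da .
  qed
  finally have "- ((1 / rad p) *\<^sub>R deriv_iota f p) = ?a *\<^sub>H D ?a + ?b *\<^sub>H D ?b"
    using r by simp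
  moreover have "fueter D = ?a *\<^sub>H D ?a + ?b *\<^sub>H D ?b"
    using reg' by (subst fueter_frame[OF lin, of \<alpha> \<beta>]) simp
  ultimately show ?thesis
    by simp
qed

text \<open>A connected set that misses \<open>K\<close> and meets the interior lies in one bounded
  component of the complement, but the real axis is unbounded.\<close>

lemma real_quats_Int_inside:
  assumes "K \<inter> real_quats = {}"
  shows "real_quats \<inter> inside K = {}"
proof (rule ccontr)
  assume "real_quats \<inter> inside K \<noteq> {}"
  then obtain p where p: "p \<in> real_quats" "p \<in> inside K"
    by blast
  have lin: "linear (\<lambda>t. Quat t 0 0 0)"
    by (rule linearI) (simp_all add: quat_eq_iff)
  have "connected real_quats"
    unfolding real_quats_def using lin
    by (intro connected_continuous_image linear_continuous_on) (auto simp: linear_conv_bounded_linear)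
  then have "real_quats \<subseteq> connected_component_set (- K) p"
    using p(1) assms by (intro connected_component_maximal) auto
  then have "bounded real_quats"
    using p(2) bounded_subset by (auto simp: inside_def)
  then obtain B where B: "\<forall>q\<in>real_quats. norm q \<le> B"
    unfolding bounded_iff by blast
  have "norm (Quat (\<bar>B\<bar> + 1) 0 0 0) = \<bar>B\<bar> + 1"
    by (simp add: norm_vec_def L2_set_def sum_4)
  then show False
    using B[THEN bspec, of "Quat (\<bar>B\<bar> + 1) 0 0 0"] by (simp add: real_quats_def)
qed

theorem theorem2:
  fixes K \<Omega> :: "quat set" and n f v :: "quat \<Rightarrow> quat"
  assumes "smooth_simple_closed_hypersurface K"
    and "K \<inter> real_quats = {}"
    and "outward_unit_normal K n"
    and "open \<Omega>" and "connected \<Omega>" and "K \<union> inside K \<subseteq> \<Omega>"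
    and "left_Cullen_regular f \<Omega>"
    and "v = (\<lambda>p. (1/2) *\<^sub>R deriv_iota f p)"
  shows "integrable (surface_measure K) (\<lambda>p. n p *\<^sub>H f p) \<and>
    set_integrable lebesgue (inside K) (\<lambda>p. - ((2 / rad p) *\<^sub>R v p)) \<and>
    (\<integral>p. n p *\<^sub>H f p \<partial>surface_measure K)
      = (LINT p:inside K|lebesgue. - ((2 / rad p) *\<^sub>R v p))"
proof -
  interpret oriented_hypersurface K n
    by unfold_locales (rule assms)+
  define D where "D p = frechet_derivative f (at p)" for p
  have f: "C1_on f D \<Omega>"
    using assms(7) Ck_on_1_imp_C1_on unfolding left_Cullen_regular_def D_def[abs_def] by blast
  \<comment> \<open>The components of the normal are real, so \<open>n f\<close> is the sum of
    \<open>n_i (e_i f)\<close>. The divergence theorem for \<open>e_i f\<close> in direction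
    \<open>e_i\<close> produces the summands of \<open>fueter\<close>, with the units on the correct
    side.\<close>
  let ?g = "\<lambda>i p. axis i 1 *\<^sub>H f p" and ?g' = "\<lambda>i p h. axis i 1 *\<^sub>H D p h"
  have g: "C1_on (?g i) (?g' i) \<Omega>" for i
    unfolding C1_on_def
    by (intro conjI ballI allI bounded_linear.has_derivative[OF bounded_linear_qmult_right]
        bounded_linear.continuous_on[OF bounded_linear_qmult_right] C1_onD[OF f])
  have nf: "n p *\<^sub>H f p = (\<Sum>i\<in>UNIV. (n p \<bullet> axis i 1) *\<^sub>R ?g i p)" for p
  proof -
    have "n p \<bullet> axis i 1 = n p $ i" for i
      by (simp add: inner_axis)
    then show ?thesis
      by (simp add: sum_4 quat_eq_iff qmult_def) (simp add: axis_def algebra_simps)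
  qed
  have int1: "integrable (surface_measure K) (\<lambda>p. (n p \<bullet> axis i 1) *\<^sub>R ?g i p)" for i
  proof (intro integrable_surface continuous_intros continuous_on_normal)
    show "continuous_on K (?g i)"
      using C1_on_continuous[OF g] by (rule continuous_on_subset) (use assms(6) in auto)
  qed
  have int2: "set_integrable lebesgue (inside K) (\<lambda>p. ?g' i p (axis i 1))" for i
    using C1_onD(2)[OF g] assms(6) by (intro set_integrable_inside) (rule continuous_on_subset)
  have int3: "(\<lambda>p. fueter (D p)) absolutely_integrable_on (inside K)"
    unfolding fueter_def by (intro absolutely_integrable_sum int2) simp
  have "(\<integral>p. n p *\<^sub>H f p \<partial>surface_measure K) = (\<Sum>i\<in>UNIV. LINT p:inside K|lebesgue. ?g' i p (axis i 1))"
    unfolding nf Bochner_Integration.integral_sum[OF int1] divergence_theorem[OF assms(4,6) g] ..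
  also have "\<dots> = (LINT p:inside K|lebesgue. fueter (D p))"
    unfolding fueter_def set_lebesgue_integral_def scaleR_sum_right
    using int2 by (intro Bochner_Integration.integral_sum[symmetric]) (simp add: set_integrable_def)
  also have "\<dots> = integral (inside K) (\<lambda>p. fueter (D p))"
    using int3 by (rule set_lebesgue_integral_eq_integral(2))
  finally have eq1: "(\<integral>p. n p *\<^sub>H f p \<partial>surface_measure K) = integral (inside K) (\<lambda>p. fueter (D p))" .
  \<comment> \<open>This null hyperplane contains the plane where the spherical coordinates
    degenerate.\<close>
  have neg: "negligible {p :: quat. p $ 2 = 0}"
    by (rule negligible_standard_hyperplane_cart)
  have eq: "- ((2 / rad p) *\<^sub>R v p) = fueter (D p)" if p: "p \<in> inside K - {p. p $ 2 = 0}" for p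
  proof -
    have "p \<notin> real_quats" "p \<in> \<Omega>"
      using real_quats_Int_inside[OF assms(2)] p assms(6) by auto
    moreover from this have "deriv_t f p + unit_im p *\<^sub>H deriv_r f p = 0"
      using assms(7) by (simp add: left_Cullen_regular_def)
    ultimately have "fueter (D p) = - ((1 / rad p) *\<^sub>R deriv_iota f p)"
      using p C1_onD(1)[OF f] by (intro fueter_eq_deriv_iota) auto
    then show ?thesis
      by (simp add: assms(8))
  qed
  \<comment> \<open>Integrability cannot be read off from \<open>deriv_iota f\<close>, which is
    uncontrolled on the degenerate set; it passes over from the continuous function
    \<open>fueter (D p)\<close>.\<close>
  have int4: "(\<lambda>p. - ((2 / rad p) *\<^sub>R v p)) absolutely_integrable_on (inside K)"
    using int3 neg eq by (rule absolutely_integrable_spike)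
  have "integral (inside K) (\<lambda>p. fueter (D p)) = integral (inside K) (\<lambda>p. - ((2 / rad p) *\<^sub>R v p))"
    using neg eq by (rule integral_spike)
  also have "\<dots> = (LINT p:inside K|lebesgue. - ((2 / rad p) *\<^sub>R v p))"
    using int4 by (rule set_lebesgue_integral_eq_integral(2)[symmetric])
  finally have eq2: "integral (inside K) (\<lambda>p. fueter (D p)) = (LINT p:inside K|lebesgue. - ((2 / rad p) *\<^sub>R v p))" .
  have int5: "integrable (surface_measure K) (\<lambda>p. n p *\<^sub>H f p)"
    unfolding nf by (intro Bochner_Integration.integrable_sum int1)
  show ?thesis
    by (intro conjI int5 int4 trans[OF eq1 eq2])
qed

end
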